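(* Let $\mathbb{O}$ be the algebra of octonions, $\mathbb{O}_{\mathbb{C}}=\mathbb{O}\otimes_{\mathbb{R}}\mathbb{C}$ its complexification and $G_{\mathbb{C}}=\mathrm{Aut}(\mathbb{O}_{\mathbb{C}})$ the group of $\mathbb{C}$-algebra automorphisms of $\mathbb{O}_{\mathbb{C}}$. Let $D\subset\mathbb{C}$ be a symmetric domain and let $\Omega_D\subset\mathbb{O}$ be the corresponding axially symmetric domain. Let $f,h:\Omega_D\to\mathbb{O}$ be slice regular functions and let $F,H:D\to\mathbb{O}_{\mathbb{C}}$ be the corresponding stem functions. (a) Assume that neither $f$ nor $h$ is slice preserving. Then the following are equivalent: (i) $f$ and $h$ have the same invariants, i.e. $\mathrm{cdiv}(f)=\mathrm{cdiv}(h)$, $\mathrm{Tr}(f)=\mathrm{Tr}(h)$, $\mathrm{N}(f)=\mathrm{N}(h)$. (ii) $F$ and $H$ have the same invariants, i.e. $\mathrm{cdiv}(F)=\mathrm{cdiv}(H)$, $\mathrm{Tr}(F)=\mathrm{Tr}(H)$, $\mathrm{N}(F)=\mathrm{N}(H)$. (iii) $\mathrm{cdiv}(F)=\mathrm{cdiv}(H)$ and for every $z\in D$ there exists an element $\alpha\in G_{\mathbb{C}}$ such that $F(z)=\alpha(H(z))$. (iv) There is a holomorphic map $\phi:D\to G_{\mathbb{C}}$ such that $F(z)=\phi(z)(H(z))$ for all $z\in D$. (b) Assume that $f$ is slice preserving. Then the following are equivalent: (i) $f=h$. (ii) $F=H$. (iii) For every $z\in D$ there exists an element $\alpha\in G_{\mathbb{C}}$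 such that $F(z)=\alpha(H(z))$. (iv) There is a holomorphic map $\phi:D\to G_{\mathbb{C}}$ such that $F(z)=\phi(z)(H(z))$ for all $z\in D$.
   Context: A domain $D\subset\mathbb{C}$ is symmetric if $z\in D\iff\bar z\in D$. Put $\mathbb{S}_{\mathbb{O}}=\{q\in\mathbb{O}:q^2=-1\}$; the axially symmetric domain associated to $D$ is $\Omega_D=\{x+yJ: x,y\in\mathbb{R},\ J\in\mathbb{S}_{\mathbb{O}},\ x+yi\in D\}$. Elements of $\mathbb{O}_{\mathbb{C}}$ are written $a+\iota b$ with $a,b\in\mathbb{O}$, where $\iota$ is the imaginary unit of the factor $\mathbb{C}$. There are two conjugations on $\mathbb{O}_{\mathbb{C}}$: complex conjugation $\overline{a+\iota b}=a-\iota b$ (conjugating the factor $\mathbb{C}$), and octonionic conjugation $(a+\iota b)^c=\bar a+\iota\bar b$, the $\mathbb{C}$-linear extension of the octonion conjugation $a\mapsto\bar a$. $G_{\mathbb{C}}$ is a complex Lie group (a complex Lie subgroup of $GL_{\mathbb{C}}(\mathbb{O}_{\mathbb{C}})$). A stem function is a function $F:D\to\mathbb{O}_{\mathbb{C}}$ with $\overline{F(\bar z)}=F(z)$ for all $z\in D$ (complex conjugation on $\mathbb{O}_{\mathbb{C}}$). A function $f:\Omega_D\to\mathbb{O}$ is a slice function if there is a stem function $F=F_1+\iota F_2$ ($F_i:D\to\mathbb{O}$) with $f(x+yJ)=F_1(x+yi)+J F_2(x+yi)$ for all $x+yi\in D$, $J\in\mathbb{S}_{\mathbb{O}}$; $F$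 is the stem function corresponding to $f$. $f$ is slice regular if $F$ is holomorphic. The $*$-product $f*g$ of slice regular functions with stem functions $F,G$ is the slice regular function with stem function $z\mapsto F(z)G(z)$. For a stem function $F$, $F^c(z)=(F(z))^c$ (octonionic conjugation); for a slice regular $f$ with stem function $F$, $f^c$ is the slice regular function with stem function $F^c$. Trace and norm are $\mathrm{Tr}(F)=F+F^c$, $\mathrm{N}(F)=FF^c$ (pointwise product), and $\mathrm{Tr}(f)=f+f^c$, $\mathrm{N}(f)=f*f^c$. The slice regular function $f$ is slice preserving if $f=f^c$; equivalently $F=F^c$; equivalently $F(D)\subset\mathbb{R}\otimes_{\mathbb{R}}\mathbb{C}$. Divisor of a vector-valued map: for a holomorphic map $F=(F_1,\dots,F_n):X\to\mathbb{C}^n$ on a Riemann surface $X$ with $F\not\equiv0$, its divisor is $\sum_{p\in X}m_p\{p\}$, where $m_p$ is the minimum over $i$ of the vanishing orders of $F_i$ at $p$. Central divisor: let $C_{\mathbb{C}}=\mathbb{R}\otimes_{\mathbb{R}}\mathbb{C}\simeq\mathbb{C}$ be the center of $\mathbb{O}_{\mathbb{C}}$. For a holomorphic map $F:D\to\mathbb{O}_{\mathbb{C}}$ with $F(D)\not\subset C_{\mathbb{C}}$, $\mathrm{cdiv}(F)$ is the divisor of the induced map $D\to\mathbb{O}_{\mathbb{C}}/C_{\mathbb{C}}$. For a slice regular function $f$ which is not slice preserving, with stem function $F$, $\mathrm{cdiv}(f):=\mathrm{cdiv}(F)$ (a divisor on $D$). *)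

theory Defs
  imports "HOL-Complex_Analysis.Complex_Analysis"
begin

text \<open>\<open>$\<close> is also notation for power series coefficients; here it is only \<open>vec_nth\<close>.\<close>

no_notation fps_nth (infixl "$" 75)

section \<open>Octonions and their complexification\<close>

text \<open>
  The octonion algebra over a commutative ring, in coordinates with respect to a basis
  \<open>e\<^sub>0 = 1, e\<^sub>1, \<dots>, e\<^sub>7\<close>. The structure constants are integers, so the product on
  \<open>complex ^ 8\<close> is the \<open>\<complex>\<close>-bilinear extension of the product on \<open>real ^ 8\<close>; hence
  \<open>complex ^ 8\<close> is \<open>\<O> \<otimes>\<^sub>\<real> \<complex>\<close> (see \<open>complexify_oct_mult\<close> below). The componentwise
  product \<open>*\<close> and unit \<open>1\<close> that the library provides on vectors are not used.
\<close>

type_synonym octonion = "real ^ 8"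
type_synonym octonion_C = "complex ^ 8"

text \<open>In the type \<open>8\<close> we have \<open>8 = 0\<close>, so the last entry of the list is coordinate \<open>0\<close>.\<close>

definition oct :: "'a \<Rightarrow> 'a \<Rightarrow> 'a \<Rightarrow> 'a \<Rightarrow> 'a \<Rightarrow> 'a \<Rightarrow> 'a \<Rightarrow> 'a \<Rightarrow> ('a::zero) ^ 8" where
  "oct a0 a1 a2 a3 a4 a5 a6 a7 = vector [a1, a2, a3, a4, a5, a6, a7, a0]"

definition oct_one :: "'a::zero_neq_one ^ 8" where
  "oct_one = oct 1 0 0 0 0 0 0 0"

text \<open>
  \<open>e\<^sub>i e\<^sub>i = -1\<close> and \<open>e\<^sub>i e\<^sub>j = e\<^sub>k = - e\<^sub>j e\<^sub>i\<close> for \<open>(i, j, k)\<close> a cyclic permutation of one of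
  \<open>(1,2,4), (2,3,5), (3,4,6), (4,5,7), (5,6,1), (6,7,2), (7,1,3)\<close>.
\<close>

definition oct_mult :: "'a::comm_ring_1 ^ 8 \<Rightarrow> 'a ^ 8 \<Rightarrow> 'a ^ 8" (infixl "\<odot>" 70) where
  "x \<odot> y = oct
     (x$0 * y$0 - x$1 * y$1 - x$2 * y$2 - x$3 * y$3 - x$4 * y$4 - x$5 * y$5 - x$6 * y$6 - x$7 * y$7)
     (x$0 * y$1 + x$1 * y$0 + (x$2 * y$4 - x$4 * y$2) + (x$3 * y$7 - x$7 * y$3) + (x$5 * y$6 - x$6 * y$5))
     (x$0 * y$2 + x$2 * y$0 + (x$3 * y$5 - x$5 * y$3) + (x$4 * y$1 - x$1 * y$4) + (x$6 * y$7 - x$7 * y$6))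
     (x$0 * y$3 + x$3 * y$0 + (x$4 * y$6 - x$6 * y$4) + (x$5 * y$2 - x$2 * y$5) + (x$7 * y$1 - x$1 * y$7))
     (x$0 * y$4 + x$4 * y$0 + (x$5 * y$7 - x$7 * y$5) + (x$6 * y$3 - x$3 * y$6) + (x$1 * y$2 - x$2 * y$1))
     (x$0 * y$5 + x$5 * y$0 + (x$6 * y$1 - x$1 * y$6) + (x$7 * y$4 - x$4 * y$7) + (x$2 * y$3 - x$3 * y$2))
     (x$0 * y$6 + x$6 * y$0 + (x$7 * y$2 - x$2 * y$7) + (x$1 * y$5 - x$5 * y$1) + (x$3 * y$4 - x$4 * y$3))
     (x$0 * y$7 + x$7 * y$0 + (x$1 * y$3 - x$3 * y$1) + (x$2 * y$6 - x$6 * y$2) + (x$4 * y$5 - x$5 * y$4))"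

text \<open>Octonionic conjugation, on \<open>\<O>\<close> and (\<open>\<complex>\<close>-linearly) on \<open>\<O>\<^sub>\<complex>\<close>.\<close>

definition oct_conj :: "'a::comm_ring_1 ^ 8 \<Rightarrow> 'a ^ 8" where
  "oct_conj x = (\<chi> i. if i = 0 then x $ i else - x $ i)"

text \<open>\<open>complexify a b\<close> is the element \<open>a + \<iota> b\<close> of \<open>\<O>\<^sub>\<complex>\<close>.\<close>

definition complexify :: "octonion \<Rightarrow> octonion \<Rightarrow> octonion_C" where
  "complexify a b = (\<chi> i. Complex (a $ i) (b $ i))"

definition octC_Re :: "octonion_C \<Rightarrow> octonion" where
  "octC_Re w = (\<chi> i. Re (w $ i))"

definition octC_Im :: "octonion_C \<Rightarrow> octonion" where
  "octC_Im w = (\<chi> i. Im (w $ i))"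

definition octC_cnj :: "octonion_C \<Rightarrow> octonion_C" where
  "octC_cnj w = complexify (octC_Re w) (- octC_Im w)"

text \<open>\<open>C\<^sub>\<complex> = \<real> \<otimes>\<^sub>\<real> \<complex>\<close>, the center of \<open>\<O>\<^sub>\<complex>\<close>.\<close>

definition center_C :: "octonion_C set" where
  "center_C = range (\<lambda>c. c *s oct_one)"

text \<open>The quotient map \<open>\<O>\<^sub>\<complex> \<rightarrow> \<O>\<^sub>\<complex> / C\<^sub>\<complex> \<cong> \<complex>\<^sup>7\<close>, in the basis given by the classes of
  \<open>e\<^sub>1, \<dots>, e\<^sub>7\<close>.\<close>

definition mod_center :: "octonion_C \<Rightarrow> complex ^ 7" where
  "mod_center w = vector [w$1, w$2, w$3, w$4, w$5, w$6, w$7]"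

definition G_C :: "(octonion_C \<Rightarrow> octonion_C) set" where
  "G_C = {\<alpha>. Vector_Spaces.linear (*s) (*s) \<alpha> \<and> bij \<alpha> \<and> (\<forall>x y. \<alpha> (x \<odot> y) = \<alpha> x \<odot> \<alpha> y)}"


section \<open>Holomorphic maps and divisors\<close>

definition vec_holomorphic_on :: "(complex \<Rightarrow> complex ^ 'n) \<Rightarrow> complex set \<Rightarrow> bool" where
  "vec_holomorphic_on F D \<longleftrightarrow> (\<forall>i. (\<lambda>z. F z $ i) holomorphic_on D)"

text \<open>\<open>G\<^sub>\<complex>\<close> is a complex Lie subgroup of the open set \<open>GL\<^sub>\<complex>(\<O>\<^sub>\<complex>)\<close> in the space of complex
  matrices, so holomorphy of a map into it is holomorphy of the matrix entries.\<close>

definition holomorphic_into_G_C :: "complex set \<Rightarrow> (complex \<Rightarrow> octonion_C \<Rightarrow> octonion_C) \<Rightarrow> bool" where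
  "holomorphic_into_G_C D \<phi> \<longleftrightarrow>
     (\<forall>z\<in>D. \<phi> z \<in> G_C) \<and> (\<forall>i j. (\<lambda>z. matrix (\<phi> z) $ i $ j) holomorphic_on D)"

text \<open>
  The divisor \<open>\<Sum> m\<^sub>p {p}\<close> of a holomorphic map \<open>D \<rightarrow> \<complex>\<^sup>n\<close> that is not identically zero, as the
  function \<open>p \<mapsto> m\<^sub>p\<close> (and \<open>0\<close> off \<open>D\<close>). Components vanishing identically on the domain \<open>D\<close> have
  vanishing order \<open>\<infinity>\<close> and do not contribute to the minimum; they are left out because \<open>zorder\<close>
  is meaningless for them.
\<close>

definition divisor :: "complex set \<Rightarrow> (complex \<Rightarrow> complex ^ 'n) \<Rightarrow> complex \<Rightarrow> int" where
  "divisor D F p =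
     (if p \<in> D then Min {zorder (\<lambda>z. F z $ i) p | i. \<exists>z\<in>D. F z $ i \<noteq> 0} else 0)"

definition cdiv :: "complex set \<Rightarrow> (complex \<Rightarrow> octonion_C) \<Rightarrow> complex \<Rightarrow> int" where
  "cdiv D F = divisor D (\<lambda>z. mod_center (F z))"


section \<open>Stem functions and slice functions\<close>

definition symmetric_domain :: "complex set \<Rightarrow> bool" where
  "symmetric_domain D \<longleftrightarrow> open D \<and> connected D \<and> D \<noteq> {} \<and> (\<forall>z. z \<in> D \<longleftrightarrow> cnj z \<in> D)"

definition sphere_O :: "octonion set" where
  "sphere_O = {q. q \<odot> q = - oct_one}"

definition axial :: "real \<Rightarrow> real \<Rightarrow> octonion \<Rightarrow> octonion" where
  "axial x y J = x *\<^sub>R oct_one + y *\<^sub>R J"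

definition axial_domain :: "complex set \<Rightarrow> octonion set" where
  "axial_domain D = {axial x y J | x y J. J \<in> sphere_O \<and> Complex x y \<in> D}"

definition stem_function :: "complex set \<Rightarrow> (complex \<Rightarrow> octonion_C) \<Rightarrow> bool" where
  "stem_function D F \<longleftrightarrow> (\<forall>z\<in>D. octC_cnj (F (cnj z)) = F z)"

text \<open>
  Functions on \<open>D\<close> and on \<open>axial_domain D\<close> are modelled by total functions whose values
  elsewhere are irrelevant; equality of such functions always means equality on the domain.
\<close>

definition corresponding_stem ::
    "complex set \<Rightarrow> (octonion \<Rightarrow> octonion) \<Rightarrow> (complex \<Rightarrow> octonion_C) \<Rightarrow> bool" where
  "corresponding_stem D f F \<longleftrightarrow> stem_function D F \<and>
     (\<forall>x y J. J \<in> sphere_O \<longrightarrow> Complex x y \<in> D \<longrightarrow>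
        f (axial x y J) = octC_Re (F (Complex x y)) + J \<odot> octC_Im (F (Complex x y)))"

definition slice_function :: "complex set \<Rightarrow> (octonion \<Rightarrow> octonion) \<Rightarrow> bool" where
  "slice_function D f \<longleftrightarrow> (\<exists>F. corresponding_stem D f F)"

definition slice_regular :: "complex set \<Rightarrow> (octonion \<Rightarrow> octonion) \<Rightarrow> bool" where
  "slice_regular D f \<longleftrightarrow> (\<exists>F. corresponding_stem D f F \<and> vec_holomorphic_on F D)"

text \<open>The corresponding stem function, unique on \<open>D\<close> by \<open>corresponding_stem_unique\<close> below.\<close>

definition stem_of :: "complex set \<Rightarrow> (octonion \<Rightarrow> octonion) \<Rightarrow> complex \<Rightarrow> octonion_C" where
  "stem_of D f = (SOME F. corresponding_stem D f F)"

text \<open>The slice function with a given stem function, see \<open>corresponding_stem_slice_of\<close> below.\<close>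

definition slice_of :: "(complex \<Rightarrow> octonion_C) \<Rightarrow> octonion \<Rightarrow> octonion" where
  "slice_of F q = (THE w. \<forall>x y J. J \<in> sphere_O \<and> q = axial x y J \<longrightarrow>
     w = octC_Re (F (Complex x y)) + J \<odot> octC_Im (F (Complex x y)))"


section \<open>Conjugation, trace, norm and central divisor\<close>

definition stem_conj :: "(complex \<Rightarrow> octonion_C) \<Rightarrow> complex \<Rightarrow> octonion_C" where
  "stem_conj F = (\<lambda>z. oct_conj (F z))"

definition stem_Tr :: "(complex \<Rightarrow> octonion_C) \<Rightarrow> complex \<Rightarrow> octonion_C" where
  "stem_Tr F = (\<lambda>z. F z + stem_conj F z)"

definition stem_N :: "(complex \<Rightarrow> octonion_C) \<Rightarrow> complex \<Rightarrow> octonion_C" where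
  "stem_N F = (\<lambda>z. F z \<odot> stem_conj F z)"

definition slice_conj :: "complex set \<Rightarrow> (octonion \<Rightarrow> octonion) \<Rightarrow> octonion \<Rightarrow> octonion" where
  "slice_conj D f = slice_of (stem_conj (stem_of D f))"

definition slice_star ::
    "complex set \<Rightarrow> (octonion \<Rightarrow> octonion) \<Rightarrow> (octonion \<Rightarrow> octonion) \<Rightarrow> octonion \<Rightarrow> octonion" where
  "slice_star D f g = slice_of (\<lambda>z. stem_of D f z \<odot> stem_of D g z)"

definition slice_Tr :: "complex set \<Rightarrow> (octonion \<Rightarrow> octonion) \<Rightarrow> octonion \<Rightarrow> octonion" where
  "slice_Tr D f = (\<lambda>q. f q + slice_conj D f q)"

definition slice_N :: "complex set \<Rightarrow> (octonion \<Rightarrow> octonion) \<Rightarrow> octonion \<Rightarrow> octonion" where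
  "slice_N D f = slice_star D f (slice_conj D f)"

definition slice_preserving :: "complex set \<Rightarrow> (octonion \<Rightarrow> octonion) \<Rightarrow> bool" where
  "slice_preserving D f \<longleftrightarrow> (\<forall>q\<in>axial_domain D. f q = slice_conj D f q)"

definition slice_cdiv :: "complex set \<Rightarrow> (octonion \<Rightarrow> octonion) \<Rightarrow> complex \<Rightarrow> int" where
  "slice_cdiv D f = cdiv D (stem_of D f)"

definition same_slice_invariants ::
    "complex set \<Rightarrow> (octonion \<Rightarrow> octonion) \<Rightarrow> (octonion \<Rightarrow> octonion) \<Rightarrow> bool" where
  "same_slice_invariants D f h \<longleftrightarrow>
     slice_cdiv D f = slice_cdiv D h \<and>
     (\<forall>q\<in>axial_domain D. slice_Tr D f q = slice_Tr D h q) \<and>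
     (\<forall>q\<in>axial_domain D. slice_N D f q = slice_N D h q)"

definition same_stem_invariants ::
    "complex set \<Rightarrow> (complex \<Rightarrow> octonion_C) \<Rightarrow> (complex \<Rightarrow> octonion_C) \<Rightarrow> bool" where
  "same_stem_invariants D F H \<longleftrightarrow>
     cdiv D F = cdiv D H \<and>
     (\<forall>z\<in>D. stem_Tr F z = stem_Tr H z) \<and>
     (\<forall>z\<in>D. stem_N F z = stem_N H z)"

definition all_equivalent :: "bool list \<Rightarrow> bool" where
  "all_equivalent Ps \<longleftrightarrow> (\<forall>P\<in>set Ps. \<forall>Q\<in>set Ps. P \<longleftrightarrow> Q)"


section \<open>Consistency of the definitions\<close>

lemma exhaust_7:
  fixes i :: 7
  shows "i = 0 \<or> i = 1 \<or> i = 2 \<or> i = 3 \<or> i = 4 \<or> i = 5 \<or> i = 6"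
proof (induct i)
  case (of_int z)
  then have "z = 0 \<or> z = 1 \<or> z = 2 \<or> z = 3 \<or> z = 4 \<or> z = 5 \<or> z = 6" by fastforce
  then show ?case by auto
qed

lemma exhaust_8:
  fixes i :: 8
  shows "i = 0 \<or> i = 1 \<or> i = 2 \<or> i = 3 \<or> i = 4 \<or> i = 5 \<or> i = 6 \<or> i = 7"
proof (induct i)
  case (of_int z)
  then have "z = 0 \<or> z = 1 \<or> z = 2 \<or> z = 3 \<or> z = 4 \<or> z = 5 \<or> z = 6 \<or> z = 7" by fastforce
  then show ?case by auto
qed

lemma forall_7: "(\<forall>i::7. P i) \<longleftrightarrow> P 0 \<and> P 1 \<and> P 2 \<and> P 3 \<and> P 4 \<and> P 5 \<and> P 6"
  by (metis exhaust_7)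

lemma forall_8: "(\<forall>i::8. P i) \<longleftrightarrow> P 0 \<and> P 1 \<and> P 2 \<and> P 3 \<and> P 4 \<and> P 5 \<and> P 6 \<and> P 7"
  by (metis exhaust_8)

lemma sum_8: "(\<Sum>i\<in>(UNIV::8 set). g i) = g 0 + g 1 + g 2 + g 3 + g 4 + g 5 + g 6 + g 7"
proof -
  have UNIV_8: "(UNIV::8 set) = {0, 1, 2, 3, 4, 5, 6, 7}"
    using exhaust_8 by auto
  show ?thesis
    unfolding UNIV_8 by (simp add: add.assoc)
qed

lemma oct_component [simp]:
  "oct a0 a1 a2 a3 a4 a5 a6 a7 $ 0 = a0" "oct a0 a1 a2 a3 a4 a5 a6 a7 $ 1 = a1"
  "oct a0 a1 a2 a3 a4 a5 a6 a7 $ 2 = a2" "oct a0 a1 a2 a3 a4 a5 a6 a7 $ 3 = a3"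
  "oct a0 a1 a2 a3 a4 a5 a6 a7 $ 4 = a4" "oct a0 a1 a2 a3 a4 a5 a6 a7 $ 5 = a5"
  "oct a0 a1 a2 a3 a4 a5 a6 a7 $ 6 = a6" "oct a0 a1 a2 a3 a4 a5 a6 a7 $ 7 = a7"
  by (simp_all add: oct_def vector_def)

lemma mod_center_component [simp]:
  "mod_center w $ 1 = w $ 1" "mod_center w $ 2 = w $ 2" "mod_center w $ 3 = w $ 3"
  "mod_center w $ 4 = w $ 4" "mod_center w $ 5 = w $ 5" "mod_center w $ 6 = w $ 6"
  "mod_center w $ 0 = w $ 7"
  by (simp_all add: mod_center_def vector_def)

lemma oct_one_mult: "oct_one \<odot> x = x" and oct_mult_one: "x \<odot> oct_one = x"
  by (simp_all add: vec_eq_iff forall_8 oct_mult_def oct_one_def)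

text \<open>The eight-square identity: together with the unit laws and bilinearity, the real algebra is
  an 8-dimensional normed division algebra, i.e. the octonions.\<close>

lemma oct_composition:
  fixes x y :: "'a::comm_ring_1 ^ 8"
  shows "(\<Sum>i\<in>UNIV. ((x \<odot> y) $ i)\<^sup>2) = (\<Sum>i\<in>UNIV. (x $ i)\<^sup>2) * (\<Sum>i\<in>UNIV. (y $ i)\<^sup>2)"
  unfolding sum_8 oct_mult_def oct_component
  by (simp add: power2_eq_square algebra_simps)

lemma complexify_oct_mult:
  "complexify a b \<odot> complexify c d = complexify (a \<odot> c - b \<odot> d) (a \<odot> d + b \<odot> c)"
  by (simp add: vec_eq_iff forall_8 oct_mult_def complexify_def complex_eq_iff)

lemma complexify_oct_conj: "oct_conj (complexify a b) = complexify (oct_conj a) (oct_conj b)"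
  by (simp add: vec_eq_iff oct_conj_def complexify_def complex_eq_iff)

lemma complexify_Re_Im: "complexify (octC_Re w) (octC_Im w) = w"
  by (simp add: vec_eq_iff complexify_def octC_Re_def octC_Im_def)

lemma octC_Re_complexify [simp]: "octC_Re (complexify a b) = a"
  and octC_Im_complexify [simp]: "octC_Im (complexify a b) = b"
  by (simp_all add: vec_eq_iff complexify_def octC_Re_def octC_Im_def)

lemma center_C_eq_kernel: "center_C = {w. mod_center w = 0}"
proof -
  have "w \<in> center_C \<longleftrightarrow> (\<exists>c. w = c *s oct_one)" for w
    by (auto simp: center_C_def)
  then show ?thesis
    by (auto simp: vec_eq_iff forall_7 forall_8 oct_one_def)
qed

lemma center_C_eq_center: "center_C = {w. \<forall>x. w \<odot> x = x \<odot> w}"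
proof (intro equalityI subsetI CollectI allI)
  fix w x assume "w \<in> center_C"
  then show "w \<odot> x = x \<odot> w"
    by (auto simp: center_C_def vec_eq_iff forall_8 oct_mult_def oct_one_def)
next
  fix w :: octonion_C assume w: "w \<in> {w. \<forall>x. w \<odot> x = x \<odot> w}"
  have "w \<odot> oct 0 1 0 0 0 0 0 0 = oct 0 1 0 0 0 0 0 0 \<odot> w"
    and "w \<odot> oct 0 0 1 0 0 0 0 0 = oct 0 0 1 0 0 0 0 0 \<odot> w"
    using w by simp_all
  then have "w $ 1 = 0 \<and> w $ 2 = 0 \<and> w $ 3 = 0 \<and> w $ 4 = 0 \<and> w $ 5 = 0 \<and> w $ 6 = 0 \<and> w $ 7 = 0"
    by (auto simp: vec_eq_iff forall_8 oct_mult_def complex_eq_iff)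
  then show "w \<in> center_C"
    by (simp add: center_C_eq_kernel vec_eq_iff forall_7)
qed

lemma sphere_O_iff: "J \<in> sphere_O \<longleftrightarrow> J $ 0 = 0 \<and> (\<Sum>i\<in>UNIV. (J $ i)\<^sup>2) = 1"
proof
  assume "J \<in> sphere_O"
  then have J: "J \<odot> J = - oct_one" by (simp add: sphere_O_def)
  have k: "i \<noteq> 0 \<Longrightarrow> J $ 0 = 0 \<or> J $ i = 0" for i
    using J exhaust_8[of i] by (auto simp: vec_eq_iff forall_8 oct_mult_def oct_one_def)
  have r: "J$0 * J$0 - J$1 * J$1 - J$2 * J$2 - J$3 * J$3 - J$4 * J$4 - J$5 * J$5 - J$6 * J$6
            - J$7 * J$7 = -1"
    using J by (simp_all add: vec_eq_iff forall_8 oct_mult_def oct_one_def)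
  have "J $ 0 = 0"
  proof (rule ccontr)
    assume "J $ 0 \<noteq> 0"
    then have "J$0 * J$0 = -1" using k[of 1] k[of 2] k[of 3] k[of 4] k[of 5] k[of 6] k[of 7] r by simp
    then show False using zero_le_square[of "J $ 0"] by linarith
  qed
  then show "J $ 0 = 0 \<and> (\<Sum>i\<in>UNIV. (J $ i)\<^sup>2) = 1"
    using r by (simp add: sum_8 power2_eq_square)
next
  assume J: "J $ 0 = 0 \<and> (\<Sum>i\<in>UNIV. (J $ i)\<^sup>2) = 1"
  then have "- (J$1 * J$1) - J$2 * J$2 - J$3 * J$3 - J$4 * J$4 - J$5 * J$5 - J$6 * J$6 - J$7 * J$7 = -1"
    by (auto simp: sum_8 power2_eq_square)
  with J show "J \<in> sphere_O"
    by (simp add: sphere_O_def vec_eq_iff forall_8 oct_mult_def oct_one_def)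
qed

lemma sphere_O_uminus: "J \<in> sphere_O \<Longrightarrow> - J \<in> sphere_O"
  by (simp add: sphere_O_iff)

lemma sphere_O_nonempty: "oct 0 1 0 0 0 0 0 0 \<in> sphere_O"
  by (simp add: sphere_O_iff sum_8)

lemma axial_component:
  assumes "J \<in> sphere_O"
  shows "axial x y J $ 0 = x" and "i \<noteq> 0 \<Longrightarrow> axial x y J $ i = y * J $ i"
  using assms exhaust_8[of i] by (auto simp: axial_def sphere_O_iff oct_one_def)

lemma axial_eqD:
  assumes J: "J \<in> sphere_O" and J': "J' \<in> sphere_O" and eq: "axial x y J = axial x' y' J'"
  shows "x = x' \<and> (y = y' \<and> J = J' \<or> y = - y' \<and> J = - J' \<or> y = 0 \<and> y' = 0)"
proof -
  have x: "x = x'"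
    using axial_component(1)[OF J, of x y] axial_component(1)[OF J', of x' y'] eq by simp
  have yJ: "y * J $ i = y' * J' $ i" for i
    using axial_component(2)[OF J, of i x y] axial_component(2)[OF J', of i x' y'] eq J J'
    by (cases "i = 0") (simp_all add: sphere_O_iff)
  have "y\<^sup>2 * (\<Sum>i\<in>UNIV. (J $ i)\<^sup>2) = y'\<^sup>2 * (\<Sum>i\<in>UNIV. (J' $ i)\<^sup>2)"
    unfolding sum_distrib_left power_mult_distrib[symmetric] yJ ..
  then have "y = y' \<or> y = - y'"
    using J J' by (simp add: sphere_O_iff power2_eq_iff)
  then show ?thesis
  proof (cases "y' = 0")
    case False
    from \<open>y = y' \<or> y = - y'\<close> show ?thesis
    proof
      assume "y = y'"
      then have "J = J'" using yJ False by (simp add: vec_eq_iff)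
      then show ?thesis using x \<open>y = y'\<close> by simp
    next
      assume y: "y = - y'"
      have "J $ i = - J' $ i" for i
      proof -
        have "y' * (J $ i + J' $ i) = 0" using yJ[of i] y by (simp add: algebra_simps)
        then show ?thesis using False by simp
      qed
      then have "J = - J'" by (simp add: vec_eq_iff)
      then show ?thesis using x y by simp
    qed
  qed (use x in auto)
qed

lemma stem_function_cnj:
  assumes "stem_function D F" "z \<in> D"
  shows "octC_Re (F (cnj z)) = octC_Re (F z)" and "octC_Im (F (cnj z)) = - octC_Im (F z)"
proof -
  have "octC_cnj (F (cnj z)) = F z"
    using assms by (simp add: stem_function_def)
  then have "octC_Re (octC_cnj (F (cnj z))) = octC_Re (F z)"
    and "octC_Im (octC_cnj (F (cnj z))) = octC_Im (F z)"
    by simp_all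
  then show "octC_Re (F (cnj z)) = octC_Re (F z)" and "octC_Im (F (cnj z)) = - octC_Im (F z)"
    by (auto simp: octC_cnj_def minus_equation_iff)
qed

lemma oct_mult_uminus_left: "(- x) \<odot> y = - (x \<odot> y)"
  and oct_mult_uminus_right: "x \<odot> (- y) = - (x \<odot> y)"
  by (simp_all add: vec_eq_iff forall_8 oct_mult_def)

lemma oct_mult_zero_right: "x \<odot> 0 = 0"
  by (simp add: vec_eq_iff forall_8 oct_mult_def)

lemma corresponding_stem_slice_of:
  assumes F: "stem_function D F"
  shows "corresponding_stem D (slice_of F) F"
  unfolding corresponding_stem_def
proof (intro conjI allI impI F)
  fix x y :: real and J :: octonion
  assume J: "J \<in> sphere_O" and z: "Complex x y \<in> D"
  let ?w = "\<lambda>x y J. octC_Re (F (Complex x y)) + J \<odot> octC_Im (F (Complex x y))"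
  have "?w x y J = ?w x' y' J'"
    if J': "J' \<in> sphere_O" and eq: "axial x y J = axial x' y' J'" for x' y' J'
  proof -
    from axial_eqD[OF J J' eq] consider "x' = x" "y' = y" "J' = J" | "x' = x" "y' = - y" "J' = - J"
      | "x' = x" "y = 0" "y' = 0" by auto
    then show ?thesis
    proof cases
      case 2
      have "Complex x' y' = cnj (Complex x y)" using 2 by (simp add: complex_eq_iff)
      then show ?thesis
        using stem_function_cnj[OF F z] 2
        by (simp add: oct_mult_uminus_left oct_mult_uminus_right)
    next
      case 3
      have "cnj (Complex x y) = Complex x y" using 3 by (simp add: complex_eq_iff)
      then have "octC_Im (F (Complex x y)) = - octC_Im (F (Complex x y))"
        using stem_function_cnj(2)[OF F z] by simp
      then have "octC_Im (F (Complex x y)) = 0"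
        by (simp add: vec_eq_iff)
      then show ?thesis using 3 by (simp add: oct_mult_zero_right)
    qed simp
  qed
  then show "slice_of F (axial x y J) = ?w x y J"
    unfolding slice_of_def using J by (intro the_equality) metis+
qed

lemma corresponding_stem_unique:
  assumes F: "corresponding_stem D f F" and G: "corresponding_stem D f G" and z: "z \<in> D"
  shows "F z = G z"
proof -
  obtain x y where xy: "z = Complex x y" by (cases z)
  let ?e = "oct 0 1 0 0 0 0 0 0 :: octonion"
  note e = sphere_O_nonempty sphere_O_uminus[OF sphere_O_nonempty]
  have eq: "octC_Re (F z) + J \<odot> octC_Im (F z) = octC_Re (G z) + J \<odot> octC_Im (G z)"
    if "J \<in> sphere_O" for J
    using F G z that unfolding corresponding_stem_def xy by metis
  have "2 *\<^sub>R octC_Re (F z) = 2 *\<^sub>R octC_Re (G z)"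
    using arg_cong2[where f="(+)", OF eq[OF e(1)] eq[OF e(2)]]
    by (simp add: oct_mult_uminus_left scaleR_2)
  then have Re: "octC_Re (F z) = octC_Re (G z)" by simp
  then have "?e \<odot> octC_Im (F z) = ?e \<odot> octC_Im (G z)"
    using eq[OF e(1)] by simp
  then have "octC_Im (F z) = octC_Im (G z)"
    by (simp add: vec_eq_iff forall_8 oct_mult_def)
  with Re show ?thesis
    by (metis complexify_Re_Im)
qed

lemma corresponding_stem_stem_of:
  "slice_function D f \<Longrightarrow> corresponding_stem D f (stem_of D f)"
  unfolding slice_function_def stem_of_def by (erule someI2_ex)

lemma stem_of_eq:
  assumes "corresponding_stem D f F" "z \<in> D"
  shows "stem_of D f z = F z"
  using assms corresponding_stem_unique corresponding_stem_stem_of slice_function_def by metis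

end

theory Submission
  imports Defs
begin

text \<open>
  The theorem reduces to one implication: if \<open>F\<close> and \<open>H\<close> have the same central divisor, trace
  and norm, then \<open>F = \<phi> H\<close> for a holomorphic map \<open>\<phi>\<close> into \<open>G\<^sub>\<complex>\<close>. Everything else is formal. An
  automorphism fixes \<open>1\<close>, and because every octonion satisfies
  \<open>x\<^sup>2 = Tr(x) x - N(x) 1\<close>, it preserves trace and norm (\<open>G_C_trace\<close>, \<open>G_C_norm\<close>); as it acts
  injectively modulo the center, a holomorphic family of automorphisms preserves the central
  divisor (\<open>G_moves_cdiv\<close>). Slice functions carry the same information as their stem functions
  (\<open>slice_eq_iff_stem_eq\<close>).

  For the main implication (\<open>same_invariants_imp_G_moves\<close>), the traces take care of the central
  components, so only the imaginary parts \<open>\<complex>\<^sup>7\<close> matter. On an arbitrary open set there is a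
  holomorphic \<open>g\<close> whose divisor is the common central divisor (\<open>Weierstrass_divisor\<close>). Dividing
  by \<open>g\<close> leaves two nowhere vanishing maps \<open>V\<close>, \<open>W\<close> into \<open>\<complex>\<^sup>7\<close> with the same norm
  (\<open>primitive_part\<close>). These are conjugate because each of them can be moved to a normal form
  that depends on its norm alone (\<open>zorn_normal_form\<close>). So no appeal to the Oka principle for the
  action of \<open>G\<^sub>\<complex>\<close> on a quadric is made: the normal form is reached by explicit elimination.

  The elimination takes place in Zorn's vector matrices \<open>(a, u; v, b)\<close> with scalars \<open>a\<close>, \<open>b\<close> and
  vectors \<open>u\<close>, \<open>v\<close> in \<open>\<complex>\<^sup>3\<close>, in which the root subgroups of \<open>G\<^sub>\<complex>\<close> are polynomial
  substitutions. Applying one with a holomorphic parameter is a row operation over the ring of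
  holomorphic functions on \<open>D\<close>. Constant generic parameters already make \<open>u\<^sub>1\<close> and \<open>u\<^sub>2\<close> free of
  common zeros: each step has to avoid only the roots of countably many nonzero polynomials,
  because zeros of a holomorphic function are isolated. The ring has stable rank one
  (\<open>coprime_combination_unit\<close>): for \<open>u\<^sub>1\<close>, \<open>u\<^sub>2\<close> without common zeros some \<open>u\<^sub>1 + h u\<^sub>2\<close> vanishes
  nowhere. With that unit as a pivot, the remaining root subgroups clear all other coordinates
  except \<open>v\<^sub>1\<close>, a torus turns the pivot into \<open>1\<close>, and then \<open>v\<^sub>1\<close> is minus the norm.

  Stable rank one holds because one can interpolate: if \<open>k\<close> agrees with a local logarithm of
  \<open>f\<close> to the order of vanishing of \<open>g\<close> at each zero of \<open>g\<close>, then \<open>g\<close> divides \<open>exp k - f\<close>.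
  Such a \<open>k\<close> (\<open>interpolation_modulo\<close>) and the function with prescribed divisor both come from
  the same convergence factors: for a locally finite set in \<open>D\<close> there are functions \<open>w p\<close>,
  holomorphic on \<open>D\<close>, with \<open>w p p = 1\<close>, that become small on every compact subset of \<open>D\<close>
  (\<open>escaping_functions\<close>).
\<close>

section \<open>Locally finite sets and isolated zeros\<close>

definition locally_finite_in :: "complex set \<Rightarrow> complex set \<Rightarrow> bool" where
  "locally_finite_in S D \<longleftrightarrow> S \<subseteq> D \<and> (\<forall>K. compact K \<longrightarrow> K \<subseteq> D \<longrightarrow> finite (S \<inter> K))"

lemma locally_finite_in_subset: "locally_finite_in S D \<Longrightarrow> A \<subseteq> S \<Longrightarrow> locally_finite_in A D"
  unfolding locally_finite_in_def by (meson Int_mono finite_subset order_refl order_trans)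

lemma locally_finite_in_isolated:
  assumes "open D" "locally_finite_in S D" "p \<in> D"
  obtains r where "r > 0" "cball p r \<subseteq> D" "S \<inter> cball p r \<subseteq> {p}"
proof -
  obtain r0 where r0: "r0 > 0" "cball p r0 \<subseteq> D"
    using assms(1,3) unfolding open_contains_cball by blast
  then have "finite (S \<inter> cball p r0)"
    using assms(2) by (auto simp: locally_finite_in_def)
  then obtain d where d: "d > 0" "\<And>x. x \<in> S \<inter> cball p r0 \<Longrightarrow> x \<noteq> p \<Longrightarrow> d \<le> dist p x"
    using finite_set_avoid[of "S \<inter> cball p r0" p] by auto
  show thesis
  proof (rule that[of "min r0 (d/2)"])
    show "S \<inter> cball p (min r0 (d / 2)) \<subseteq> {p}"
    proof
      fix x assume x: "x \<in> S \<inter> cball p (min r0 (d / 2))"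
      then have "dist p x \<le> d / 2" by simp
      then have "dist p x < d" using d(1) by linarith
      then show "x \<in> {p}" using d(2)[of x] x by (cases "x = p") auto
    qed
  qed (use r0 d in auto)
qed

lemma locally_finite_in_open_Diff:
  assumes "open D" "locally_finite_in S D"
  shows "open (D - S)"
  unfolding open_contains_cball
proof
  fix x assume x: "x \<in> D - S"
  then obtain r where r: "r > 0" "cball x r \<subseteq> D" "S \<inter> cball x r \<subseteq> {x}"
    using locally_finite_in_isolated[OF assms, of x] by auto
  have "cball x r \<subseteq> D - S" using x r by auto
  with r(1) show "\<exists>e>0. cball x e \<subseteq> D - S" by blast
qed

lemma locally_finite_in_countable:
  assumes "open D" "locally_finite_in S D"
  shows "countable S"
proof -
  obtain C where C: "\<And>n. compact (C n)" "\<And>n. C n \<subseteq> D" "\<And>n. C n \<subseteq> interior (C (Suc n))"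
    "\<Union>(range C) = D" "\<And>K. compact K \<Longrightarrow> K \<subseteq> D \<Longrightarrow> \<exists>N. \<forall>n\<ge>N. K \<subseteq> C n"
    by (rule open_Union_compact_subsets[OF assms(1)]) blast
  have "S \<subseteq> D" using assms(2) by (simp add: locally_finite_in_def)
  then have "S = (\<Union>n::nat. S \<inter> C n)"
    unfolding C(4)[symmetric] by blast
  moreover have "finite (S \<inter> C n)" for n
    using assms(2) C(1,2) by (simp add: locally_finite_in_def)
  then have "countable (\<Union>n::nat. S \<inter> C n)"
    by (intro countable_UN) (auto intro: countable_finite)
  ultimately show ?thesis by simp
qed

lemma zeros_locally_finite:
  assumes "open D" "connected D" "g holomorphic_on D" "\<exists>z\<in>D. g z \<noteq> 0"
  shows "locally_finite_in {z\<in>D. g z = 0} D"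
proof (cases "g constant_on D")
  case True
  then have "{z\<in>D. g z = 0} = {}" using assms(4) by (auto simp: constant_on_def)
  then show ?thesis by (simp only: locally_finite_in_def) auto
next
  case False
  have "finite ({z\<in>D. g z = 0} \<inter> K)" if "compact K" "K \<subseteq> D" for K
  proof -
    have "{z\<in>D. g z = 0} \<inter> K = {z\<in>K. g z = 0}" using that by auto
    then show ?thesis
      using holomorphic_compact_finite_zeros[OF assms(3,1,2) that False] by simp
  qed
  then show ?thesis by (auto simp: locally_finite_in_def)
qed

text \<open>
  Functions below are often glued from different formulas at different points, so holomorphy is
  checked on a ball around each point.
\<close>

lemma holomorphic_on_local:
  assumes "\<And>p. p \<in> D \<Longrightarrow> \<exists>r>0. \<exists>q. q holomorphic_on ball p r \<and> (\<forall>z\<in>ball p r. h z = q z)"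
  shows "h holomorphic_on D"
  unfolding holomorphic_on_def
proof
  fix p assume "p \<in> D"
  then obtain r q where r: "r > 0" "q holomorphic_on ball p r" "\<forall>z\<in>ball p r. h z = q z"
    using assms by blast
  then have "h holomorphic_on ball p r"
    using holomorphic_transform by (metis (no_types, lifting))
  then have "h field_differentiable (at p)"
    using r(1) holomorphic_on_imp_differentiable_at by auto
  then show "h field_differentiable (at p within D)"
    by (rule field_differentiable_at_within)
qed

lemma holomorphic_eq_at_limit:
  assumes "open D" "p \<in> D" "f holomorphic_on D" "g holomorphic_on D"
    and eq: "\<And>z. z \<in> D \<Longrightarrow> z \<noteq> p \<Longrightarrow> f z = g z"
  shows "f p = (g p :: complex)"
proof -
  have "isCont f p" "isCont g p"
    using assms(1-4) holomorphic_on_imp_continuous_on continuous_on_interior interior_open by metis+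
  then have lim: "f \<midarrow>p\<rightarrow> f p" "g \<midarrow>p\<rightarrow> g p" by (auto simp: isCont_def)
  have "\<forall>\<^sub>F z in at p. f z = g z"
    using eventually_at_in_open[OF assms(1,2)] by eventually_elim (use eq in auto)
  then have "f \<midarrow>p\<rightarrow> g p" using lim(2) by (simp add: tendsto_cong)
  with lim(1) show ?thesis by (rule LIM_unique)
qed

section \<open>Convergence factors on an arbitrary open set\<close>

text \<open>
  A point \<open>p\<close> of \<open>S\<close> can leave every compact subset of \<open>D\<close> in two ways. If it approaches the
  boundary, take a nearest boundary point \<open>b\<close> and the function \<open>(p - b) / (z - b)\<close>; if it tends to
  infinity, take \<open>(z - c) / (p - c)\<close> with a fixed \<open>c\<close>. Both take the value \<open>1\<close> at \<open>p\<close> only, and to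
  first order, as the nowhere vanishing factor \<open>v\<close> records.
\<close>

lemma escaping_functions:
  assumes D: "open D" and S: "locally_finite_in S D"
  obtains w v :: "complex \<Rightarrow> complex \<Rightarrow> complex" where
    "\<And>p. p \<in> S \<Longrightarrow> w p holomorphic_on D" "\<And>p. p \<in> S \<Longrightarrow> v p holomorphic_on D"
    "\<And>p z. p \<in> S \<Longrightarrow> z \<in> D \<Longrightarrow> v p z \<noteq> 0"
    "\<And>p z. p \<in> S \<Longrightarrow> z \<in> D \<Longrightarrow> 1 - w p z = (z - p) * v p z"
    "\<And>K. compact K \<Longrightarrow> K \<subseteq> D \<Longrightarrow> finite {p\<in>S. \<exists>z\<in>K. norm (w p z) > 1/2}"
proof -
  \<comment> \<open>The weight \<open>1 + norm p\<close> makes the two cases complementary: a set of points on which the product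
     is bounded below and \<open>p\<close> is bounded stays away from the boundary, and one on which the product
     is bounded above and the distance is bounded below is bounded.\<close>
  define near where "near p \<longleftrightarrow> D \<noteq> UNIV \<and> infdist p (-D) * (1 + norm p) < 1" for p
  have "S \<noteq> UNIV"
    using locally_finite_in_countable[OF D S] uncountable_UNIV_complex by auto
  then obtain c where c: "c \<notin> S" by blast
  have clD: "closed (-D)" using D by (rule closed_Compl)
  define b where "b p = (SOME b. b \<in> -D \<and> infdist p (-D) = dist p b)" for p
  have b: "b p \<notin> D" "dist p (b p) = infdist p (-D)" if "near p" for p
  proof -
    have "-D \<noteq> {}" using that unfolding near_def by auto
    then have "\<exists>b. b \<in> -D \<and> infdist p (-D) = dist p b"
      using infdist_attains_inf[OF clD, of p] by metis
    from someI_ex[OF this] show "b p \<notin> D" "dist p (b p) = infdist p (-D)"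
      unfolding b_def by simp_all
  qed
  define w where "w p z = (if near p then (p - b p) / (z - b p) else (z - c) / (p - c))" for p z
  define v where "v p z = (if near p then 1 / (z - b p) else - 1 / (p - c))" for p z
  have inD: "x \<in> D" if "infdist x (-D) > 0" for x
    using that infdist_zero[of x "-D"] by (cases "x \<in> D") auto
  have cpt: "compact {p \<in> cball a R. infdist p (-D) \<ge> e}" for a :: complex and R e
  proof -
    have "closed {p. e \<le> infdist p (-D)}"
      by (intro closed_Collect_le continuous_intros)
    then have "compact (cball a R \<inter> {p. e \<le> infdist p (-D)})"
      by (rule compact_Int_closed[OF compact_cball])
    moreover have "cball a R \<inter> {p. e \<le> infdist p (-D)} = {p \<in> cball a R. infdist p (-D) \<ge> e}"
      by blast
    ultimately show ?thesis by simp
  qed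
  show thesis
  proof (rule that[of w v])
    fix p assume p: "p \<in> S"
    then have pD: "p \<in> D" and pc: "p \<noteq> c" using S c by (auto simp: locally_finite_in_def)
    have zb: "z - b p \<noteq> 0" if "z \<in> D" "near p" for z using b that by auto
    show "w p holomorphic_on D"
      unfolding w_def using zb pc by (cases "near p") (auto intro!: holomorphic_intros)
    show "v p holomorphic_on D"
      unfolding v_def using zb pc by (cases "near p") (auto intro!: holomorphic_intros)
    fix z assume z: "z \<in> D"
    show "v p z \<noteq> 0" unfolding v_def using zb z pc by auto
    show "1 - w p z = (z - p) * v p z"
      unfolding v_def w_def using zb z pc by (auto simp: divide_simps)
  next
    fix K :: "complex set" assume K: "compact K" "K \<subseteq> D"
    obtain R where R: "\<And>z. z \<in> K \<Longrightarrow> dist c z \<le> R"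
      using compact_imp_bounded[OF K(1)] bounded_any_center[of K c] by auto
    have "K \<inter> -D = {}" using K(2) by auto
    from separate_compact_closed[OF K(1) clD this]
    obtain e where "e > 0" "\<forall>z\<in>K. \<forall>y\<in>-D. e \<le> dist z y" by auto
    then have e: "e > 0" "\<And>z y. z \<in> K \<Longrightarrow> y \<notin> D \<Longrightarrow> e \<le> dist z y" by auto
    define K1 where "K1 = (if D = UNIV then cball c (2 * R)
        else {p \<in> cball c (2 * R). infdist p (-D) \<ge> 1 / (1 + norm c + 2 * \<bar>R\<bar>)})"
    define K2 where "K2 = {p \<in> cball 0 (2 / e). infdist p (-D) \<ge> e / 2}"
    have pos: "1 + norm c + 2 * \<bar>R\<bar> > 0" by (simp add: add_pos_nonneg)
    have "compact K1"
      unfolding K1_def by (simp only: compact_cball cpt split: if_split) simp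
    moreover have "compact K2" unfolding K2_def by (rule cpt)
    moreover have "K1 \<subseteq> D"
    proof
      fix x assume x: "x \<in> K1"
      have "1 / (1 + norm c + 2 * \<bar>R\<bar>) > 0" using pos by simp
      then show "x \<in> D" using x inD[of x] unfolding K1_def by (cases "D = UNIV") auto
    qed
    moreover have "K2 \<subseteq> D"
    proof
      fix x assume x: "x \<in> K2"
      then show "x \<in> D" using inD[of x] e(1) unfolding K2_def by auto
    qed
    ultimately have fin: "finite (S \<inter> K1 \<union> S \<inter> K2)"
      using S unfolding locally_finite_in_def by simp
    have "p \<in> K1 \<union> K2" if p: "p \<in> S" and z: "z \<in> K" and big: "norm (w p z) > 1/2" for p z
    proof (cases "near p")
      case True
      have "e \<le> norm (z - b p)" using e(2)[OF z b(1)[OF True]] by (simp add: dist_norm)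
      moreover from this have "norm (z - b p) > 0" using e(1) by linarith
      then have "norm (p - b p) > norm (z - b p) / 2"
        using big True by (simp add: w_def norm_divide less_divide_eq mult.commute)
      ultimately have i: "infdist p (-D) > e / 2"
        using b(2)[OF True] by (simp add: dist_norm)
      have "e / 2 * (1 + norm p) \<le> infdist p (-D) * (1 + norm p)"
        using i by (intro mult_right_mono) auto
      also have "\<dots> < 1" using True by (simp add: near_def)
      finally have "norm p \<le> 2 / e" using e(1) by (simp add: field_simps)
      then show ?thesis using i by (auto simp: K2_def)
    next
      case False
      have "p \<noteq> c" using p c by auto
      then have "norm (p - c) < 2 * norm (z - c)"
        using big False by (simp add: w_def norm_divide field_simps)
      also have "\<dots> \<le> 2 * R" using R[OF z] by (simp add: dist_norm norm_minus_commute)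
      finally have pR: "dist c p \<le> 2 * R" by (simp add: dist_norm norm_minus_commute)
      have "infdist p (-D) \<ge> 1 / (1 + norm c + 2 * \<bar>R\<bar>)" if "D \<noteq> UNIV"
      proof -
        have "norm p \<le> norm c + norm (p - c)" by (metis add.commute norm_triangle_sub)
        then have "norm p \<le> norm c + 2 * \<bar>R\<bar>" using pR by (simp add: dist_norm norm_minus_commute)
        then have "infdist p (-D) * (1 + norm p) \<le> infdist p (-D) * (1 + norm c + 2 * \<bar>R\<bar>)"
          by (intro mult_left_mono) (auto simp: infdist_nonneg)
        moreover have "infdist p (-D) * (1 + norm p) \<ge> 1" using False that by (simp add: near_def)
        ultimately show ?thesis using pos by (simp add: divide_le_eq)
      qed
      then show ?thesis using pR by (auto simp: K1_def)
    qed
    then have "{p \<in> S. \<exists>z\<in>K. norm (w p z) > 1/2} \<subseteq> S \<inter> K1 \<union> S \<inter> K2" by blast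
    then show "finite {p \<in> S. \<exists>z\<in>K. norm (w p z) > 1/2}" using fin finite_subset by blast
  qed
qed

text \<open>
  The regions \<open>L p\<close> turn the local smallness of \<open>w p\<close> into a choice that can be made once for each
  \<open>p\<close>: on the compact set \<open>L p\<close> a high power of \<open>w p\<close> beats any given continuous function, and every
  compact subset of \<open>D\<close> lies in all but finitely many \<open>L p\<close>. They are built from a compact
  exhaustion of \<open>D\<close>, using only the first few of its members, as counted by an enumeration of
  \<open>S\<close>, so that \<open>L p\<close> stays compact.
\<close>

lemma cutoffs:
  assumes D: "open D" and S: "locally_finite_in S D"
  obtains w v :: "complex \<Rightarrow> complex \<Rightarrow> complex" and L where
    "\<And>p. p \<in> S \<Longrightarrow> w p holomorphic_on D" "\<And>p. p \<in> S \<Longrightarrow> v p holomorphic_on D"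
    "\<And>p z. p \<in> S \<Longrightarrow> z \<in> D \<Longrightarrow> v p z \<noteq> 0"
    "\<And>p z. p \<in> S \<Longrightarrow> z \<in> D \<Longrightarrow> 1 - w p z = (z - p) * v p z"
    "\<And>p. p \<in> S \<Longrightarrow> compact (L p)" "\<And>p. p \<in> S \<Longrightarrow> L p \<subseteq> D"
    "\<And>p z. p \<in> S \<Longrightarrow> z \<in> L p \<Longrightarrow> norm (w p z) \<le> 1/2"
    "\<And>K. compact K \<Longrightarrow> K \<subseteq> D \<Longrightarrow> finite {p\<in>S. \<not> K \<subseteq> L p}"
proof -
  obtain w v where wv:
    "\<And>p. p \<in> S \<Longrightarrow> w p holomorphic_on D" "\<And>p. p \<in> S \<Longrightarrow> v p holomorphic_on D"
    "\<And>p z. p \<in> S \<Longrightarrow> z \<in> D \<Longrightarrow> v p z \<noteq> 0"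
    "\<And>p z. p \<in> S \<Longrightarrow> z \<in> D \<Longrightarrow> 1 - w p z = (z - p) * v p z"
    and fin: "\<And>K. compact K \<Longrightarrow> K \<subseteq> D \<Longrightarrow> finite {p\<in>S. \<exists>z\<in>K. norm (w p z) > 1/2}"
    by (rule escaping_functions[OF D S]) blast
  obtain C where C: "\<And>n. compact (C n)" "\<And>n. C n \<subseteq> D" "\<And>n. C n \<subseteq> interior (C (Suc n))"
    "\<Union>(range C) = D" "\<And>K. compact K \<Longrightarrow> K \<subseteq> D \<Longrightarrow> \<exists>N. \<forall>n\<ge>N. K \<subseteq> C n"
    by (rule open_Union_compact_subsets[OF D]) blast
  define J where "J p = {j. j \<le> to_nat_on S p \<and> (\<forall>z\<in>C j. norm (w p z) \<le> 1/2)}" for p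
  define L where "L p = (\<Union>j\<in>J p. C j)" for p
  have finJ: "finite (J p)" for p
    by (rule finite_subset[of _ "{..to_nat_on S p}"]) (auto simp: J_def)
  show thesis
  proof (rule that[of w v L])
    show "compact (L p)" for p unfolding L_def using finJ C(1) by (intro compact_UN) auto
    show "L p \<subseteq> D" for p unfolding L_def using C(2) by auto
    show "norm (w p z) \<le> 1/2" if "z \<in> L p" for p z using that by (auto simp: L_def J_def)
  next
    fix K assume K: "compact K" "K \<subseteq> D"
    then obtain N where N: "K \<subseteq> C N" using C(5)[OF K] by auto
    have "finite {p\<in>S. to_nat_on S p < N}"
    proof (rule finite_imageD)
      show "finite (to_nat_on S ` {p\<in>S. to_nat_on S p < N})"
        by (rule finite_subset[of _ "{..<N}"]) auto
      show "inj_on (to_nat_on S) {p\<in>S. to_nat_on S p < N}"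
        using inj_on_to_nat_on[OF locally_finite_in_countable[OF D S]] by (rule inj_on_subset) auto
    qed
    moreover have "finite {p\<in>S. \<exists>z\<in>C N. norm (w p z) > 1/2}" by (rule fin[OF C(1,2)])
    moreover have "{p\<in>S. \<not> K \<subseteq> L p} \<subseteq> {p\<in>S. to_nat_on S p < N} \<union> {p\<in>S. \<exists>z\<in>C N. norm (w p z) > 1/2}"
    proof
      fix p assume p: "p \<in> {p\<in>S. \<not> K \<subseteq> L p}"
      then have "\<not> C N \<subseteq> L p" using N by auto
      then have "N \<notin> J p" unfolding L_def by auto
      then show "p \<in> {p\<in>S. to_nat_on S p < N} \<union> {p\<in>S. \<exists>z\<in>C N. norm (w p z) > 1/2}"
        using p by (auto simp: J_def not_le)
    qed
    ultimately show "finite {p\<in>S. \<not> K \<subseteq> L p}" by (meson finite_Un finite_subset)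
  qed (use wv in auto)
qed

lemma eventually_cutoff:
  assumes D: "open D" and S: "locally_finite_in S D"
    and L: "finite {p\<in>S. \<not> K \<subseteq> L p}"
  shows "\<forall>\<^sub>F n in sequentially. n \<in> to_nat_on S ` A \<longrightarrow> A \<subseteq> S \<longrightarrow> K \<subseteq> L (from_nat_into S n)"
proof -
  note cS = locally_finite_in_countable[OF D S]
  have "finite (to_nat_on S ` {p\<in>S. \<not> K \<subseteq> L p})" using L by (rule finite_imageI)
  then obtain N where "\<forall>n \<in> to_nat_on S ` {p\<in>S. \<not> K \<subseteq> L p}. n < N"
    unfolding finite_nat_set_iff_bounded by auto
  then have N: "\<And>n. n \<in> to_nat_on S ` {p\<in>S. \<not> K \<subseteq> L p} \<Longrightarrow> n < N" by blast
  show ?thesis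
  proof (rule eventually_sequentiallyI[of N], intro impI)
    fix n assume n: "N \<le> n" "n \<in> to_nat_on S ` A" and A: "A \<subseteq> S"
    then obtain p where p: "p \<in> S" "n = to_nat_on S p" by auto
    then have "from_nat_into S n = p" using cS by simp
    moreover have "K \<subseteq> L p"
    proof (rule ccontr)
      assume "\<not> K \<subseteq> L p"
      then have "n < N" using p by (intro N) auto
      then show False using n by simp
    qed
    ultimately show "K \<subseteq> L (from_nat_into S n)" by simp
  qed
qed

section \<open>Mittag-Leffler sums and Weierstrass products\<close>

text \<open>
  Sums are provided for all subsets \<open>A\<close> of \<open>S\<close> at once, because the behaviour of \<open>M A\<close> at a point
  \<open>p\<close> of \<open>A\<close> is read off by splitting off the term \<open>R p\<close>: what remains is holomorphic at \<open>p\<close>.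
\<close>

lemma Mittag_Leffler_sum:
  assumes D: "open D" and S: "locally_finite_in S D"
    and R: "\<And>p. p \<in> S \<Longrightarrow> R p holomorphic_on D - {p}"
    and L: "\<And>K. compact K \<Longrightarrow> K \<subseteq> D \<Longrightarrow> finite {p\<in>S. \<not> K \<subseteq> L p}"
    and bound: "\<And>p z. p \<in> S \<Longrightarrow> z \<in> L p \<Longrightarrow> norm (R p z) \<le> (1/2) ^ to_nat_on S p"
  obtains M :: "complex set \<Rightarrow> complex \<Rightarrow> complex" where
    "\<And>A. A \<subseteq> S \<Longrightarrow> M A holomorphic_on D - A"
    "\<And>A p z. A \<subseteq> S \<Longrightarrow> p \<in> A \<Longrightarrow> z \<in> D - A \<Longrightarrow> M A z = R p z + M (A - {p}) z"
proof -
  note cS = locally_finite_in_countable[OF D S]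
  \<comment> \<open>Indexing by the values of an enumeration covers finite and infinite \<open>S\<close> together.\<close>
  define r where "r A n z = (if n \<in> to_nat_on S ` A then R (from_nat_into S n) z else 0)" for A n z
  define M where "M A z = (\<Sum>n. r A n z)" for A z
  have unif: "uniform_limit K (\<lambda>n z. \<Sum>i<n. r A i z) (M A) sequentially"
    and summ: "z \<in> K \<Longrightarrow> summable (\<lambda>n. r A n z)"
    if "compact K" "K \<subseteq> D" "A \<subseteq> S" for K A z
  proof -
    have ev: "\<forall>\<^sub>F n in sequentially. \<forall>z\<in>K. norm (r A n z) \<le> (1/2)^n"
      using eventually_cutoff[OF D S L[OF that(1,2)], of A]
    proof eventually_elim
      case (elim n)
      show ?case
      proof
        fix z assume z: "z \<in> K"
        show "norm (r A n z) \<le> (1/2)^n"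
        proof (cases "n \<in> to_nat_on S ` A")
          case True
          then obtain p where p: "p \<in> A" "n = to_nat_on S p" by auto
          then have "p \<in> S" "from_nat_into S n = p" using that(3) cS by auto
          then show ?thesis using elim True that(3) z bound[of p z] p by (auto simp: r_def)
        qed (auto simp: r_def)
      qed
    qed
    have sg: "summable (\<lambda>n. (1/2)^n :: real)" by (rule summable_geometric) simp
    show "uniform_limit K (\<lambda>n z. \<Sum>i<n. r A i z) (M A) sequentially"
      unfolding M_def by (rule Weierstrass_m_test_ev[OF ev sg])
    show "summable (\<lambda>n. r A n z)" if "z \<in> K"
      by (rule summable_comparison_test_ev[OF _ sg]) (use ev that in \<open>auto elim: eventually_mono\<close>)
  qed
  show thesis
  proof (rule that[of M])
    fix A assume A: "A \<subseteq> S"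
    have op: "open (D - A)"
      by (rule locally_finite_in_open_Diff[OF D locally_finite_in_subset[OF S A]])
    show "M A holomorphic_on D - A"
    proof (rule holomorphic_uniform_sequence[OF op])
      have "r A i holomorphic_on D - A" for i
      proof (cases "i \<in> to_nat_on S ` A")
        case True
        then obtain p where p: "p \<in> A" "i = to_nat_on S p" by auto
        then have "p \<in> S" "from_nat_into S i = p" using A cS by auto
        then have "r A i = R p" using True by (auto simp: r_def fun_eq_iff)
        then show ?thesis using holomorphic_on_subset[OF R[OF \<open>p \<in> S\<close>]] p by auto
      next
        case False
        then have "r A i = (\<lambda>_. 0)" by (auto simp: r_def fun_eq_iff)
        then show ?thesis by simp
      qed
      then show "(\<lambda>z. \<Sum>i<n. r A i z) holomorphic_on D - A" for n
        by (intro holomorphic_intros)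
    next
      fix x assume "x \<in> D - A"
      then obtain d where "d > 0" "cball x d \<subseteq> D - A" using op open_contains_cball_eq by blast
      moreover from this have "uniform_limit (cball x d) (\<lambda>n z. \<Sum>i<n. r A i z) (M A) sequentially"
        using A by (intro unif) auto
      ultimately show "\<exists>d>0. cball x d \<subseteq> D - A \<and>
          uniform_limit (cball x d) (\<lambda>n z. \<Sum>i<n. r A i z) (M A) sequentially" by blast
    qed
  next
    fix A p z assume A: "A \<subseteq> S" and p: "p \<in> A" and z: "z \<in> D - A"
    have pS: "p \<in> S" using A p by auto
    have inj: "to_nat_on S q = to_nat_on S p \<longleftrightarrow> q = p" if "q \<in> S" for q
      using inj_on_to_nat_on[OF cS] that pS by (auto simp: inj_on_def)
    have *: "r A n z = (if n = to_nat_on S p then R p z else 0) + r (A - {p}) n z" for n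
    proof (cases "n = to_nat_on S p")
      case True
      then have "n \<notin> to_nat_on S ` (A - {p})" using inj A by (auto simp: eq_commute)
      then show ?thesis using True p cS pS by (simp add: r_def)
    next
      case False
      then have "n \<in> to_nat_on S ` (A - {p}) \<longleftrightarrow> n \<in> to_nat_on S ` A" by auto
      then show ?thesis using False by (simp add: r_def)
    qed
    have "summable (\<lambda>n. r (A - {p}) n z)"
      using A z by (intro summ[of "{z}"]) auto
    then have "M A z = (\<Sum>n. if n = to_nat_on S p then R p z else 0) + M (A - {p}) z"
      unfolding M_def * by (subst suminf_add[symmetric]) auto
    also have "(\<Sum>n. if n = to_nat_on S p then R p z else 0) = R p z"
      using sums_single[of "to_nat_on S p" "\<lambda>_. R p z"] by (rule sums_unique[symmetric])
    finally show "M A z = R p z + M (A - {p}) z" .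
  qed
qed

text \<open>
  The multiplicative counterpart; here the order of vanishing at \<open>p\<close> is visible after splitting
  off the factor \<open>E p\<close>.
\<close>

lemma Weierstrass_product:
  assumes D: "open D" and S: "locally_finite_in S D"
    and E: "\<And>p. p \<in> S \<Longrightarrow> E p holomorphic_on D"
    and L: "\<And>K. compact K \<Longrightarrow> K \<subseteq> D \<Longrightarrow> finite {p\<in>S. \<not> K \<subseteq> L p}"
    and bound: "\<And>p z. p \<in> S \<Longrightarrow> z \<in> L p \<Longrightarrow> norm (E p z - 1) \<le> (1/2) ^ to_nat_on S p"
  obtains P :: "complex set \<Rightarrow> complex \<Rightarrow> complex" where
    "\<And>A. A \<subseteq> S \<Longrightarrow> P A holomorphic_on D"
    "\<And>A p z. A \<subseteq> S \<Longrightarrow> p \<in> A \<Longrightarrow> z \<in> D \<Longrightarrow> P A z = E p z * P (A - {p}) z"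
    "\<And>A z. A \<subseteq> S \<Longrightarrow> z \<in> D \<Longrightarrow> (\<And>p. p \<in> A \<Longrightarrow> E p z \<noteq> 0) \<Longrightarrow> P A z \<noteq> 0"
proof -
  note cS = locally_finite_in_countable[OF D S]
  define e where "e A n z = (if n \<in> to_nat_on S ` A then E (from_nat_into S n) z else 1)" for A n z
  define P where "P A z = (\<Prod>n. e A n z)" for A z
  have e_hol: "e A n holomorphic_on D" if "A \<subseteq> S" for A n
  proof (cases "n \<in> to_nat_on S ` A")
    case True
    then obtain p where p: "p \<in> A" "n = to_nat_on S p" by auto
    then have "p \<in> S" "from_nat_into S n = p" using that cS by auto
    then have "e A n = E p" using True by (auto simp: e_def fun_eq_iff)
    then show ?thesis using E[OF \<open>p \<in> S\<close>] by auto
  next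
    case False
    then have "e A n = (\<lambda>_. 1)" by (auto simp: e_def fun_eq_iff)
    then show ?thesis by simp
  qed
  have ev: "\<forall>\<^sub>F n in sequentially. \<forall>z\<in>K. norm (norm (e A n z - 1)) \<le> (1/2)^n"
    if "compact K" "K \<subseteq> D" "A \<subseteq> S" for K A
    using eventually_cutoff[OF D S L[OF that(1,2)], of A]
  proof eventually_elim
    case (elim n)
    show ?case
    proof
      fix z assume z: "z \<in> K"
      show "norm (norm (e A n z - 1)) \<le> (1/2)^n"
      proof (cases "n \<in> to_nat_on S ` A")
        case True
        then obtain p where p: "p \<in> A" "n = to_nat_on S p" by auto
        then have "p \<in> S" "from_nat_into S n = p" using that(3) cS by auto
        then show ?thesis using elim True that(3) z bound[of p z] p by (auto simp: e_def)
      qed (auto simp: e_def)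
    qed
  qed
  have sg: "summable (\<lambda>n. (1/2)^n :: real)" by (rule summable_geometric) simp
  have conv: "convergent_prod (\<lambda>n. e A n z)" if "A \<subseteq> S" "z \<in> D" for A z
  proof -
    have "summable (\<lambda>n. norm (e A n z - 1))"
      by (rule summable_comparison_test_ev[OF _ sg])
        (use ev[of "{z}" A] that in \<open>auto elim: eventually_mono\<close>)
    then show ?thesis
      using abs_convergent_prod_conv_summable abs_convergent_prod_imp_convergent_prod by blast
  qed
  have unif: "uniform_limit K (\<lambda>N z. \<Prod>n<N. e A n z) (P A) sequentially"
    if K: "compact K" "K \<subseteq> D" and A: "A \<subseteq> S" for K A
  proof -
    have "uniformly_convergent_on K (\<lambda>N z. \<Prod>n<N. e A n z)"
    proof (rule uniformly_convergent_on_prod'[OF _ K(1)])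
      show "continuous_on K (e A n)" for n
        using holomorphic_on_subset[OF e_hol[OF A] K(2)] holomorphic_on_imp_continuous_on by blast
      show "uniformly_convergent_on K (\<lambda>N z. \<Sum>n<N. norm (e A n z - 1))"
        by (rule Weierstrass_m_test'_ev[OF ev[OF K A] sg])
    qed
    then obtain g where g: "uniform_limit K (\<lambda>N z. \<Prod>n<N. e A n z) g sequentially"
      by (auto simp: uniformly_convergent_on_def)
    have eq: "g z = P A z" if z: "z \<in> K" for z
    proof -
      have "(\<lambda>n. \<Prod>i<Suc n. e A i z) \<longlonglongrightarrow> g z"
        using tendsto_uniform_limitI[OF g z] by (rule LIMSEQ_Suc)
      moreover have "(\<lambda>n. \<Prod>i<Suc n. e A i z) \<longlonglongrightarrow> P A z"
        using convergent_prod_LIMSEQ[OF conv[OF A, of z]] K z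
        unfolding P_def lessThan_Suc_atMost by auto
      ultimately show ?thesis using LIMSEQ_unique by blast
    qed
    have "uniform_limit K (\<lambda>N z. \<Prod>n<N. e A n z) g sequentially \<longleftrightarrow>
        uniform_limit K (\<lambda>N z. \<Prod>n<N. e A n z) (P A) sequentially"
      by (rule uniform_limit_cong') (simp_all add: eq)
    then show ?thesis using g by simp
  qed
  show thesis
  proof (rule that[of P])
    fix A assume A: "A \<subseteq> S"
    show "P A holomorphic_on D"
    proof (rule holomorphic_uniform_sequence[OF D])
      show "(\<lambda>z. \<Prod>n<N. e A n z) holomorphic_on D" for N
        using e_hol[OF A] by (intro holomorphic_intros)
      fix x assume "x \<in> D"
      then obtain d where "d > 0" "cball x d \<subseteq> D" using D open_contains_cball_eq by blast
      moreover from this have "uniform_limit (cball x d) (\<lambda>N z. \<Prod>n<N. e A n z) (P A) sequentially"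
        using A by (intro unif) auto
      ultimately show "\<exists>d>0. cball x d \<subseteq> D \<and>
          uniform_limit (cball x d) (\<lambda>N z. \<Prod>n<N. e A n z) (P A) sequentially" by blast
    qed
  next
    fix A p z assume A: "A \<subseteq> S" and p: "p \<in> A" and z: "z \<in> D"
    have pS: "p \<in> S" using A p by auto
    have inj: "to_nat_on S q = to_nat_on S p \<longleftrightarrow> q = p" if "q \<in> S" for q
      using inj_on_to_nat_on[OF cS] that pS by (auto simp: inj_on_def)
    have *: "e A n z = (if n = to_nat_on S p then E p z else 1) * e (A - {p}) n z" for n
    proof (cases "n = to_nat_on S p")
      case True
      then have "n \<notin> to_nat_on S ` (A - {p})" using inj A by (auto simp: eq_commute)
      then show ?thesis using True p cS pS by (simp add: e_def)
    next
      case False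
      then have "n \<in> to_nat_on S ` (A - {p}) \<longleftrightarrow> n \<in> to_nat_on S ` A" by auto
      then show ?thesis using False by (simp add: e_def)
    qed
    have "A - {p} \<subseteq> S" using A by auto
    then have "(\<lambda>n. e (A - {p}) n z) has_prod P (A - {p}) z"
      unfolding P_def using conv z by blast
    from has_prod_mult[OF has_prod_single[of "to_nat_on S p" "\<lambda>_. E p z"] this]
    have "(\<lambda>n. e A n z) has_prod (E p z * P (A - {p}) z)" unfolding * .
    then show "P A z = E p z * P (A - {p}) z" unfolding P_def by (metis has_prod_iff)
  next
    fix A z assume A: "A \<subseteq> S" and z: "z \<in> D" and nz: "\<And>p. p \<in> A \<Longrightarrow> E p z \<noteq> 0"
    have "e A n z \<noteq> 0" for n
    proof (cases "n \<in> to_nat_on S ` A")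
      case True
      then obtain p where p: "p \<in> A" "n = to_nat_on S p" by auto
      then have "from_nat_into S n = p" using A cS by auto
      then show ?thesis using nz[OF p(1)] by (simp add: e_def)
    qed (simp add: e_def)
    then show "P A z \<noteq> 0"
      unfolding P_def using prodinf_nonzero[OF conv[OF A z]] by blast
  qed
qed

section \<open>Prescribed divisors, interpolation and unit combinations\<close>

text \<open>
  Divisibility by \<open>g\<close> is a local property: where \<open>g\<close> does not vanish the quotient is determined, and
  since its zeros are isolated the local quotients agree with it nearby.
\<close>

lemma local_quotient:
  assumes "\<And>p. p \<in> D \<Longrightarrow> \<exists>r>0. \<exists>q. q holomorphic_on ball p r \<and> (\<forall>z\<in>ball p r. N z = g z * q z)"
    and "\<And>p. p \<in> D \<Longrightarrow> \<exists>r>0. \<forall>z\<in>ball p r - {p}. g z \<noteq> (0::complex)"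
  obtains h where "h holomorphic_on D" "\<And>z. z \<in> D \<Longrightarrow> N z = g z * h z"
proof -
  have "\<exists>rq. p \<in> D \<longrightarrow> fst rq > 0 \<and> snd rq holomorphic_on ball p (fst rq) \<and>
      (\<forall>z\<in>ball p (fst rq). N z = g z * snd rq z)" for p
    using assms(1)[of p] by force
  then obtain rq where rq: "\<forall>p. p \<in> D \<longrightarrow> fst (rq p) > 0 \<and> snd (rq p) holomorphic_on ball p (fst (rq p)) \<and>
      (\<forall>z\<in>ball p (fst (rq p)). N z = g z * snd (rq p) z)"
    using choice[of "\<lambda>p rq. p \<in> D \<longrightarrow> fst rq > 0 \<and> snd rq holomorphic_on ball p (fst rq) \<and>
      (\<forall>z\<in>ball p (fst rq). N z = g z * snd rq z)"] by auto
  define r where "r p = fst (rq p)" for p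
  define q where "q p = snd (rq p)" for p
  have r: "r p > 0" and q: "q p holomorphic_on ball p (r p)"
    and Nq: "\<And>z. z \<in> ball p (r p) \<Longrightarrow> N z = g z * q p z" if "p \<in> D" for p
    using rq that unfolding r_def q_def by auto
  define h where "h z = (if g z = 0 then q z z else N z / g z)" for z
  have "h holomorphic_on D"
  proof (rule holomorphic_on_local)
    fix p assume p: "p \<in> D"
    obtain d where d: "d > 0" "\<forall>z\<in>ball p d - {p}. g z \<noteq> 0" using assms(2)[OF p] by blast
    have "h z = q p z" if "z \<in> ball p (min d (r p))" for z
    proof (cases "z = p")
      case True
      then show ?thesis using Nq[OF p, of p] r[OF p] by (auto simp: h_def)
    next
      case False
      then have "g z \<noteq> 0" using d that by auto
      then show ?thesis using Nq[OF p, of z] that by (auto simp: h_def)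
    qed
    moreover have "q p holomorphic_on ball p (min d (r p))"
      using q[OF p] by (rule holomorphic_on_subset) auto
    ultimately show "\<exists>r>0. \<exists>q. q holomorphic_on ball p r \<and> (\<forall>z\<in>ball p r. h z = q z)"
      using d(1) r[OF p] by (intro exI[of _ "min d (r p)"] conjI exI[of _ "q p"]) auto
  qed
  moreover have "N z = g z * h z" if "z \<in> D" for z
    using Nq[OF that, of z] r[OF that] by (auto simp: h_def)
  ultimately show thesis by (rule that)
qed

lemma zeros_isolated:
  assumes "open D" "connected D" "g holomorphic_on D" "\<exists>z\<in>D. g z \<noteq> 0" "p \<in> D"
  obtains r where "r > 0" "ball p r \<subseteq> D" "\<And>z. z \<in> ball p r - {p} \<Longrightarrow> g z \<noteq> 0"
proof -
  obtain r where r: "r > 0" "cball p r \<subseteq> D" "{z\<in>D. g z = 0} \<inter> cball p r \<subseteq> {p}"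
    using locally_finite_in_isolated[OF assms(1) zeros_locally_finite[OF assms(1-4)] assms(5)] by auto
  show thesis
  proof (rule that[of r])
    show "ball p r \<subseteq> D" using r(2) by auto
    show "g z \<noteq> 0" if "z \<in> ball p r - {p}" for z
    proof
      assume "g z = 0"
      then have "z \<in> {z\<in>D. g z = 0} \<inter> cball p r" using that r(2) by auto
      then show False using r(3) that by auto
    qed
  qed (rule r(1))
qed

lemma factor_order:
  assumes "open D" "connected D" "g holomorphic_on D" "\<exists>z\<in>D. g z \<noteq> 0" "p \<in> D"
  obtains n G where "G holomorphic_on D" "G p \<noteq> 0" "\<And>z. z \<in> D \<Longrightarrow> g z = (z - p) ^ n * G z"
proof (cases "g p = 0")
  case False
  show thesis by (rule that[of g 0]) (use assms False in auto)
next
  case True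
  then have "\<not> g constant_on D" using assms(4,5) unfolding constant_on_def by metis
  then obtain G0 r n where G0: "0 < n" "0 < r" "ball p r \<subseteq> D" "G0 holomorphic_on ball p r"
      "\<And>w. w \<in> ball p r \<Longrightarrow> g w = (w - p) ^ n * G0 w" "\<And>w. w \<in> ball p r \<Longrightarrow> G0 w \<noteq> 0"
    using holomorphic_factor_zero_nonconstant[OF assms(3,1,2,5) True] by metis
  obtain G where G: "G holomorphic_on D" "\<And>z. z \<in> D \<Longrightarrow> g z = (z - p) ^ n * G z"
  proof (rule local_quotient[of D g "\<lambda>z. (z - p) ^ n"])
    fix x assume x: "x \<in> D"
    show "\<exists>r>0. \<forall>z\<in>ball x r - {x}. (z - p) ^ n \<noteq> 0"
    proof (cases "x = p")
      case True then show ?thesis by (intro exI[of _ 1]) auto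
    next
      case False then show ?thesis by (intro exI[of _ "dist x p"]) auto
    qed
    show "\<exists>r>0. \<exists>q. q holomorphic_on ball x r \<and> (\<forall>z\<in>ball x r. g z = (z - p) ^ n * q z)"
    proof (cases "x = p")
      case True then show ?thesis using G0 by (intro exI[of _ r] conjI exI[of _ G0]) auto
    next
      case False
      obtain d where d: "d > 0" "ball x d \<subseteq> D" using assms(1) x open_contains_ball_eq by blast
      have "(\<lambda>z. g z / (z - p) ^ n) holomorphic_on ball x (min d (dist x p))"
        by (intro holomorphic_intros holomorphic_on_subset[OF assms(3)]) (use d in auto)
      then show ?thesis using d(1) False
        by (intro exI[of _ "min d (dist x p)"] conjI exI[of _ "\<lambda>z. g z / (z - p) ^ n"]) auto
    qed
  qed blast
  have "G p = G0 p"
  proof (rule holomorphic_eq_at_limit[of "ball p r" p G G0])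
    show "G holomorphic_on ball p r" using holomorphic_on_subset[OF G(1) G0(3)] .
    fix z assume z: "z \<in> ball p r" "z \<noteq> p"
    then have "(z - p) ^ n * G z = (z - p) ^ n * G0 z" using G(2)[of z] G0(3,5) by auto
    then show "G z = G0 z" using z(2) by simp
  qed (use G0(2,4) in auto)
  then have "G p \<noteq> 0" using G0(2,6) by auto
  show thesis by (rule that[of G n]) (use G \<open>G p \<noteq> 0\<close> in auto)
qed

lemma Taylor_split:
  fixes f :: "complex \<Rightarrow> complex"
  assumes "f holomorphic_on ball p r" "r > 0"
  obtains T Q where "T holomorphic_on UNIV" "Q holomorphic_on ball p r"
    "\<And>z. z \<in> ball p r \<Longrightarrow> f z = T z + (z - p) ^ n * Q z"
proof (induction n arbitrary: thesis)
  case 0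
  show ?case by (rule 0[of "\<lambda>_. 0" f]) (use assms in auto)
next
  case (Suc n)
  obtain T Q where TQ: "T holomorphic_on UNIV" "Q holomorphic_on ball p r"
    "\<And>z. z \<in> ball p r \<Longrightarrow> f z = T z + (z - p) ^ n * Q z"
    using Suc.IH by blast
  define Q' where "Q' z = (if z = p then deriv Q p else (Q z - Q p) / (z - p))" for z
  show ?case
  proof (rule Suc.prems[of "\<lambda>z. T z + (z - p) ^ n * Q p" Q'])
    show "(\<lambda>z. T z + (z - p) ^ n * Q p) holomorphic_on UNIV"
      by (intro holomorphic_intros TQ(1))
    show "Q' holomorphic_on ball p r"
      unfolding Q'_def by (rule pole_lemma[OF TQ(2)]) (use assms(2) in simp)
    fix z assume z: "z \<in> ball p r"
    have Q: "Q z = Q p + (z - p) * Q' z" by (auto simp: Q'_def)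
    show "f z = T z + (z - p) ^ n * Q p + (z - p) ^ Suc n * Q' z"
      unfolding TQ(3)[OF z] by (subst Q) (simp add: algebra_simps)
  qed
qed

lemma power_near_one:
  fixes e :: real
  assumes "e > 0"
  obtains d where "d > 0" "\<And>x::complex. norm (x - 1) < d \<Longrightarrow> norm (x ^ n - 1) < e"
proof -
  have "isCont (\<lambda>x::complex. x ^ n) 1" by (intro continuous_intros)
  then show thesis
    using that assms unfolding continuous_at_eps_delta by (auto simp: dist_norm)
qed

text \<open>
  Prescribed orders of vanishing on an arbitrary open set. The factor at \<open>p\<close> is a power of an
  elementary factor evaluated at \<open>w p\<close>; as \<open>1 - w p z\<close> is \<open>z - p\<close> times a unit, it vanishes
  at \<open>p\<close> only, to the required order.
\<close>

lemma Weierstrass_divisor: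
  fixes m :: "complex \<Rightarrow> nat"
  assumes D: "open D" and S: "locally_finite_in S D"
  obtains g where "g holomorphic_on D" "\<And>z. z \<in> D - S \<Longrightarrow> g z \<noteq> 0"
    "\<And>p. p \<in> S \<Longrightarrow> \<exists>G. G holomorphic_on D \<and> G p \<noteq> 0 \<and> (\<forall>z\<in>D. g z = (z - p) ^ m p * G z)"
proof -
  obtain w v L where wv: "\<And>p. p \<in> S \<Longrightarrow> w p holomorphic_on D" "\<And>p. p \<in> S \<Longrightarrow> v p holomorphic_on D"
    "\<And>p z. p \<in> S \<Longrightarrow> z \<in> D \<Longrightarrow> v p z \<noteq> 0"
    "\<And>p z. p \<in> S \<Longrightarrow> z \<in> D \<Longrightarrow> 1 - w p z = (z - p) * v p z"
    "\<And>p. p \<in> S \<Longrightarrow> compact (L p)" "\<And>p. p \<in> S \<Longrightarrow> L p \<subseteq> D"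
    "\<And>p z. p \<in> S \<Longrightarrow> z \<in> L p \<Longrightarrow> norm (w p z) \<le> 1/2"
    "\<And>K. compact K \<Longrightarrow> K \<subseteq> D \<Longrightarrow> finite {p\<in>S. \<not> K \<subseteq> L p}"
    by (rule cutoffs[OF D S]) blast
  have "\<exists>N. \<forall>x. norm x \<le> 1/2 \<longrightarrow> norm (weierstrass_factor N x ^ m p - 1) \<le> (1/2) ^ to_nat_on S p" for p
  proof -
    obtain d where d: "d > 0" "\<And>x::complex. norm (x - 1) < d \<Longrightarrow> norm (x ^ m p - 1) < (1/2) ^ to_nat_on S p"
      using power_near_one[of "(1/2) ^ to_nat_on S p" "m p"] by auto
    obtain N where N: "(1/2) ^ N < d / 3" using real_arch_pow_inv[of "d/3" "1/2"] d(1) by auto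
    have "norm (weierstrass_factor N x ^ m p - 1) \<le> (1/2) ^ to_nat_on S p" if x: "norm x \<le> 1/2" for x
    proof -
      have "norm (weierstrass_factor N x - 1) \<le> 3 * norm x ^ Suc N"
        by (rule weierstrass_factor_bound[OF x])
      also have "\<dots> \<le> 3 * (1/2) ^ Suc N" using x by (intro mult_left_mono power_mono) auto
      also have "\<dots> \<le> 3 * (1/2) ^ N" by simp
      also have "\<dots> < d" using N by simp
      finally show ?thesis using d(2) by (simp add: less_imp_le)
    qed
    then show ?thesis by blast
  qed
  then obtain N where N: "\<And>p x. norm x \<le> 1/2 \<Longrightarrow>
      norm (weierstrass_factor (N p) x ^ m p - 1) \<le> (1/2) ^ to_nat_on S p"
    by metis
  define E where "E p z = weierstrass_factor (N p) (w p z) ^ m p" for p z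
  have E_hol: "E p holomorphic_on D" if "p \<in> S" for p
    unfolding E_def using wv(1)[OF that] by (intro holomorphic_intros)
  have E_bd: "norm (E p z - 1) \<le> (1/2) ^ to_nat_on S p" if "p \<in> S" "z \<in> L p" for p z
    unfolding E_def by (rule N) (rule wv(7)[OF that])
  obtain P where P: "\<And>A. A \<subseteq> S \<Longrightarrow> P A holomorphic_on D"
    "\<And>A p z. A \<subseteq> S \<Longrightarrow> p \<in> A \<Longrightarrow> z \<in> D \<Longrightarrow> P A z = E p z * P (A - {p}) z"
    "\<And>A z. A \<subseteq> S \<Longrightarrow> z \<in> D \<Longrightarrow> (\<And>p. p \<in> A \<Longrightarrow> E p z \<noteq> 0) \<Longrightarrow> P A z \<noteq> 0"
    by (rule Weierstrass_product[OF D S E_hol wv(8) E_bd]) blast+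
  have E_nz: "E p z \<noteq> 0" if "p \<in> S" "z \<in> D" "z \<noteq> p" for p z
  proof -
    have "1 - w p z \<noteq> 0" using wv(3,4)[OF that(1,2)] that(3) by simp
    then show ?thesis by (simp add: E_def)
  qed
  show thesis
  proof (rule that[of "P S"])
    show "P S holomorphic_on D" using P(1) by simp
    show "P S z \<noteq> 0" if "z \<in> D - S" for z using that E_nz by (intro P(3)) auto
    fix p assume p: "p \<in> S"
    then have pD: "p \<in> D" using S by (auto simp: locally_finite_in_def)
    define G where "G z = (v p z * exp (\<Sum>k=1..N p. w p z ^ k / of_nat k)) ^ m p * P (S - {p}) z" for z
    show "\<exists>G. G holomorphic_on D \<and> G p \<noteq> 0 \<and> (\<forall>z\<in>D. P S z = (z - p) ^ m p * G z)"
    proof (intro exI[of _ G] conjI ballI)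
      show "G holomorphic_on D" unfolding G_def
        by (intro holomorphic_intros wv(1,2)[OF p] P(1)) auto
      have "P (S - {p}) p \<noteq> 0" using pD E_nz by (intro P(3)) auto
      then show "G p \<noteq> 0" using wv(3)[OF p pD] by (simp add: G_def)
      fix z assume z: "z \<in> D"
      have "P S z = E p z * P (S - {p}) z" by (rule P(2)) (use p z in auto)
      also have "E p z = (z - p) ^ m p * (v p z * exp (\<Sum>k=1..N p. w p z ^ k / of_nat k)) ^ m p"
        unfolding E_def weierstrass_factor_def wv(4)[OF p z] by (simp add: power_mult_distrib)
      finally show "P S z = (z - p) ^ m p * G z" by (simp add: G_def)
    qed
  qed
qed

text \<open>
  Prescribing \<open>k\<close> modulo \<open>g\<close> at each zero of \<open>g\<close> amounts to prescribing the principal parts of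
  \<open>k / g\<close>. If \<open>l p / G\<close> has Taylor polynomial \<open>T\<close> at \<open>p\<close>, where \<open>g = (z - p)\<^sup>n G\<close>, the principal
  part is that of \<open>T / (z - p)\<^sup>n\<close>. Multiplying it by \<open>1 - (1 - w\<^sup>j)\<^sup>n\<close>, which differs from \<open>1\<close> by a
  multiple of \<open>(z - p)\<^sup>n\<close> and is small where \<open>w\<^sup>j\<close> is, changes it by a holomorphic function only
  and makes the sum over all zeros converge.
\<close>

lemma interpolation_modulo:
  assumes D: "open D" "connected D" and g: "g holomorphic_on D" "\<exists>z\<in>D. g z \<noteq> 0"
    and l: "\<And>p. p \<in> D \<Longrightarrow> g p = 0 \<Longrightarrow> r p > 0"
      "\<And>p. p \<in> D \<Longrightarrow> g p = 0 \<Longrightarrow> l p holomorphic_on ball p (r p)"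
  obtains k where "k holomorphic_on D"
    "\<And>p. p \<in> D \<Longrightarrow> g p = 0 \<Longrightarrow>
      \<exists>d>0. \<exists>q. q holomorphic_on ball p d \<and> (\<forall>z\<in>ball p d. k z = l p z + g z * q z)"
proof -
  define S where "S = {z\<in>D. g z = 0}"
  have S: "locally_finite_in S D" unfolding S_def by (rule zeros_locally_finite[OF D g])
  have SD: "S \<subseteq> D" by (auto simp: S_def)
  define good where "good p n G T Q d \<longleftrightarrow> G holomorphic_on D \<and> (\<forall>z\<in>D. g z = (z - p) ^ n * G z) \<and>
      T holomorphic_on UNIV \<and> d > 0 \<and> ball p d \<subseteq> D \<and> Q holomorphic_on ball p d \<and>
      (\<forall>z\<in>ball p d. l p z = G z * T z + g z * Q z)" for p n G T Q and d :: real
  have "\<exists>n G T Q d. good p n G T Q d" if "p \<in> S" for p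
  proof -
    have p: "p \<in> D" "g p = 0" using that by (auto simp: S_def)
    obtain n G where G: "G holomorphic_on D" "G p \<noteq> 0" "\<And>z. z \<in> D \<Longrightarrow> g z = (z - p) ^ n * G z"
      using factor_order[OF D g p(1)] by metis
    obtain d0 where d0: "d0 > 0" "ball p d0 \<subseteq> D" "\<And>z. z \<in> ball p d0 - {p} \<Longrightarrow> g z \<noteq> 0"
      using zeros_isolated[OF D g p(1)] by metis
    define d where "d = min d0 (r p)"
    have d: "d > 0" "ball p d \<subseteq> D" "ball p d \<subseteq> ball p (r p)"
      using d0(1,2) l(1)[OF p] by (auto simp: d_def)
    have Gnz: "G z \<noteq> 0" if "z \<in> ball p d" for z
      using G(2) G(3)[of z] d0(3)[of z] that d(2) by (cases "z = p") (auto simp: d_def)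
    have "(\<lambda>z. l p z / G z) holomorphic_on ball p d"
      using Gnz by (intro holomorphic_intros holomorphic_on_subset[OF l(2)[OF p] d(3)]
          holomorphic_on_subset[OF G(1) d(2)]) auto
    from Taylor_split[where n = n, OF this d(1)]
    obtain T Q where TQ: "T holomorphic_on UNIV" "Q holomorphic_on ball p d"
      "\<And>z. z \<in> ball p d \<Longrightarrow> l p z / G z = T z + (z - p) ^ n * Q z"
      by blast
    have "l p z = G z * T z + g z * Q z" if z: "z \<in> ball p d" for z
    proof -
      have "l p z = G z * (l p z / G z)" using Gnz[OF z] by simp
      also have "\<dots> = G z * T z + g z * Q z"
        unfolding TQ(3)[OF z] using G(3)[of z] z d(2) by (simp add: algebra_simps subset_iff)
      finally show ?thesis .
    qed
    then have "good p n G T Q d" unfolding good_def using G TQ d by auto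
    then show ?thesis by blast
  qed
  then obtain n G T Q d where good: "\<And>p. p \<in> S \<Longrightarrow> good p (n p) (G p) (T p) (Q p) (d p)"
    by metis
  obtain w v L where wv: "\<And>p. p \<in> S \<Longrightarrow> w p holomorphic_on D" "\<And>p. p \<in> S \<Longrightarrow> v p holomorphic_on D"
    "\<And>p z. p \<in> S \<Longrightarrow> z \<in> D \<Longrightarrow> v p z \<noteq> 0"
    "\<And>p z. p \<in> S \<Longrightarrow> z \<in> D \<Longrightarrow> 1 - w p z = (z - p) * v p z"
    "\<And>p. p \<in> S \<Longrightarrow> compact (L p)" "\<And>p. p \<in> S \<Longrightarrow> L p \<subseteq> D"
    "\<And>p z. p \<in> S \<Longrightarrow> z \<in> L p \<Longrightarrow> norm (w p z) \<le> 1/2"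
    "\<And>K. compact K \<Longrightarrow> K \<subseteq> D \<Longrightarrow> finite {p\<in>S. \<not> K \<subseteq> L p}"
    by (rule cutoffs[OF D(1) S]) blast
  have pL: "p \<notin> L p" if "p \<in> S" for p
  proof
    assume "p \<in> L p"
    then have "norm (w p p) \<le> 1/2" by (rule wv(7)[OF that])
    moreover have "w p p = 1" using wv(4)[OF that, of p] that SD by auto
    ultimately show False by simp
  qed
  have "\<exists>j. \<forall>z\<in>L p. norm (T p z / (z - p) ^ n p * (1 - (1 - w p z ^ j) ^ n p)) \<le> (1/2) ^ to_nat_on S p"
    if p: "p \<in> S" for p
  proof -
    have "continuous_on (L p) (T p)"
      using good[OF p] holomorphic_on_imp_continuous_on continuous_on_subset
      unfolding good_def by blast
    then have "continuous_on (L p) (\<lambda>z. T p z / (z - p) ^ n p)"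
      using pL[OF p] by (intro continuous_intros) auto
    then have "bounded ((\<lambda>z. T p z / (z - p) ^ n p) ` L p)"
      using compact_continuous_image[OF _ wv(5)[OF p]] compact_imp_bounded by blast
    then obtain B where B: "B > 0" "\<And>z. z \<in> L p \<Longrightarrow> norm (T p z / (z - p) ^ n p) \<le> B"
      unfolding bounded_pos by auto
    obtain e where e: "e > 0"
      "\<And>x::complex. norm (x - 1) < e \<Longrightarrow> norm (x ^ n p - 1) < (1/2) ^ to_nat_on S p / B"
      using power_near_one[of "(1/2) ^ to_nat_on S p / B" "n p"] B(1) by auto
    obtain j where j: "(1/2) ^ j < e" using real_arch_pow_inv[of e "1/2"] e(1) by auto
    have "norm (T p z / (z - p) ^ n p * (1 - (1 - w p z ^ j) ^ n p)) \<le> (1/2) ^ to_nat_on S p"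
      if z: "z \<in> L p" for z
    proof -
      have "norm ((1 - w p z ^ j) - 1) = norm (w p z) ^ j" by (simp add: norm_power)
      also have "\<dots> \<le> (1/2) ^ j" by (rule power_mono[OF wv(7)[OF p z]]) simp
      also have "\<dots> < e" by (rule j)
      finally have "norm ((1 - w p z ^ j) ^ n p - 1) < (1/2) ^ to_nat_on S p / B" by (rule e(2))
      then have "norm (1 - (1 - w p z ^ j) ^ n p) \<le> (1/2) ^ to_nat_on S p / B"
        by (simp add: norm_minus_commute)
      then have "norm (T p z / (z - p) ^ n p) * norm (1 - (1 - w p z ^ j) ^ n p)
          \<le> B * ((1/2) ^ to_nat_on S p / B)"
        using B z by (intro mult_mono) auto
      also have "B * ((1/2) ^ to_nat_on S p / B) = (1/2) ^ to_nat_on S p" using B(1) by simp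
      finally show ?thesis unfolding norm_mult .
    qed
    then show ?thesis by blast
  qed
  then obtain j where j: "\<And>p z. p \<in> S \<Longrightarrow> z \<in> L p \<Longrightarrow>
      norm (T p z / (z - p) ^ n p * (1 - (1 - w p z ^ j p) ^ n p)) \<le> (1/2) ^ to_nat_on S p"
    by metis
  \<comment> \<open>\<open>U\<close> is the factor in \<open>(1 - w\<^sup>j)\<^sup>n = (z - p)\<^sup>n U\<close>, so that \<open>R\<close> is the corrected principal
     part with the cancellation at \<open>p\<close> carried out.\<close>
  define U where "U p z = (v p z * (\<Sum>i<j p. w p z ^ i)) ^ n p" for p z
  define R where "R p z = T p z / (z - p) ^ n p - T p z * U p z" for p z
  have U_hol: "U p holomorphic_on D" if "p \<in> S" for p
    unfolding U_def by (intro holomorphic_intros wv(1,2)[OF that])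
  have T_hol: "T p holomorphic_on A" if "p \<in> S" for p A
    using good[OF that] holomorphic_on_subset unfolding good_def by blast
  have R_hol: "R p holomorphic_on D - {p}" if "p \<in> S" for p
    unfolding R_def
    by (intro holomorphic_intros T_hol[OF that] holomorphic_on_subset[OF U_hol[OF that]]) auto
  have "R p z = T p z / (z - p) ^ n p * (1 - (1 - w p z ^ j p) ^ n p)"
    if "p \<in> S" "z \<in> D" "z \<noteq> p" for p z
  proof -
    have "1 - w p z ^ j p = (z - p) * (v p z * (\<Sum>i<j p. w p z ^ i))"
      using one_diff_power_eq[of "w p z" "j p"] wv(4)[OF that(1,2)] by simp
    then have "(1 - w p z ^ j p) ^ n p = (z - p) ^ n p * U p z"
      by (simp add: U_def power_mult_distrib)
    then show ?thesis using that(3) by (simp add: R_def right_diff_distrib)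
  qed
  then have bound: "norm (R p z) \<le> (1/2) ^ to_nat_on S p" if "p \<in> S" "z \<in> L p" for p z
    using j[OF that] that pL[OF that(1)] wv(6)[OF that(1)] by (metis subsetD)
  obtain M :: "complex set \<Rightarrow> complex \<Rightarrow> complex" where
    M: "\<And>A. A \<subseteq> S \<Longrightarrow> M A holomorphic_on D - A"
      "\<And>A p z. A \<subseteq> S \<Longrightarrow> p \<in> A \<Longrightarrow> z \<in> D - A \<Longrightarrow> M A z = R p z + M (A - {p}) z"
    by (rule Mittag_Leffler_sum[OF D(1) S R_hol wv(8) bound]) blast+
  \<comment> \<open>Off \<open>S\<close> this is \<open>g\<close> times the sum of the principal parts, on \<open>S\<close> its limit.\<close>
  define k where "k z = (if z \<in> S then G z z * T z z else g z * M S z)" for z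
  have loc: "\<exists>d>0. \<exists>q. ball p d \<subseteq> D \<and> q holomorphic_on ball p d \<and> l p holomorphic_on ball p d \<and>
      (\<forall>z\<in>ball p d. k z = l p z + g z * q z)" if p: "p \<in> S" for p
  proof -
    have pD: "p \<in> D" "g p = 0" using p by (auto simp: S_def)
    obtain d0 where d0: "d0 > 0" "cball p d0 \<subseteq> D" "S \<inter> cball p d0 \<subseteq> {p}"
      using locally_finite_in_isolated[OF D(1) S pD(1)] by metis
    have gd: "\<forall>z\<in>D. g z = (z - p) ^ n p * G p z" "d p > 0" "Q p holomorphic_on ball p (d p)"
        "\<And>z. z \<in> ball p (d p) \<Longrightarrow> l p z = G p z * T p z + g z * Q p z"
      using good[OF p] unfolding good_def by auto
    define d' where "d' = Min {d0, d p, r p}"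
    have d': "d' > 0" "d' \<le> d0" "d' \<le> d p" "d' \<le> r p"
      using d0(1) gd(2) l(1)[OF pD] by (auto simp: d'_def)
    have sub: "ball p d' \<subseteq> D - (S - {p})" "ball p d' \<subseteq> D" "ball p d' \<subseteq> ball p (d p)" "ball p d' \<subseteq> ball p (r p)"
      using d0(2,3) d' by (auto simp: subset_iff)
    define q where "q z = M (S - {p}) z - T p z * U p z - Q p z" for z
    have "q holomorphic_on ball p d'"
      unfolding q_def
      by (intro holomorphic_intros T_hol[OF p] holomorphic_on_subset[OF U_hol[OF p] sub(2)]
          holomorphic_on_subset[OF gd(3) sub(3)] holomorphic_on_subset[OF M(1) sub(1)]) auto
    moreover have "k z = l p z + g z * q z" if z: "z \<in> ball p d'" for z
    proof (cases "z = p")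
      case True
      then show ?thesis using gd(2) gd(4)[of p] pD p by (simp add: k_def)
    next
      case False
      then have zS: "z \<in> D - S" using z sub(1) by auto
      have gz: "g z * (T p z / (z - p) ^ n p) = G p z * T p z"
        using gd(1) zS False by simp
      have "l p z = G p z * T p z + g z * Q p z" using z sub(3) by (intro gd(4)) auto
      moreover have "k z = g z * R p z + g z * M (S - {p}) z"
        using M(2)[of S p z] zS p by (simp add: k_def distrib_left)
      moreover have "g z * R p z = G p z * T p z - g z * (T p z * U p z)"
        unfolding R_def right_diff_distrib gz ..
      ultimately show ?thesis by (simp add: q_def algebra_simps)
    qed
    ultimately show ?thesis
      using d'(1) sub holomorphic_on_subset[OF l(2)[OF pD] sub(4)] by blast
  qed
  show thesis
  proof (rule that[of k])
    show "\<exists>d>0. \<exists>q. q holomorphic_on ball p d \<and> (\<forall>z\<in>ball p d. k z = l p z + g z * q z)"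
      if "p \<in> D" "g p = 0" for p
      using loc[of p] that unfolding S_def by blast
    show "k holomorphic_on D"
    proof (rule holomorphic_on_local)
      fix p assume p: "p \<in> D"
      show "\<exists>r>0. \<exists>q. q holomorphic_on ball p r \<and> (\<forall>z\<in>ball p r. k z = q z)"
      proof (cases "p \<in> S")
        case True
        then obtain d q where dq: "d > 0" "ball p d \<subseteq> D" "q holomorphic_on ball p d"
          "l p holomorphic_on ball p d" "\<forall>z\<in>ball p d. k z = l p z + g z * q z"
          using loc by blast
        have "(\<lambda>z. l p z + g z * q z) holomorphic_on ball p d"
          by (intro holomorphic_intros dq(3,4) holomorphic_on_subset[OF g(1) dq(2)])
        then show ?thesis using dq(1,5) by blast
      next
        case False
        then obtain d where d: "d > 0" "ball p d \<subseteq> D - S"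
          using locally_finite_in_open_Diff[OF D(1) S] p open_contains_ball_eq by blast
        have "(\<lambda>z. g z * M S z) holomorphic_on ball p d"
          using d(2) by (intro holomorphic_intros holomorphic_on_subset[OF M(1)[of S]]
              holomorphic_on_subset[OF g(1)]) auto
        moreover have "\<forall>z\<in>ball p d. k z = g z * M S z" using d(2) by (auto simp: k_def)
        ultimately show ?thesis using d(1) by blast
      qed
    qed
  qed
qed

text \<open>
  The ring of holomorphic functions on a planar domain has stable rank one. Interpolate the local
  logarithms \<open>l\<close> of \<open>f\<close> by a global \<open>k\<close> modulo \<open>g\<close>: near a zero of \<open>g\<close>,
  \<open>exp k = f exp (g q)\<close> is congruent to \<open>f\<close> modulo \<open>g\<close>, so \<open>exp k = f + h g\<close> globally.
\<close>

lemma coprime_combination_unit: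
  assumes D: "open D" "connected D" and fg: "f holomorphic_on D" "g holomorphic_on D"
    and coprime: "\<And>z. z \<in> D \<Longrightarrow> f z \<noteq> 0 \<or> g z \<noteq> 0"
  obtains h where "h holomorphic_on D" "\<And>z. z \<in> D \<Longrightarrow> f z + h z * g z \<noteq> 0"
proof (cases "\<exists>z\<in>D. g z \<noteq> 0")
  case False
  show thesis by (rule that[of "\<lambda>_. 0"]) (use False coprime in auto)
next
  case True
  define log_near where "log_near p r l \<longleftrightarrow> r > 0 \<and> ball p r \<subseteq> D \<and> l holomorphic_on ball p r \<and>
      (\<forall>z\<in>ball p r. f z = exp (l z))" for p l and r :: real
  have "\<exists>r l. log_near p r l"
    if p: "p \<in> D" "g p = 0" for p
  proof -
    have "f p \<noteq> 0" using coprime[OF p(1)] p(2) by auto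
    then have ex: "\<exists>z\<in>D. f z \<noteq> 0" using p(1) by blast
    obtain r where r: "r > 0" "ball p r \<subseteq> D" "\<And>z. z \<in> ball p r - {p} \<Longrightarrow> f z \<noteq> 0"
      using zeros_isolated[OF D fg(1) ex p(1)] by metis
    have fnz: "f z \<noteq> 0" if "z \<in> ball p r" for z using r(3)[of z] that \<open>f p \<noteq> 0\<close> by auto
    obtain l where "l holomorphic_on ball p r" "\<And>z. z \<in> ball p r \<Longrightarrow> f z = exp (l z)"
      by (rule contractible_imp_holomorphic_log[OF holomorphic_on_subset[OF fg(1) r(2)]
          convex_imp_contractible[OF convex_ball] fnz]) blast+
    then show ?thesis using r(1,2) unfolding log_near_def by blast
  qed
  then obtain r l where "\<And>p. p \<in> D \<Longrightarrow> g p = 0 \<Longrightarrow> log_near p (r p) (l p)"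
    by metis
  then have rl: "\<And>p. p \<in> D \<Longrightarrow> g p = 0 \<Longrightarrow> r p > 0"
    "\<And>p. p \<in> D \<Longrightarrow> g p = 0 \<Longrightarrow> ball p (r p) \<subseteq> D"
    "\<And>p. p \<in> D \<Longrightarrow> g p = 0 \<Longrightarrow> l p holomorphic_on ball p (r p)"
    "\<And>p z. p \<in> D \<Longrightarrow> g p = 0 \<Longrightarrow> z \<in> ball p (r p) \<Longrightarrow> f z = exp (l p z)"
    unfolding log_near_def by auto
  obtain k where k: "k holomorphic_on D"
    "\<And>p. p \<in> D \<Longrightarrow> g p = 0 \<Longrightarrow>
      \<exists>d>0. \<exists>q. q holomorphic_on ball p d \<and> (\<forall>z\<in>ball p d. k z = l p z + g z * q z)"
    by (rule interpolation_modulo[OF D fg(2) True rl(1,3)]) blast+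
  \<comment> \<open>The entire function \<open>(exp x - 1) / x\<close>, which exhibits \<open>exp (g q) - 1\<close> as a multiple of \<open>g\<close>.\<close>
  define e1 :: "complex \<Rightarrow> complex" where
    "e1 x = (if x = 0 then deriv exp 0 else (exp x - exp 0) / (x - 0))" for x
  have e1_hol: "e1 holomorphic_on UNIV"
    unfolding e1_def by (rule pole_lemma) (auto intro: holomorphic_intros)
  have e1: "exp x = 1 + x * e1 x" for x by (auto simp: e1_def)
  obtain h where h: "h holomorphic_on D" "\<And>z. z \<in> D \<Longrightarrow> exp (k z) - f z = g z * h z"
  proof (rule local_quotient[of D "\<lambda>z. exp (k z) - f z" g])
    fix p assume p: "p \<in> D"
    obtain d where d: "d > 0" "ball p d \<subseteq> D" "\<And>z. z \<in> ball p d - {p} \<Longrightarrow> g z \<noteq> 0"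
      using zeros_isolated[OF D fg(2) True p] by metis
    then show "\<exists>r>0. \<forall>z\<in>ball p r - {p}. g z \<noteq> 0" by blast
    show "\<exists>r>0. \<exists>q. q holomorphic_on ball p r \<and> (\<forall>z\<in>ball p r. exp (k z) - f z = g z * q z)"
    proof (cases "g p = 0")
      case False
      have gnz: "g z \<noteq> 0" if "z \<in> ball p d" for z using d(3)[of z] that False by auto
      have "(\<lambda>z. (exp (k z) - f z) / g z) holomorphic_on ball p d"
        using gnz by (intro holomorphic_intros holomorphic_on_subset[OF k(1) d(2)]
            holomorphic_on_subset[OF fg(1) d(2)] holomorphic_on_subset[OF fg(2) d(2)]) auto
      then show ?thesis using d(1) gnz
        by (intro exI[of _ d] conjI exI[of _ "\<lambda>z. (exp (k z) - f z) / g z"]) auto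
    next
      case True
      obtain d' q where q: "d' > 0" "q holomorphic_on ball p d'"
        "\<And>z. z \<in> ball p d' \<Longrightarrow> k z = l p z + g z * q z"
        using k(2)[OF p True] by blast
      define e where "e = min d' (r p)"
      have e: "e > 0" "ball p e \<subseteq> ball p d'" "ball p e \<subseteq> ball p (r p)" "ball p e \<subseteq> D"
        using q(1) rl(1,2)[OF p True] by (auto simp: e_def)
      have ee: "(\<lambda>z. e1 (g z * q z)) holomorphic_on ball p e"
        using holomorphic_on_compose_gen[of "\<lambda>z. g z * q z" "ball p e" e1 UNIV] e1_hol
        by (auto simp: o_def intro!: holomorphic_intros holomorphic_on_subset[OF fg(2) e(4)]
            holomorphic_on_subset[OF q(2) e(2)])
      have "(\<lambda>z. f z * (q z * e1 (g z * q z))) holomorphic_on ball p e"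
        by (intro holomorphic_intros ee holomorphic_on_subset[OF fg(1) e(4)]
            holomorphic_on_subset[OF q(2) e(2)])
      moreover have "exp (k z) - f z = g z * (f z * (q z * e1 (g z * q z)))" if z: "z \<in> ball p e" for z
      proof -
        have "exp (k z) = f z * exp (g z * q z)"
          using q(3)[OF subsetD[OF e(2) z]] rl(4)[OF p True subsetD[OF e(3) z]]
          by (simp add: exp_add)
        then show ?thesis by (simp add: e1[of "g z * q z"] algebra_simps)
      qed
      ultimately show ?thesis using e(1) by blast
    qed
  qed blast
  show thesis
  proof (rule that[OF h(1)])
    fix z assume "z \<in> D"
    then have "f z + h z * g z = exp (k z)" using h(2)[of z] by (simp add: algebra_simps)
    then show "f z + h z * g z \<noteq> 0" by simp
  qed
qed

section \<open>Zorn coordinates and root automorphisms\<close>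

lemma oct_eq_iff: "x = y \<longleftrightarrow> x$0=y$0 \<and> x$1=y$1 \<and> x$2=y$2 \<and> x$3=y$3 \<and> x$4=y$4 \<and> x$5=y$5 \<and> x$6=y$6 \<and> x$7=y$7"
  for x y :: "'a ^ 8"
  by (simp add: vec_eq_iff forall_8)

text \<open>
  Zorn's vector matrices \<open>(a, u; v, b)\<close>: the scalars \<open>a\<close> and \<open>b\<close> are the coordinates \<open>0\<close> and \<open>4\<close>,
  the vectors \<open>u\<close> and \<open>v\<close> are the coordinates \<open>1, 2, 3\<close> and \<open>5, 6, 7\<close>. The product is
  \<open>(a a' + u v', a u' + b' u - v \<times> v'; a' v + b v' + u \<times> u', b b' + v u')\<close>.
\<close>

definition zorn_mult :: "complex ^ 8 \<Rightarrow> complex ^ 8 \<Rightarrow> complex ^ 8" where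
  "zorn_mult x y = oct
    (x$0*y$0 + (x$1*y$5 + x$2*y$6 + x$3*y$7))
    (x$0*y$1 + y$4*x$1 - (x$6*y$7 - x$7*y$6))
    (x$0*y$2 + y$4*x$2 - (x$7*y$5 - x$5*y$7))
    (x$0*y$3 + y$4*x$3 - (x$5*y$6 - x$6*y$5))
    (x$4*y$4 + (x$5*y$1 + x$6*y$2 + x$7*y$3))
    (y$0*x$5 + x$4*y$5 + (x$2*y$3 - x$3*y$2))
    (y$0*x$6 + x$4*y$6 + (x$3*y$1 - x$1*y$3))
    (y$0*x$7 + x$4*y$7 + (x$1*y$2 - x$2*y$1))"

text \<open>
  The idempotents \<open>(1 \<mp> \<i> e\<^sub>7) / 2\<close> correspond to the two diagonal entries. Left multiplication by
  \<open>e\<^sub>7\<close> has the eigenvalues \<open>\<i>\<close> and \<open>-\<i>\<close> on the span of the other \<open>e\<^sub>j\<close>; the eigenvectors are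
  \<open>e\<^sub>1 \<mp> \<i> e\<^sub>3\<close>, \<open>e\<^sub>2 \<mp> \<i> e\<^sub>6\<close> and \<open>e\<^sub>4 \<mp> \<i> e\<^sub>5\<close>, and they carry \<open>u\<close> and \<open>v\<close>.
\<close>

definition to_zorn :: "complex ^ 8 \<Rightarrow> complex ^ 8" where
  "to_zorn x = oct (x$0 + \<i>*x$7) (-x$1 - \<i>*x$3) (-x$2 - \<i>*x$6) (-x$4 - \<i>*x$5)
     (x$0 - \<i>*x$7) (x$1 - \<i>*x$3) (x$2 - \<i>*x$6) (x$4 - \<i>*x$5)"

definition from_zorn :: "complex ^ 8 \<Rightarrow> complex ^ 8" where
  "from_zorn y = oct ((y$0 + y$4)/2) ((y$5 - y$1)/2) ((y$6 - y$2)/2) (\<i>*(y$1 + y$5)/2)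
     ((y$7 - y$3)/2) (\<i>*(y$3 + y$7)/2) (\<i>*(y$2 + y$6)/2) (- \<i>*(y$0 - y$4)/2)"

lemma to_from_zorn: "to_zorn (from_zorn y) = y"
  by (simp add: oct_eq_iff to_zorn_def from_zorn_def field_simps)

lemma from_to_zorn: "from_zorn (to_zorn x) = x"
  by (simp add: oct_eq_iff to_zorn_def from_zorn_def field_simps)

lemma to_zorn_mult: "to_zorn (x \<odot> y) = zorn_mult (to_zorn x) (to_zorn y)"
  by (simp add: oct_eq_iff to_zorn_def zorn_mult_def oct_mult_def algebra_simps)

text \<open>
  Root elements of \<open>G\<^sub>\<complex>\<close>, products of commuting ones, and a torus. The long roots and the torus come from \<open>SL\<^sub>3\<close>, which acts on
  \<open>u\<close> by \<open>A\<close> and on \<open>v\<close> by the inverse transpose of \<open>A\<close>. The short root elements have parameters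
  in the direction of one coordinate \<open>u\<^sub>k\<close> or \<open>v\<^sub>k\<close>; they are quadratic in the parameter, being
  exponentials of derivations with vanishing third power.
\<close>

definition long_up :: "complex \<Rightarrow> complex \<Rightarrow> complex ^ 8 \<Rightarrow> complex ^ 8" where
  "long_up s t x = oct (x$0) (x$1 + s*x$2 + t*x$3) (x$2) (x$3) (x$4) (x$5) (x$6 - s*x$5) (x$7 - t*x$5)"
definition long_low :: "complex \<Rightarrow> complex \<Rightarrow> complex ^ 8 \<Rightarrow> complex ^ 8" where
  "long_low s t x = oct (x$0) (x$1) (x$2 + s*x$1) (x$3 + t*x$1) (x$4) (x$5 - s*x$6 - t*x$7) (x$6) (x$7)"
definition long_23 :: "complex \<Rightarrow> complex ^ 8 \<Rightarrow> complex ^ 8" where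
  "long_23 t x = oct (x$0) (x$1) (x$2 + t*x$3) (x$3) (x$4) (x$5) (x$6) (x$7 - t*x$6)"
definition long_32 :: "complex \<Rightarrow> complex ^ 8 \<Rightarrow> complex ^ 8" where
  "long_32 t x = oct (x$0) (x$1) (x$2) (x$3 + t*x$2) (x$4) (x$5) (x$6 - t*x$7) (x$7)"
definition torus :: "complex \<Rightarrow> complex ^ 8 \<Rightarrow> complex ^ 8" where
  "torus t x = oct (x$0) (t*x$1) (x$2/t) (x$3) (x$4) (x$5/t) (t*x$6) (x$7)"
definition short_2 :: "complex \<Rightarrow> complex ^ 8 \<Rightarrow> complex ^ 8" where
  "short_2 t x = oct (x$0 - t*x$6) (x$1) (x$2 + t*(x$0-x$4) - t^2*x$6) (x$3) (x$4 + t*x$6)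
     (x$5 + t*x$3) (x$6) (x$7 - t*x$1)"
definition short_3 :: "complex \<Rightarrow> complex ^ 8 \<Rightarrow> complex ^ 8" where
  "short_3 t x = oct (x$0 - t*x$7) (x$1) (x$2) (x$3 + t*(x$0-x$4) - t^2*x$7) (x$4 + t*x$7)
     (x$5 - t*x$2) (x$6 + t*x$1) (x$7)"
definition short_low :: "complex \<Rightarrow> complex ^ 8 \<Rightarrow> complex ^ 8" where
  "short_low t x = oct (x$0 - t*x$1) (x$1) (x$2 - t*x$7) (x$3 + t*x$6) (x$4 + t*x$1)
     (x$5 + t*(x$0-x$4) - t^2*x$1) (x$6) (x$7)"

lemma long_up_mult: "long_up s t (zorn_mult x y) = zorn_mult (long_up s t x) (long_up s t y)"
  by (simp add: oct_eq_iff long_up_def zorn_mult_def algebra_simps)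
lemma long_low_mult: "long_low s t (zorn_mult x y) = zorn_mult (long_low s t x) (long_low s t y)"
  by (simp add: oct_eq_iff long_low_def zorn_mult_def algebra_simps)
lemma long_23_mult: "long_23 t (zorn_mult x y) = zorn_mult (long_23 t x) (long_23 t y)"
  by (simp add: oct_eq_iff long_23_def zorn_mult_def algebra_simps)
lemma long_32_mult: "long_32 t (zorn_mult x y) = zorn_mult (long_32 t x) (long_32 t y)"
  by (simp add: oct_eq_iff long_32_def zorn_mult_def algebra_simps)
lemma torus_mult: "t \<noteq> 0 \<Longrightarrow> torus t (zorn_mult x y) = zorn_mult (torus t x) (torus t y)"
  by (simp add: oct_eq_iff torus_def zorn_mult_def field_simps)
lemma short_2_mult: "short_2 t (zorn_mult x y) = zorn_mult (short_2 t x) (short_2 t y)"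
  by (simp add: oct_eq_iff short_2_def zorn_mult_def algebra_simps power2_eq_square)
lemma short_3_mult: "short_3 t (zorn_mult x y) = zorn_mult (short_3 t x) (short_3 t y)"
  by (simp add: oct_eq_iff short_3_def zorn_mult_def algebra_simps power2_eq_square)
lemma short_low_mult: "short_low t (zorn_mult x y) = zorn_mult (short_low t x) (short_low t y)"
  by (simp add: oct_eq_iff short_low_def zorn_mult_def algebra_simps power2_eq_square)

section \<open>Holomorphic families of automorphisms\<close>

lemma linear_s_iff: "Vector_Spaces.linear (*s) (*s) (f :: complex^'n \<Rightarrow> complex^'m) \<longleftrightarrow>
    (\<forall>x y. f (x + y) = f x + f y) \<and> (\<forall>c x. f (c *s x) = c *s f x)"
  unfolding Vector_Spaces.linear_iff by (simp add: vec.vector_space_axioms)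

lemma to_zorn_linear: "to_zorn (x + y) = to_zorn x + to_zorn y" "to_zorn (c *s x) = c *s to_zorn x"
  by (simp_all add: oct_eq_iff to_zorn_def algebra_simps)
lemma from_zorn_linear: "from_zorn (x + y) = from_zorn x + from_zorn y" "from_zorn (c *s x) = c *s from_zorn x"
  by (simp_all add: oct_eq_iff from_zorn_def algebra_simps add_divide_distrib diff_divide_distrib)

lemma from_zorn_mult: "from_zorn (zorn_mult x y) = from_zorn x \<odot> from_zorn y"
  by (metis to_zorn_mult to_from_zorn from_to_zorn)

text \<open>
  Holomorphic families of multiplicative linear maps in Zorn coordinates. Bijectivity is not part
  of the definition: it is obtained from an explicit inverse family, for root elements the
  one with the negated parameter.
\<close>

definition zorn_aut_family :: "complex set \<Rightarrow> (complex \<Rightarrow> octonion_C \<Rightarrow> octonion_C) \<Rightarrow> bool" where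
  "zorn_aut_family D \<rho> \<longleftrightarrow>
     (\<forall>z\<in>D. (\<forall>x y. \<rho> z (x + y) = \<rho> z x + \<rho> z y) \<and> (\<forall>c x. \<rho> z (c *s x) = c *s \<rho> z x) \<and>
            (\<forall>x y. \<rho> z (zorn_mult x y) = zorn_mult (\<rho> z x) (\<rho> z y))) \<and>
     (\<forall>x. vec_holomorphic_on (\<lambda>z. \<rho> z x) D)"

lemma vec8_holomorphic_on_iff: "vec_holomorphic_on F D \<longleftrightarrow>
    (\<lambda>z. F z $ 0) holomorphic_on D \<and> (\<lambda>z. F z $ 1) holomorphic_on D \<and> (\<lambda>z. F z $ 2) holomorphic_on D \<and>
    (\<lambda>z. F z $ 3) holomorphic_on D \<and> (\<lambda>z. F z $ 4) holomorphic_on D \<and> (\<lambda>z. F z $ 5) holomorphic_on D \<and>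
    (\<lambda>z. F z $ 6) holomorphic_on D \<and> (\<lambda>z. F z $ 7) holomorphic_on D"
  for F :: "complex \<Rightarrow> complex ^ 8"
  by (simp add: vec_holomorphic_on_def forall_8)

lemma from_zorn_holomorphic:
  "vec_holomorphic_on F D \<Longrightarrow> vec_holomorphic_on (\<lambda>z. from_zorn (F z)) D"
  unfolding vec8_holomorphic_on_iff by (auto simp: from_zorn_def intro!: holomorphic_intros)

lemma to_zorn_holomorphic:
  "vec_holomorphic_on F D \<Longrightarrow> vec_holomorphic_on (\<lambda>z. to_zorn (F z)) D"
  unfolding vec8_holomorphic_on_iff by (auto simp: to_zorn_def intro!: holomorphic_intros)

text \<open>
  Condition (iv) of the theorem. The relation \<open>G_equiv\<close> asks for it in both
  directions, which suits the elimination, where each step comes with its inverse.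
\<close>

definition G_moves :: "complex set \<Rightarrow> (complex \<Rightarrow> octonion_C) \<Rightarrow> (complex \<Rightarrow> octonion_C) \<Rightarrow> bool" where
  "G_moves D V W \<longleftrightarrow> (\<exists>\<phi>. holomorphic_into_G_C D \<phi> \<and> (\<forall>z\<in>D. W z = \<phi> z (V z)))"

definition G_equiv :: "complex set \<Rightarrow> (complex \<Rightarrow> octonion_C) \<Rightarrow> (complex \<Rightarrow> octonion_C) \<Rightarrow> bool" where
  "G_equiv D V W \<longleftrightarrow> G_moves D V W \<and> G_moves D W V"

definition zorn_equiv :: "complex set \<Rightarrow> (complex \<Rightarrow> octonion_C) \<Rightarrow> (complex \<Rightarrow> octonion_C) \<Rightarrow> bool" where
  "zorn_equiv D X Y \<longleftrightarrow> G_equiv D (\<lambda>z. from_zorn (X z)) (\<lambda>z. from_zorn (Y z))"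

lemma holomorphic_into_G_C_compose:
  assumes "holomorphic_into_G_C D \<phi>" "holomorphic_into_G_C D \<psi>"
  shows "holomorphic_into_G_C D (\<lambda>z. \<phi> z \<circ> \<psi> z)"
  unfolding holomorphic_into_G_C_def
proof (intro conjI ballI allI)
  fix z assume "z \<in> D"
  then have G: "\<phi> z \<in> G_C" "\<psi> z \<in> G_C" using assms by (auto simp: holomorphic_into_G_C_def)
  then show "\<phi> z \<circ> \<psi> z \<in> G_C"
    by (auto simp: G_C_def linear_s_iff intro: bij_comp)
next
  fix i j
  have "(\<lambda>z. (\<Sum>k\<in>UNIV. matrix (\<phi> z) $ i $ k * matrix (\<psi> z) $ k $ j)) holomorphic_on D"
    using assms by (intro holomorphic_intros) (auto simp: holomorphic_into_G_C_def)
  moreover have "matrix (\<phi> z \<circ> \<psi> z) $ i $ j = (\<Sum>k\<in>UNIV. matrix (\<phi> z) $ i $ k * matrix (\<psi> z) $ k $ j)"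
    if "z \<in> D" for z
  proof -
    have "Vector_Spaces.linear (*s) (*s) (\<phi> z)" "Vector_Spaces.linear (*s) (*s) (\<psi> z)"
      using assms that by (auto simp: holomorphic_into_G_C_def G_C_def)
    then show ?thesis by (simp add: matrix_compose_gen matrix_matrix_mult_def)
  qed
  ultimately show "(\<lambda>z. matrix (\<phi> z \<circ> \<psi> z) $ i $ j) holomorphic_on D"
    by (simp cong: holomorphic_cong)
qed

lemma holomorphic_into_G_C_id: "holomorphic_into_G_C D (\<lambda>z x. x)"
  by (auto simp: holomorphic_into_G_C_def G_C_def linear_s_iff bij_def matrix_def)

lemma G_moves_trans:
  assumes "G_moves D U V" "G_moves D V W"
  shows "G_moves D U W"
proof -
  from assms(1) obtain \<phi> where 1: "holomorphic_into_G_C D \<phi>" "\<forall>z\<in>D. V z = \<phi> z (U z)"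
    unfolding G_moves_def by (elim exE conjE)
  from assms(2) obtain \<psi> where 2: "holomorphic_into_G_C D \<psi>" "\<forall>z\<in>D. W z = \<psi> z (V z)"
    unfolding G_moves_def by (elim exE conjE)
  show ?thesis
    unfolding G_moves_def
    by (rule exI[of _ "\<lambda>z. \<psi> z \<circ> \<phi> z"]) (use 1 2 in \<open>simp add: holomorphic_into_G_C_compose\<close>)
qed

lemma G_equiv_trans: "G_equiv D U V \<Longrightarrow> G_equiv D V W \<Longrightarrow> G_equiv D U W"
  unfolding G_equiv_def using G_moves_trans by blast

lemma zorn_aut_family_imp_G_C:
  assumes "zorn_aut_family D \<rho>" and inv: "\<And>z x. z \<in> D \<Longrightarrow> \<sigma> z (\<rho> z x) = x" "\<And>z x. z \<in> D \<Longrightarrow> \<rho> z (\<sigma> z x) = x"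
  shows "holomorphic_into_G_C D (\<lambda>z x. from_zorn (\<rho> z (to_zorn x)))"
  unfolding holomorphic_into_G_C_def
proof (intro conjI ballI allI)
  fix z assume z: "z \<in> D"
  have "bij (\<lambda>x. from_zorn (\<rho> z (to_zorn x)))"
  proof (rule o_bij[of "\<lambda>x. from_zorn (\<sigma> z (to_zorn x))"])
  qed (auto simp: fun_eq_iff to_from_zorn from_to_zorn inv[OF z])
  then show "(\<lambda>x. from_zorn (\<rho> z (to_zorn x))) \<in> G_C"
    using assms(1) z
    by (simp add: G_C_def linear_s_iff zorn_aut_family_def to_zorn_linear from_zorn_linear
        to_zorn_mult from_zorn_mult)
next
  fix i j
  have "vec_holomorphic_on (\<lambda>z. from_zorn (\<rho> z (to_zorn (axis j 1)))) D"
    using assms(1) unfolding zorn_aut_family_def by (intro from_zorn_holomorphic) auto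
  then show "(\<lambda>z. matrix (\<lambda>x. from_zorn (\<rho> z (to_zorn x))) $ i $ j) holomorphic_on D"
    by (simp add: matrix_def vec_holomorphic_on_def)
qed

lemma zorn_equivI:
  assumes "zorn_aut_family D \<rho>" "zorn_aut_family D \<sigma>"
    and inv: "\<And>z x. z \<in> D \<Longrightarrow> \<sigma> z (\<rho> z x) = x" "\<And>z x. z \<in> D \<Longrightarrow> \<rho> z (\<sigma> z x) = x"
  shows "zorn_equiv D (\<lambda>z. \<rho> z (X z)) X"
  unfolding zorn_equiv_def G_equiv_def G_moves_def
proof (intro conjI)
  show "\<exists>\<phi>. holomorphic_into_G_C D \<phi> \<and> (\<forall>z\<in>D. from_zorn (\<rho> z (X z)) = \<phi> z (from_zorn (X z)))"
    by (rule exI[of _ "\<lambda>z x. from_zorn (\<rho> z (to_zorn x))"])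
      (simp add: to_from_zorn zorn_aut_family_imp_G_C[of D \<rho> \<sigma>] assms)
  show "\<exists>\<phi>. holomorphic_into_G_C D \<phi> \<and> (\<forall>z\<in>D. from_zorn (X z) = \<phi> z (from_zorn (\<rho> z (X z))))"
    by (rule exI[of _ "\<lambda>z x. from_zorn (\<sigma> z (to_zorn x))"])
      (simp add: to_from_zorn zorn_aut_family_imp_G_C[of D \<sigma> \<rho>] assms)
qed

lemmas root_defs = long_up_def long_low_def long_23_def long_32_def torus_def short_2_def short_3_def short_low_def

lemma long_up_equiv:
  assumes "s holomorphic_on D" "t holomorphic_on D"
  shows "zorn_equiv D (\<lambda>z. long_up (s z) (t z) (X z)) X"
proof (rule zorn_equivI[where \<rho> = "\<lambda>z. long_up (s z) (t z)" and \<sigma> = "\<lambda>z. long_up (- s z) (- t z)"])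
  show "zorn_aut_family D (\<lambda>z. long_up (s z) (t z))" "zorn_aut_family D (\<lambda>z. long_up (- s z) (- t z))"
    using assms unfolding zorn_aut_family_def vec8_holomorphic_on_iff
    by (auto simp: long_up_mult) (auto simp: long_up_def oct_eq_iff algebra_simps intro!: holomorphic_intros)
qed (auto simp: long_up_def oct_eq_iff algebra_simps)

lemma long_low_equiv:
  assumes "s holomorphic_on D" "t holomorphic_on D"
  shows "zorn_equiv D (\<lambda>z. long_low (s z) (t z) (X z)) X"
proof (rule zorn_equivI[where \<rho> = "\<lambda>z. long_low (s z) (t z)" and \<sigma> = "\<lambda>z. long_low (- s z) (- t z)"])
  show "zorn_aut_family D (\<lambda>z. long_low (s z) (t z))" "zorn_aut_family D (\<lambda>z. long_low (- s z) (- t z))"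
    using assms unfolding zorn_aut_family_def vec8_holomorphic_on_iff
    by (auto simp: long_low_mult) (auto simp: long_low_def oct_eq_iff algebra_simps intro!: holomorphic_intros)
qed (auto simp: long_low_def oct_eq_iff algebra_simps)

lemma long_23_equiv:
  assumes "t holomorphic_on D"
  shows "zorn_equiv D (\<lambda>z. long_23 (t z) (X z)) X"
proof (rule zorn_equivI[where \<rho> = "\<lambda>z. long_23 (t z)" and \<sigma> = "\<lambda>z. long_23 (- t z)"])
  show "zorn_aut_family D (\<lambda>z. long_23 (t z))" "zorn_aut_family D (\<lambda>z. long_23 (- t z))"
    using assms unfolding zorn_aut_family_def vec8_holomorphic_on_iff
    by (auto simp: long_23_mult) (auto simp: long_23_def oct_eq_iff algebra_simps intro!: holomorphic_intros)
qed (auto simp: long_23_def oct_eq_iff algebra_simps)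

lemma long_32_equiv:
  assumes "t holomorphic_on D"
  shows "zorn_equiv D (\<lambda>z. long_32 (t z) (X z)) X"
proof (rule zorn_equivI[where \<rho> = "\<lambda>z. long_32 (t z)" and \<sigma> = "\<lambda>z. long_32 (- t z)"])
  show "zorn_aut_family D (\<lambda>z. long_32 (t z))" "zorn_aut_family D (\<lambda>z. long_32 (- t z))"
    using assms unfolding zorn_aut_family_def vec8_holomorphic_on_iff
    by (auto simp: long_32_mult) (auto simp: long_32_def oct_eq_iff algebra_simps intro!: holomorphic_intros)
qed (auto simp: long_32_def oct_eq_iff algebra_simps)

lemma torus_equiv:
  assumes "t holomorphic_on D" "\<And>z. z \<in> D \<Longrightarrow> t z \<noteq> 0"
  shows "zorn_equiv D (\<lambda>z. torus (t z) (X z)) X"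
proof (rule zorn_equivI[where \<rho> = "\<lambda>z. torus (t z)" and \<sigma> = "\<lambda>z. torus (1 / t z)"])
  show "zorn_aut_family D (\<lambda>z. torus (t z))" "zorn_aut_family D (\<lambda>z. torus (1 / t z))"
    using assms unfolding zorn_aut_family_def vec8_holomorphic_on_iff
    by (auto simp: torus_mult)
      (auto simp: torus_def oct_eq_iff algebra_simps add_divide_distrib intro!: holomorphic_intros)
qed (use assms in \<open>auto simp: torus_def oct_eq_iff\<close>)

lemma short_2_equiv:
  assumes "t holomorphic_on D"
  shows "zorn_equiv D (\<lambda>z. short_2 (t z) (X z)) X"
proof (rule zorn_equivI[where \<rho> = "\<lambda>z. short_2 (t z)" and \<sigma> = "\<lambda>z. short_2 (- t z)"])
  show "zorn_aut_family D (\<lambda>z. short_2 (t z))" "zorn_aut_family D (\<lambda>z. short_2 (- t z))"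
    using assms unfolding zorn_aut_family_def vec8_holomorphic_on_iff
    by (auto simp: short_2_mult) (auto simp: short_2_def oct_eq_iff algebra_simps intro!: holomorphic_intros)
qed (auto simp: short_2_def oct_eq_iff algebra_simps power2_eq_square)

lemma short_3_equiv:
  assumes "t holomorphic_on D"
  shows "zorn_equiv D (\<lambda>z. short_3 (t z) (X z)) X"
proof (rule zorn_equivI[where \<rho> = "\<lambda>z. short_3 (t z)" and \<sigma> = "\<lambda>z. short_3 (- t z)"])
  show "zorn_aut_family D (\<lambda>z. short_3 (t z))" "zorn_aut_family D (\<lambda>z. short_3 (- t z))"
    using assms unfolding zorn_aut_family_def vec8_holomorphic_on_iff
    by (auto simp: short_3_mult) (auto simp: short_3_def oct_eq_iff algebra_simps intro!: holomorphic_intros)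
qed (auto simp: short_3_def oct_eq_iff algebra_simps power2_eq_square)

lemma short_low_equiv:
  assumes "t holomorphic_on D"
  shows "zorn_equiv D (\<lambda>z. short_low (t z) (X z)) X"
proof (rule zorn_equivI[where \<rho> = "\<lambda>z. short_low (t z)" and \<sigma> = "\<lambda>z. short_low (- t z)"])
  show "zorn_aut_family D (\<lambda>z. short_low (t z))" "zorn_aut_family D (\<lambda>z. short_low (- t z))"
    using assms unfolding zorn_aut_family_def vec8_holomorphic_on_iff
    by (auto simp: short_low_mult) (auto simp: short_low_def oct_eq_iff algebra_simps intro!: holomorphic_intros)
qed (auto simp: short_low_def oct_eq_iff algebra_simps power2_eq_square)

section \<open>Invariants of a single automorphism\<close>

text \<open>
  The quadratic equation of the octonions. Any multiplicative map that fixes \<open>1\<close> respects it; this is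
  what ties automorphisms to trace and norm.
\<close>

lemma oct_square: "x \<odot> x = (2 * x $ 0) *s x - (\<Sum>i\<in>UNIV. (x $ i)\<^sup>2) *s oct_one" for x :: octonion_C
  by (simp add: oct_eq_iff oct_mult_def oct_one_def sum_8 power2_eq_square algebra_simps)

lemma G_C_one:
  assumes "\<alpha> \<in> G_C" shows "\<alpha> oct_one = oct_one"
proof -
  obtain u where "\<alpha> u = oct_one" using assms unfolding G_C_def by (metis (no_types, lifting) bij_pointE mem_Collect_eq)
  then have "\<alpha> oct_one = \<alpha> oct_one \<odot> \<alpha> u" by (simp add: oct_mult_one)
  also have "\<dots> = \<alpha> (oct_one \<odot> u)" using assms by (simp add: G_C_def)
  also have "\<dots> = \<alpha> u" by (simp add: oct_one_mult)
  finally show ?thesis using \<open>\<alpha> u = oct_one\<close> by simp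
qed

lemma G_C_linear:
  assumes "\<alpha> \<in> G_C"
  shows "\<alpha> (x + y) = \<alpha> x + \<alpha> y" "\<alpha> (c *s x) = c *s \<alpha> x" "\<alpha> (x - y) = \<alpha> x - \<alpha> y"
    "\<alpha> (x \<odot> y) = \<alpha> x \<odot> \<alpha> y" "\<alpha> x = 0 \<longleftrightarrow> x = 0" "\<alpha> x = \<alpha> y \<longleftrightarrow> x = y"
proof -
  have l: "\<And>x y. \<alpha> (x + y) = \<alpha> x + \<alpha> y" "\<And>c x. \<alpha> (c *s x) = c *s \<alpha> x"
    "\<And>x y. \<alpha> (x \<odot> y) = \<alpha> x \<odot> \<alpha> y" and b: "inj \<alpha>"
    using assms by (auto simp: G_C_def linear_s_iff bij_def)
  show "\<alpha> (x + y) = \<alpha> x + \<alpha> y" "\<alpha> (c *s x) = c *s \<alpha> x" "\<alpha> (x \<odot> y) = \<alpha> x \<odot> \<alpha> y"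
    "\<alpha> x = \<alpha> y \<longleftrightarrow> x = y"
    using l b by (auto simp: inj_eq)
  show "\<alpha> (x - y) = \<alpha> x - \<alpha> y"
    using l(1)[of "x - y" y] by (simp add: algebra_simps)
  have "\<alpha> 0 = 0" using l(2)[of 0 0] by simp
  then show "\<alpha> x = 0 \<longleftrightarrow> x = 0" using b by (metis injD)
qed

text \<open>
  For imaginary \<open>x\<close> the square of \<open>y = \<alpha> x\<close> is scalar. By the quadratic equation so is \<open>Tr(y) y\<close>, and
  if \<open>Tr(y)\<close> were not zero then \<open>y\<close>, and with it \<open>x\<close>, would be scalar and imaginary, hence zero.
\<close>

lemma G_C_trace:
  assumes "\<alpha> \<in> G_C" shows "\<alpha> x $ 0 = x $ 0"
proof -
  note lin = G_C_linear[OF assms]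
  have im: "\<alpha> x $ 0 = 0" if x: "x $ 0 = 0" for x
  proof (rule ccontr)
    define y where "y = \<alpha> x"
    assume "\<alpha> x $ 0 \<noteq> 0"
    then have y0: "y $ 0 \<noteq> 0" by (simp add: y_def)
    have "(2 * y $ 0) *s y - (\<Sum>i\<in>UNIV. (y $ i)\<^sup>2) *s oct_one = \<alpha> (x \<odot> x)"
      using oct_square[of y] lin(4)[of x x] by (simp add: y_def)
    also have "\<dots> = - (\<Sum>i\<in>UNIV. (x $ i)\<^sup>2) *s oct_one"
      unfolding oct_square[of x] lin(3) lin(2) x G_C_one[OF assms] by (simp add: vec_eq_iff)
    finally have "y $ i = 0" if "i \<noteq> 0" for i
      using y0 that unfolding vec_eq_iff using exhaust_8[of i]
      by (auto simp: oct_one_def forall_8)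
    then have scalar: "y = y $ 0 *s oct_one" by (auto simp: oct_eq_iff oct_one_def)
    have "\<alpha> x = \<alpha> (y $ 0 *s oct_one)"
      unfolding lin(2) G_C_one[OF assms] y_def[symmetric] by (rule scalar)
    then have "x = y $ 0 *s oct_one" by (simp only: lin(6))
    then have "x $ 0 = y $ 0" by (metis oct_component(1) oct_one_def vector_smult_component mult.right_neutral)
    then show False using x y0 by simp
  qed
  have "\<alpha> x = \<alpha> (x - x $ 0 *s oct_one) + x $ 0 *s oct_one"
    by (simp add: lin(2,3) G_C_one[OF assms])
  moreover have "\<alpha> (x - x $ 0 *s oct_one) $ 0 = 0" by (rule im) (simp add: oct_one_def)
  ultimately have "\<alpha> x $ 0 = 0 + (x $ 0 *s oct_one :: octonion_C) $ 0" by (metis vector_add_component)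
  then show ?thesis by (simp add: oct_one_def)
qed

text \<open>
  Apply \<open>\<alpha>\<close> to the quadratic equation of \<open>x\<close> and compare with that of \<open>\<alpha> x\<close>; the traces agree already.
\<close>

lemma G_C_norm:
  assumes "\<alpha> \<in> G_C" shows "(\<Sum>i\<in>UNIV. (\<alpha> x $ i)\<^sup>2) = (\<Sum>i\<in>UNIV. (x $ i)\<^sup>2)"
proof -
  note lin = G_C_linear[OF assms]
  have "(2 * \<alpha> x $ 0) *s \<alpha> x - (\<Sum>i\<in>UNIV. (\<alpha> x $ i)\<^sup>2) *s oct_one = \<alpha> (x \<odot> x)"
    using oct_square[of "\<alpha> x"] lin(4)[of x x] by simp
  also have "\<dots> = (2 * \<alpha> x $ 0) *s \<alpha> x - (\<Sum>i\<in>UNIV. (x $ i)\<^sup>2) *s oct_one"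
    unfolding oct_square[of x] lin(3) lin(2) G_C_one[OF assms] G_C_trace[OF assms] ..
  finally have "(\<Sum>i\<in>UNIV. (\<alpha> x $ i)\<^sup>2) *s (oct_one :: octonion_C) = (\<Sum>i\<in>UNIV. (x $ i)\<^sup>2) *s oct_one"
    by simp
  from arg_cong[OF this, of "\<lambda>v. v $ 0"] show ?thesis
    by (simp only: vector_smult_component oct_one_def oct_component mult_1_right)
qed

lemma G_moves_holomorphic:
  assumes "G_moves D V W" "vec_holomorphic_on V D"
  shows "vec_holomorphic_on W D"
proof -
  obtain \<phi> where \<phi>: "holomorphic_into_G_C D \<phi>" "\<forall>z\<in>D. W z = \<phi> z (V z)"
    using assms(1) unfolding G_moves_def by (elim exE conjE)
  show ?thesis
    unfolding vec_holomorphic_on_def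
  proof
    fix i
    have "(\<lambda>z. \<Sum>j\<in>UNIV. matrix (\<phi> z) $ i $ j * V z $ j) holomorphic_on D"
      using assms(2) \<phi>(1) by (intro holomorphic_intros) (auto simp: holomorphic_into_G_C_def vec_holomorphic_on_def)
    moreover have "W z $ i = (\<Sum>j\<in>UNIV. matrix (\<phi> z) $ i $ j * V z $ j)" if z: "z \<in> D" for z
    proof -
      have "Vector_Spaces.linear (*s) (*s) (\<phi> z)"
        using \<phi>(1) z by (auto simp: holomorphic_into_G_C_def G_C_def)
      from matrix_works[OF this, of "V z"] have "W z = matrix (\<phi> z) *v V z" using \<phi>(2) z by simp
      then show ?thesis by (simp add: matrix_vector_mult_def)
    qed
    ultimately show "(\<lambda>z. W z $ i) holomorphic_on D" by (simp cong: holomorphic_cong)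
  qed
qed

lemma G_moves_invariants:
  assumes "G_moves D V W" "z \<in> D"
  shows "W z $ 0 = V z $ 0" "(\<Sum>i\<in>UNIV. (W z $ i)\<^sup>2) = (\<Sum>i\<in>UNIV. (V z $ i)\<^sup>2)" "W z = 0 \<longleftrightarrow> V z = 0"
proof -
  obtain \<phi> where \<phi>: "holomorphic_into_G_C D \<phi>" "\<forall>z\<in>D. W z = \<phi> z (V z)"
    using assms(1) unfolding G_moves_def by (elim exE conjE)
  then have *: "\<phi> z \<in> G_C" "W z = \<phi> z (V z)" using assms(2) by (auto simp: holomorphic_into_G_C_def)
  then show "W z $ 0 = V z $ 0" "(\<Sum>i\<in>UNIV. (W z $ i)\<^sup>2) = (\<Sum>i\<in>UNIV. (V z $ i)\<^sup>2)" "W z = 0 \<longleftrightarrow> V z = 0"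
    by (auto simp: G_C_trace G_C_norm G_C_linear(5))
qed

section \<open>A normal form for nowhere vanishing imaginary maps\<close>

definition zorn_norm :: "octonion_C \<Rightarrow> complex" where
  "zorn_norm y = y$0 * y$4 - (y$1 * y$5 + y$2 * y$6 + y$3 * y$7)"

lemma zorn_norm_eq: "(\<Sum>i\<in>UNIV. (from_zorn y $ i)\<^sup>2) = zorn_norm y"
  by (simp add: sum_8 zorn_norm_def from_zorn_def power2_eq_square field_simps)

lemma from_zorn_0: "from_zorn y $ 0 = (y $ 0 + y $ 4) / 2"
  by (simp add: from_zorn_def)

lemma from_zorn_eq_0: "from_zorn y = 0 \<longleftrightarrow> y = 0"
proof
  assume "from_zorn y = 0"
  then have "to_zorn (from_zorn y) = to_zorn 0" by simp
  then show "y = 0" by (simp add: to_from_zorn) (simp add: oct_eq_iff to_zorn_def)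
qed (simp add: oct_eq_iff from_zorn_def)

text \<open>
  Nowhere vanishing holomorphic maps into the imaginary octonions, in Zorn coordinates, where the
  trace is the sum of the two diagonal entries.
\<close>

definition admissible :: "complex set \<Rightarrow> (complex \<Rightarrow> octonion_C) \<Rightarrow> bool" where
  "admissible D X \<longleftrightarrow> vec_holomorphic_on X D \<and> (\<forall>z\<in>D. X z $ 4 = - X z $ 0 \<and> X z \<noteq> 0)"

lemma zorn_equiv_admissible:
  assumes "zorn_equiv D Y X" "admissible D X"
  shows "admissible D Y" "\<And>z. z \<in> D \<Longrightarrow> zorn_norm (Y z) = zorn_norm (X z)"
proof -
  have m: "G_moves D (\<lambda>z. from_zorn (X z)) (\<lambda>z. from_zorn (Y z))"
    using assms(1) by (simp add: zorn_equiv_def G_equiv_def)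
  have "vec_holomorphic_on (\<lambda>z. from_zorn (Y z)) D"
    by (rule G_moves_holomorphic[OF m from_zorn_holomorphic]) (use assms(2) in \<open>simp add: admissible_def\<close>)
  from to_zorn_holomorphic[OF this] have "vec_holomorphic_on Y D" by (simp add: to_from_zorn)
  moreover have "Y z $ 4 = - Y z $ 0 \<and> Y z \<noteq> 0" if z: "z \<in> D" for z
  proof -
    have "X z $ 4 = - X z $ 0" "X z \<noteq> 0" using assms(2) z by (auto simp: admissible_def)
    then show ?thesis
      using G_moves_invariants(1,3)[OF m z] by (simp add: from_zorn_0 from_zorn_eq_0 add_eq_0_iff)
  qed
  ultimately show "admissible D Y" by (simp add: admissible_def)
  show "zorn_norm (Y z) = zorn_norm (X z)" if "z \<in> D" for z
    using G_moves_invariants(2)[OF m that] by (simp add: zorn_norm_eq)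
qed

lemma zorn_equiv_trans: "zorn_equiv D X Y \<Longrightarrow> zorn_equiv D Y Z \<Longrightarrow> zorn_equiv D X Z"
  unfolding zorn_equiv_def by (rule G_equiv_trans)

lemma zorn_equiv_refl: "zorn_equiv D X X"
proof -
  have "(\<lambda>z. long_23 0 (X z)) = X" by (simp add: fun_eq_iff oct_eq_iff long_23_def)
  then show ?thesis using long_23_equiv[of "\<lambda>_. 0" D X] by simp
qed

text \<open>
  General position: a complex parameter can avoid the roots of countably many polynomials.
\<close>

lemma generic_parameter:
  assumes "countable P" "\<And>p. p \<in> P \<Longrightarrow> p \<noteq> (0 :: complex poly)"
  obtains t where "\<And>p. p \<in> P \<Longrightarrow> poly p t \<noteq> 0"
proof -
  have "countable (\<Union>p\<in>P. {t. poly p t = 0})"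
    using assms by (intro countable_UN) (auto intro: countable_finite poly_roots_finite)
  then have "(\<Union>p\<in>P. {t. poly p t = 0}) \<noteq> UNIV"
    using uncountable_UNIV_complex by auto
  then show thesis using that by blast
qed

text \<open>
  A one-parameter family that fixes \<open>u\<^sub>1\<close> and feeds every coordinate other than \<open>u\<^sub>1\<close> and \<open>v\<^sub>1\<close> into
  \<open>u\<^sub>2\<close>. The exponent \<open>4\<close> keeps the contributions in different powers of \<open>t\<close>, so that they cannot
  cancel.
\<close>

definition generic_root :: "complex \<Rightarrow> octonion_C \<Rightarrow> octonion_C" where
  "generic_root t x = long_23 (t ^ 4) (short_2 t (long_32 t x))"

lemma generic_root_1: "generic_root t x $ 1 = x $ 1"
  by (simp add: generic_root_def root_defs)

lemma generic_root_2:
  assumes "x $ 4 = - x $ 0"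
  shows "generic_root t x $ 2 = poly [:x$2, 2 * x$0, - x$6, x$7, x$3, x$2:] t"
  using assms by (simp add: generic_root_def root_defs algebra_simps power2_eq_square power3_eq_cube power4_eq_xxxx)

lemma generic_root_equiv: "zorn_equiv D (\<lambda>z. generic_root t (X z)) X"
  unfolding generic_root_def
  by (rule zorn_equiv_trans[OF long_23_equiv zorn_equiv_trans[OF short_2_equiv long_32_equiv]])
    (auto intro: holomorphic_intros)

lemma long_const_equiv: "zorn_equiv D (\<lambda>z. long_up s t (X z)) X" "zorn_equiv D (\<lambda>z. long_low s t (X z)) X"
  by (rule long_up_equiv long_low_equiv; simp)+

text \<open>
  The first of three generic moves. At one point, bring a nonzero vector into a position with
  \<open>u\<^sub>1\<close> and \<open>u\<^sub>2\<close> nonzero; by the identity theorem these coordinates then have isolated zeros.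
\<close>

lemma move_to_nonzero_coordinates:
  assumes X: "admissible D X" and z0: "z0 \<in> D"
  obtains Y where "zorn_equiv D Y X" "Y z0 $ 1 \<noteq> 0" "Y z0 $ 2 \<noteq> 0"
proof -
  \<comment> \<open>The vectors for which \<open>generic_root\<close> can make \<open>u\<^sub>2\<close> nonzero.\<close>
  define active where "active x \<longleftrightarrow> x$2 \<noteq> 0 \<or> x$3 \<noteq> 0 \<or> x$0 \<noteq> 0 \<or> x$6 \<noteq> 0 \<or> x$7 \<noteq> (0::complex)" for x :: octonion_C
  have "\<exists>Y. zorn_equiv D Y X \<and> active (Y z0)"
  proof (cases "active (X z0)")
    case True
    then show ?thesis using zorn_equiv_refl by blast
  next
    case False
    then have "X z0 $ 1 \<noteq> 0 \<or> X z0 $ 5 \<noteq> 0"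
      using X z0 by (auto simp: admissible_def active_def oct_eq_iff)
    then show ?thesis
    proof
      assume "X z0 $ 1 \<noteq> 0"
      then have "active (long_low 1 0 (X z0))" using False by (simp add: active_def long_low_def)
      then show ?thesis using long_const_equiv(2)[of D 1 0 X] by blast
    next
      assume "X z0 $ 5 \<noteq> 0"
      then have "active (long_up 1 0 (X z0))" using False by (simp add: active_def long_up_def)
      then show ?thesis using long_const_equiv(1)[of D 1 0 X] by blast
    qed
  qed
  then obtain Y where Y: "zorn_equiv D Y X" "active (Y z0)" by blast
  have adm: "admissible D Y" using zorn_equiv_admissible(1)[OF Y(1) X] .
  define p where "p = [:Y z0$2, 2 * Y z0$0, - Y z0$6, Y z0$7, Y z0$3, Y z0$2:]"
  have "p \<noteq> 0" using Y(2) by (auto simp: p_def active_def)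
  then obtain t where t: "poly p t \<noteq> 0" using generic_parameter[of "{p}"] by auto
  define Y1 where "Y1 z = generic_root t (Y z)" for z
  have Y1: "zorn_equiv D Y1 X"
    unfolding Y1_def using zorn_equiv_trans[OF generic_root_equiv Y(1)] .
  have Y12: "Y1 z0 $ 2 \<noteq> 0"
    using t generic_root_2[of "Y z0" t] adm z0 by (simp add: Y1_def p_def admissible_def)
  show thesis
  proof (cases "Y1 z0 $ 1 = 0")
    case False
    then show thesis using that[OF Y1] Y12 by blast
  next
    case True
    show thesis
      by (rule that[OF zorn_equiv_trans[OF long_const_equiv(1)[of D 1 0 Y1] Y1]])
        (use True Y12 in \<open>simp_all add: long_up_def\<close>)
  qed
qed

lemma countable_zeros:
  assumes "open D" "connected D" "g holomorphic_on D" "\<exists>z\<in>D. g z \<noteq> 0"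
  shows "countable {z\<in>D. g z = 0}"
  by (rule locally_finite_in_countable[OF assms(1) zeros_locally_finite[OF assms]])

text \<open>
  \<open>generic_root\<close> is powerless at points where only \<open>v\<^sub>1\<close> is nonzero. The operation
  \<open>u\<^sub>1 += t u\<^sub>3\<close>, \<open>v\<^sub>3 -= t v\<^sub>1\<close> removes them. It leaves \<open>u\<^sub>2\<close> alone, so only the countably many zeros of
  \<open>u\<^sub>2\<close> have to be watched, and there a generic \<open>t\<close> keeps \<open>v\<^sub>3\<close> from vanishing.
\<close>

lemma move_off_axis:
  assumes D: "open D" "connected D" and X: "admissible D X" and z0: "z0 \<in> D" "X z0 $ 1 \<noteq> 0" "X z0 $ 2 \<noteq> 0"
  obtains Y where "zorn_equiv D Y X" "Y z0 $ 1 \<noteq> 0"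
    "\<And>z. z \<in> D \<Longrightarrow> Y z $ 1 = 0 \<Longrightarrow>
       Y z$2 \<noteq> 0 \<or> Y z$3 \<noteq> 0 \<or> Y z$0 \<noteq> 0 \<or> Y z$6 \<noteq> 0 \<or> Y z$7 \<noteq> 0"
proof -
  have hol: "(\<lambda>z. X z $ i) holomorphic_on D" for i
    using X by (simp add: admissible_def vec_holomorphic_on_def)
  define S where "S = {z\<in>D. X z $ 2 = 0}"
  have "countable S" unfolding S_def by (rule countable_zeros[OF D hol]) (use z0 in blast)
  define P where "P = insert [:X z0 $ 1, X z0 $ 3:] ((\<lambda>z. [:X z $ 7, - X z $ 5:]) ` {z\<in>S. X z $ 7 \<noteq> 0 \<or> X z $ 5 \<noteq> 0})"
  have "countable {z\<in>S. X z $ 7 \<noteq> 0 \<or> X z $ 5 \<noteq> 0}"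
    by (rule countable_subset[OF _ \<open>countable S\<close>]) auto
  then have "countable P" unfolding P_def by auto
  moreover have "p \<noteq> 0" if "p \<in> P" for p using that z0 by (auto simp: P_def)
  ultimately obtain t where t: "\<And>p. p \<in> P \<Longrightarrow> poly p t \<noteq> 0"
    using generic_parameter[of P] by blast
  define Y where "Y z = long_up 0 t (X z)" for z
  show thesis
  proof (rule that[of Y])
    show "zorn_equiv D Y X" unfolding Y_def by (rule long_const_equiv)
    show "Y z0 $ 1 \<noteq> 0" using t[of "[:X z0 $ 1, X z0 $ 3:]"] by (simp add: P_def Y_def long_up_def)
    fix z assume z: "z \<in> D" "Y z $ 1 = 0"
    show "Y z$2 \<noteq> 0 \<or> Y z$3 \<noteq> 0 \<or> Y z$0 \<noteq> 0 \<or> Y z$6 \<noteq> 0 \<or> Y z$7 \<noteq> 0"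
    proof (rule ccontr)
      assume "\<not> ?thesis"
      then have y: "Y z$2 = 0" "Y z$3 = 0" "Y z$0 = 0" "Y z$6 = 0" "Y z$7 = 0" by auto
      then have x: "X z$2 = 0" "X z$3 = 0" "X z$0 = 0" "X z$6 = 0" "X z$7 - t * X z$5 = 0" "X z$1 = 0"
        using z(2) by (auto simp: Y_def long_up_def)
      have "X z $ 7 = 0 \<and> X z $ 5 = 0"
      proof (rule ccontr)
        assume "\<not> ?thesis"
        then have "[:X z $ 7, - X z $ 5:] \<in> P" using x(1) z(1) by (auto simp: P_def S_def)
        from t[OF this] show False using x(5) by simp
      qed
      then show False using X z(1) x by (auto simp: admissible_def oct_eq_iff)
    qed
  qed
qed

text \<open>
  As \<open>u\<^sub>1\<close> is fixed by \<open>generic_root\<close>, it suffices to make \<open>u\<^sub>2\<close> nonzero at the countably many zeros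
  of \<open>u\<^sub>1\<close>.
\<close>

lemma move_to_coprime:
  assumes D: "open D" "connected D" and X: "admissible D X" and z0: "z0 \<in> D" "X z0 $ 1 \<noteq> 0"
    and off: "\<And>z. z \<in> D \<Longrightarrow> X z $ 1 = 0 \<Longrightarrow>
       X z$2 \<noteq> 0 \<or> X z$3 \<noteq> 0 \<or> X z$0 \<noteq> 0 \<or> X z$6 \<noteq> 0 \<or> X z$7 \<noteq> 0"
  obtains Y where "zorn_equiv D Y X" "\<And>z. z \<in> D \<Longrightarrow> Y z $ 1 \<noteq> 0 \<or> Y z $ 2 \<noteq> 0"
proof -
  have hol: "(\<lambda>z. X z $ i) holomorphic_on D" for i
    using X by (simp add: admissible_def vec_holomorphic_on_def)
  define S where "S = {z\<in>D. X z $ 1 = 0}"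
  define P where "P = (\<lambda>z. [:X z$2, 2 * X z$0, - X z$6, X z$7, X z$3, X z$2:]) ` S"
  have "countable S" unfolding S_def by (rule countable_zeros[OF D hol]) (use z0 in blast)
  then have "countable P" unfolding P_def by simp
  moreover have "p \<noteq> 0" if "p \<in> P" for p using that off by (auto simp: P_def S_def)
  ultimately obtain t where t: "\<And>p. p \<in> P \<Longrightarrow> poly p t \<noteq> 0"
    using generic_parameter[of P] by blast
  show thesis
  proof (rule that[OF generic_root_equiv])
    fix z assume z: "z \<in> D"
    have "X z $ 4 = - X z $ 0" using X z by (simp add: admissible_def)
    note r = generic_root_2[OF this, of t]
    show "generic_root t (X z) $ 1 \<noteq> 0 \<or> generic_root t (X z) $ 2 \<noteq> 0"
    proof (cases "z \<in> S")
      case True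
      have "generic_root t (X z) $ 2 \<noteq> 0"
        unfolding r by (rule t) (use True in \<open>simp add: P_def\<close>)
      then show ?thesis ..
    next
      case False
      then show ?thesis using z by (simp add: generic_root_1 S_def)
    qed
  qed
qed

text \<open>
  Elimination with the pivot \<open>u\<^sub>1\<close>. The order matters: once \<open>v\<^sub>2\<close> and \<open>v\<^sub>3\<close> are zero, clearing
  \<open>u\<^sub>2\<close>, \<open>u\<^sub>3\<close> and then the diagonal does not bring them back.
\<close>

lemma normalise_unit_coordinate:
  assumes X: "admissible D X" and unit: "\<And>z. z \<in> D \<Longrightarrow> X z $ 1 \<noteq> 0"
  obtains Y b where "zorn_equiv D Y X" "\<And>z. z \<in> D \<Longrightarrow> Y z = oct 0 1 0 0 0 (b z) 0 0"
proof -
  have hol: "(\<lambda>z. X z $ i) holomorphic_on D" if "admissible D X" for i X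
    using that by (simp add: admissible_def vec_holomorphic_on_def)
  define X1 where "X1 z = short_3 (- X z $ 6 / X z $ 1) (X z)" for z
  have E1: "zorn_equiv D X1 X" unfolding X1_def
    by (rule short_3_equiv) (use unit hol[OF X] in \<open>auto intro!: holomorphic_intros\<close>)
  note A1 = zorn_equiv_admissible(1)[OF E1 X]
  have x1: "X1 z $ 1 \<noteq> 0" "X1 z $ 6 = 0" if "z \<in> D" for z
    using unit[OF that] by (simp_all add: X1_def short_3_def)
  define X2 where "X2 z = short_2 (X1 z $ 7 / X1 z $ 1) (X1 z)" for z
  have E2: "zorn_equiv D X2 X1" unfolding X2_def
    by (rule short_2_equiv) (use x1 hol[OF A1] in \<open>auto intro!: holomorphic_intros\<close>)
  note A2 = zorn_equiv_admissible(1)[OF E2 A1]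
  have x2: "X2 z $ 1 \<noteq> 0" "X2 z $ 6 = 0" "X2 z $ 7 = 0" if "z \<in> D" for z
    using x1[OF that] by (simp_all add: X2_def short_2_def)
  define X3 where "X3 z = long_low (- X2 z $ 2 / X2 z $ 1) (- X2 z $ 3 / X2 z $ 1) (X2 z)" for z
  have E3: "zorn_equiv D X3 X2" unfolding X3_def
    by (rule long_low_equiv) (use x2 hol[OF A2] in \<open>auto intro!: holomorphic_intros\<close>)
  note A3 = zorn_equiv_admissible(1)[OF E3 A2]
  have x3: "X3 z $ 1 \<noteq> 0" "X3 z $ 6 = 0" "X3 z $ 7 = 0" "X3 z $ 2 = 0" "X3 z $ 3 = 0" if "z \<in> D" for z
    using x2[OF that] by (simp_all add: X3_def long_low_def)
  define X4 where "X4 z = short_low (X3 z $ 0 / X3 z $ 1) (X3 z)" for z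
  have E4: "zorn_equiv D X4 X3" unfolding X4_def
    by (rule short_low_equiv) (use x3 hol[OF A3] in \<open>auto intro!: holomorphic_intros\<close>)
  note A4 = zorn_equiv_admissible(1)[OF E4 A3]
  have x4: "X4 z $ 1 \<noteq> 0" "X4 z $ 6 = 0" "X4 z $ 7 = 0" "X4 z $ 2 = 0" "X4 z $ 3 = 0" "X4 z $ 0 = 0" if "z \<in> D" for z
    using x3[OF that] by (simp_all add: X4_def short_low_def)
  have x4': "X4 z $ 4 = 0" if "z \<in> D" for z
    using A4 x4(6)[OF that] that by (simp add: admissible_def)
  define X5 where "X5 z = torus (1 / X4 z $ 1) (X4 z)" for z
  have E5: "zorn_equiv D X5 X4" unfolding X5_def
    by (rule torus_equiv) (use x4 hol[OF A4] in \<open>auto intro!: holomorphic_intros\<close>)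
  show thesis
  proof (rule that[of X5 "\<lambda>z. X5 z $ 5"])
    show "zorn_equiv D X5 X"
      by (rule zorn_equiv_trans[OF E5 zorn_equiv_trans[OF E4 zorn_equiv_trans[OF E3 zorn_equiv_trans[OF E2 E1]]]])
    show "X5 z = oct 0 1 0 0 0 (X5 z $ 5) 0 0" if "z \<in> D" for z
      using x4[OF that] x4'[OF that] by (simp add: oct_eq_iff X5_def torus_def)
  qed
qed

text \<open>
  The three generic moves make \<open>u\<^sub>1\<close> and \<open>u\<^sub>2\<close> coprime, stable rank one turns \<open>u\<^sub>1\<close> into a unit, and
  elimination leaves a single free coordinate, which the invariance of the norm determines.
\<close>

theorem zorn_normal_form:
  assumes D: "open D" "connected D" and X: "admissible D X"
  obtains Y where "zorn_equiv D Y X" "\<And>z. z \<in> D \<Longrightarrow> Y z = oct 0 1 0 0 0 (- zorn_norm (X z)) 0 0"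
proof (cases "D = {}")
  case True
  show thesis by (rule that[of X]) (use True zorn_equiv_refl in auto)
next
  case False
  then obtain z0 where z0: "z0 \<in> D" by blast
  obtain X1 where X1: "zorn_equiv D X1 X" "X1 z0 $ 1 \<noteq> 0" "X1 z0 $ 2 \<noteq> 0"
    by (rule move_to_nonzero_coordinates[OF X z0])
  note A1 = zorn_equiv_admissible(1)[OF X1(1) X]
  obtain X2 where X2: "zorn_equiv D X2 X1" "X2 z0 $ 1 \<noteq> 0"
    "\<And>z. z \<in> D \<Longrightarrow> X2 z $ 1 = 0 \<Longrightarrow>
       X2 z$2 \<noteq> 0 \<or> X2 z$3 \<noteq> 0 \<or> X2 z$0 \<noteq> 0 \<or> X2 z$6 \<noteq> 0 \<or> X2 z$7 \<noteq> 0"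
    by (rule move_off_axis[OF D A1 z0 X1(2,3)]) blast
  note A2 = zorn_equiv_admissible(1)[OF X2(1) A1]
  obtain X3 where X3: "zorn_equiv D X3 X2" "\<And>z. z \<in> D \<Longrightarrow> X3 z $ 1 \<noteq> 0 \<or> X3 z $ 2 \<noteq> 0"
    by (rule move_to_coprime[OF D A2 z0 X2(2,3)]) blast+
  note A3 = zorn_equiv_admissible(1)[OF X3(1) A2]
  have hol: "(\<lambda>z. X3 z $ i) holomorphic_on D" for i
    using A3 by (simp add: admissible_def vec_holomorphic_on_def)
  obtain h where h: "h holomorphic_on D" "\<And>z. z \<in> D \<Longrightarrow> X3 z $ 1 + h z * X3 z $ 2 \<noteq> 0"
    by (rule coprime_combination_unit[OF D hol hol X3(2)]) blast+
  define X4 where "X4 z = long_up (h z) 0 (X3 z)" for z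
  have X4: "zorn_equiv D X4 X3" unfolding X4_def by (rule long_up_equiv) (use h in auto)
  note A4 = zorn_equiv_admissible(1)[OF X4 A3]
  have unit: "X4 z $ 1 \<noteq> 0" if "z \<in> D" for z using h(2)[OF that] by (simp add: X4_def long_up_def)
  obtain Y b where Y: "zorn_equiv D Y X4" "\<And>z. z \<in> D \<Longrightarrow> Y z = oct 0 1 0 0 0 (b z) 0 0"
    by (rule normalise_unit_coordinate[OF A4 unit]) blast+
  have YX: "zorn_equiv D Y X"
    by (rule zorn_equiv_trans[OF Y(1) zorn_equiv_trans[OF X4 zorn_equiv_trans[OF X3(1) zorn_equiv_trans[OF X2(1) X1(1)]]]])
  have "Y z = oct 0 1 0 0 0 (- zorn_norm (X z)) 0 0" if "z \<in> D" for z
  proof -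
    have "zorn_norm (Y z) = - b z" unfolding Y(2)[OF that] by (simp add: zorn_norm_def)
    then have "b z = - zorn_norm (X z)" using zorn_equiv_admissible(2)[OF YX X that] by simp
    then show ?thesis using Y(2)[OF that] by simp
  qed
  with YX show thesis by (rule that)
qed

section \<open>Divisors and central divisors\<close>

lemma divisor_cong:
  assumes "open D" "\<And>z. z \<in> D \<Longrightarrow> F z = G z"
  shows "divisor D F = divisor D G"
proof
  fix p show "divisor D F p = divisor D G p"
  proof (cases "p \<in> D")
    case True
    have "zorder (\<lambda>z. F z $ i) p = zorder (\<lambda>z. G z $ i) p" for i
    proof (rule zorder_cong)
      show "\<forall>\<^sub>F z in at p. F z $ i = G z $ i"
        using eventually_at_in_open[OF assms(1) True] by eventually_elim (use assms(2) in auto)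
    qed simp
    moreover have "(\<exists>z\<in>D. F z $ i \<noteq> 0) \<longleftrightarrow> (\<exists>z\<in>D. G z $ i \<noteq> 0)" for i using assms(2) by auto
    ultimately show ?thesis by (simp add: divisor_def)
  qed (simp add: divisor_def)
qed

text \<open>
  The divisor at \<open>p\<close> is the power of \<open>z - p\<close> that can be taken out of the vector, leaving a vector
  that is nonzero at \<open>p\<close>. This form, unlike the minimum of orders of coordinates, is visibly
  compatible with linear substitutions.
\<close>

lemma divisor_eqI:
  fixes V W :: "complex \<Rightarrow> complex ^ 'n"
  assumes D: "open D" "connected D" "p \<in> D" and W: "vec_holomorphic_on W D" "W p \<noteq> 0"
    and VW: "\<And>z. z \<in> D \<Longrightarrow> V z = (z - p) ^ m *s W z"
  shows "divisor D V p = int m"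
proof -
  let ?Z = "{zorder (\<lambda>z. V z $ i) p | i. \<exists>z\<in>D. V z $ i \<noteq> 0}"
  have hol: "(\<lambda>z. W z $ i) holomorphic_on D" for i using W(1) by (simp add: vec_holomorphic_on_def)
  have ord: "\<exists>k. zorder (\<lambda>z. V z $ i) p = int (m + k) \<and> (W p $ i \<noteq> 0 \<longrightarrow> k = 0)"
    if nz: "\<exists>z\<in>D. V z $ i \<noteq> 0" for i
  proof -
    have "\<exists>z\<in>D. W z $ i \<noteq> 0" using nz VW by force
    from factor_order[OF D(1,2) hol this D(3)]
    obtain k G where G: "G holomorphic_on D" "G p \<noteq> 0" "\<And>z. z \<in> D \<Longrightarrow> W z $ i = (z - p) ^ k * G z"
      by blast
    have "zorder (\<lambda>z. V z $ i) p = int (m + k)"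
    proof (rule zorder_eqI[OF D(1,3) G(1,2)])
      fix w assume "w \<in> D" "w \<noteq> p"
      then show "V w $ i = G w * (w - p) powi int (m + k)"
        using VW[of w] G(3)[of w] by (simp add: power_int_def power_add nat_add_distrib)
    qed
    moreover have "W p $ i \<noteq> 0 \<longrightarrow> k = 0" using G(3)[OF D(3)] by (cases k) auto
    ultimately show ?thesis by blast
  qed
  obtain i where i: "W p $ i \<noteq> 0" using W(2) by (auto simp: vec_eq_iff)
  have "\<exists>z\<in>D. V z $ i \<noteq> 0"
  proof (rule ccontr)
    assume "\<not> ?thesis"
    then have "W p $ i = 0"
      using VW by (intro holomorphic_eq_at_limit[OF D(1,3) hol, of "\<lambda>_. 0"]) force+
    with i show False by blast
  qed
  then have "int m \<in> ?Z" using ord[of i] i by force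
  moreover have "finite ?Z" by simp
  moreover have "int m \<le> x" if "x \<in> ?Z" for x using that ord by force
  ultimately have "Min ?Z = int m" by (intro Min_eqI) auto
  then show ?thesis using D(3) by (simp add: divisor_def)
qed

lemma divisor_factor:
  fixes V :: "complex \<Rightarrow> complex ^ 'n"
  assumes D: "open D" "connected D" "p \<in> D" and V: "vec_holomorphic_on V D" "\<exists>z\<in>D. V z \<noteq> 0"
  obtains m W where "vec_holomorphic_on W D" "W p \<noteq> 0" "\<And>z. z \<in> D \<Longrightarrow> V z = (z - p) ^ m *s W z"
    "divisor D V p = int m"
proof -
  have hol: "(\<lambda>z. V z $ i) holomorphic_on D" for i using V(1) by (simp add: vec_holomorphic_on_def)
  define I where "I = {i. \<exists>z\<in>D. V z $ i \<noteq> 0}"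
  define good where "good i k G \<longleftrightarrow> G holomorphic_on D \<and> G p \<noteq> 0 \<and> (\<forall>z\<in>D. V z $ i = (z - p) ^ k * G z)" for i k G
  have "\<exists>k G. good i k G" if "i \<in> I" for i
  proof -
    have "\<exists>z\<in>D. V z $ i \<noteq> 0" using that by (simp add: I_def)
    from factor_order[OF D(1,2) hol this D(3)] show ?thesis unfolding good_def by metis
  qed
  then obtain k G where "\<And>i. i \<in> I \<Longrightarrow> good i (k i) (G i)" by metis
  then have kG: "\<And>i. i \<in> I \<Longrightarrow> G i holomorphic_on D" "\<And>i. i \<in> I \<Longrightarrow> G i p \<noteq> 0"
    "\<And>i z. i \<in> I \<Longrightarrow> z \<in> D \<Longrightarrow> V z $ i = (z - p) ^ k i * G i z"
    unfolding good_def by auto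
  have "I \<noteq> {}" using V(2) by (auto simp: I_def vec_eq_iff)
  define m where "m = Min (k ` I)"
  have m_le: "m \<le> k i" if "i \<in> I" for i using that by (simp add: m_def)
  have "m \<in> k ` I" unfolding m_def using \<open>I \<noteq> {}\<close> by (intro Min_in) auto
  then obtain i0 where i0: "i0 \<in> I" "k i0 = m" by auto
  define W where "W z = (\<chi> i. if i \<in> I then (z - p) ^ (k i - m) * G i z else 0)" for z
  have W: "vec_holomorphic_on W D"
    unfolding vec_holomorphic_on_def
  proof
    fix i show "(\<lambda>z. W z $ i) holomorphic_on D"
      using kG(1)[of i] by (cases "i \<in> I") (auto simp: W_def intro!: holomorphic_intros)
  qed
  have "W p $ i0 \<noteq> 0" using i0 kG(2) by (simp add: W_def)
  then have Wp: "W p \<noteq> 0" by (metis zero_index)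
  have VW: "V z = (z - p) ^ m *s W z" if z: "z \<in> D" for z
    unfolding vec_eq_iff
  proof
    fix i
    show "V z $ i = ((z - p) ^ m *s W z) $ i"
    proof (cases "i \<in> I")
      case True
      then show ?thesis using kG(3)[OF True z] m_le[OF True]
        by (simp add: W_def mult.assoc[symmetric] power_add[symmetric])
    next
      case False
      then show ?thesis using z by (simp add: W_def I_def)
    qed
  qed
  show thesis by (rule that[OF W Wp VW divisor_eqI[OF D W Wp VW]])
qed

text \<open>
  The section of \<open>mod_center\<close> with imaginary values; it lets quotient vectors be treated as
  octonions, on which automorphisms act.
\<close>

definition from_imaginary :: "complex ^ 7 \<Rightarrow> octonion_C" where
  "from_imaginary v = oct 0 (v $ 1) (v $ 2) (v $ 3) (v $ 4) (v $ 5) (v $ 6) (v $ 0)"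

lemma mod_center_from_imaginary: "mod_center (from_imaginary v) = v"
  by (simp add: vec_eq_iff forall_7 from_imaginary_def)

lemma mod_center_linear: "mod_center (x + y) = mod_center x + mod_center y"
  "mod_center (c *s x) = c *s mod_center x" "mod_center oct_one = 0"
  by (simp_all add: vec_eq_iff forall_7 oct_one_def)

lemma from_imaginary_mod_center: "x = x $ 0 *s oct_one + from_imaginary (mod_center x)"
  by (simp add: oct_eq_iff from_imaginary_def oct_one_def)

lemma from_imaginary_scale: "from_imaginary (c *s v) = c *s from_imaginary v"
  by (simp add: oct_eq_iff from_imaginary_def)

lemma mod_center_holomorphic: "vec_holomorphic_on F D \<Longrightarrow> vec_holomorphic_on (\<lambda>z. mod_center (F z)) D"
  by (simp add: vec_holomorphic_on_def forall_7)

lemma from_imaginary_holomorphic: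
  "vec_holomorphic_on F D \<Longrightarrow> vec_holomorphic_on (\<lambda>z. from_imaginary (F z)) D"
  by (simp add: vec_holomorphic_on_def forall_8 from_imaginary_def)

lemma cdiv_eqI:
  assumes D: "open D" "connected D" "p \<in> D" and W: "vec_holomorphic_on W D" "W p \<noteq> 0" "W p $ 0 = 0"
    and FW: "\<And>z. z \<in> D \<Longrightarrow> F z = c z *s oct_one + (z - p) ^ m *s W z"
  shows "cdiv D F p = int m"
  unfolding cdiv_def
proof (rule divisor_eqI[OF D mod_center_holomorphic[OF W(1)]])
  show "mod_center (W p) \<noteq> 0" using W(2,3) by (auto simp: vec_eq_iff forall_7 forall_8)
  show "mod_center (F z) = (z - p) ^ m *s mod_center (W z)" if "z \<in> D" for z
    unfolding FW[OF that] by (simp add: mod_center_linear)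
qed

lemma cdiv_factor:
  assumes D: "open D" "connected D" "p \<in> D" and F: "vec_holomorphic_on F D" "\<exists>z\<in>D. mod_center (F z) \<noteq> 0"
  obtains m W where "vec_holomorphic_on W D" "W p \<noteq> 0" "\<And>z. W z $ 0 = 0"
    "\<And>z. z \<in> D \<Longrightarrow> F z = F z $ 0 *s oct_one + (z - p) ^ m *s W z" "cdiv D F p = int m"
proof -
  obtain m W where W: "vec_holomorphic_on W D" "W p \<noteq> 0"
    "\<And>z. z \<in> D \<Longrightarrow> mod_center (F z) = (z - p) ^ m *s W z" "divisor D (\<lambda>z. mod_center (F z)) p = int m"
    by (rule divisor_factor[OF D mod_center_holomorphic[OF F(1)] F(2)]) blast+
  show thesis
  proof (rule that[of "\<lambda>z. from_imaginary (W z)" m])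
    show "vec_holomorphic_on (\<lambda>z. from_imaginary (W z)) D" by (rule from_imaginary_holomorphic[OF W(1)])
    have "mod_center (from_imaginary (W p)) \<noteq> mod_center 0"
      using W(2) mod_center_linear(2)[of 0 0] by (simp add: mod_center_from_imaginary)
    then show "from_imaginary (W p) \<noteq> 0" by metis
    show "from_imaginary (W z) $ 0 = 0" for z by (simp add: from_imaginary_def)
    show "F z = F z $ 0 *s oct_one + (z - p) ^ m *s from_imaginary (W z)" if "z \<in> D" for z
      using from_imaginary_mod_center[of "F z"] W(3)[OF that] by (simp add: from_imaginary_scale)
    show "cdiv D F p = int m" using W(4) by (simp add: cdiv_def)
  qed
qed

text \<open>
  Write the imaginary part of \<open>H\<close> as \<open>(z - p)\<^sup>m W\<close> with \<open>W p \<noteq> 0\<close>. Then that of \<open>F\<close> is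
  \<open>(z - p)\<^sup>m\<close> times \<open>\<phi> W\<close>, which is imaginary and nonzero at \<open>p\<close> since \<open>\<phi> p\<close> is injective.
\<close>

lemma G_moves_cdiv:
  assumes D: "open D" "connected D" and H: "vec_holomorphic_on H D" "\<exists>z\<in>D. mod_center (H z) \<noteq> 0"
    and move: "G_moves D H F"
  shows "cdiv D F = cdiv D H"
proof
  fix p show "cdiv D F p = cdiv D H p"
  proof (cases "p \<in> D")
    case True
    obtain m W where W: "vec_holomorphic_on W D" "W p \<noteq> 0" "\<And>z. W z $ 0 = 0"
      "\<And>z. z \<in> D \<Longrightarrow> H z = H z $ 0 *s oct_one + (z - p) ^ m *s W z" "cdiv D H p = int m"
      by (rule cdiv_factor[OF D True H]) blast+
    obtain \<phi> where \<phi>: "holomorphic_into_G_C D \<phi>" "\<forall>z\<in>D. F z = \<phi> z (H z)"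
      using move unfolding G_moves_def by (elim exE conjE)
    have G: "\<phi> z \<in> G_C" if "z \<in> D" for z using \<phi>(1) that by (simp add: holomorphic_into_G_C_def)
    have "G_moves D W (\<lambda>z. \<phi> z (W z))" unfolding G_moves_def using \<phi>(1) by blast
    from G_moves_holomorphic[OF this W(1)] have "cdiv D F p = int m"
    proof (rule cdiv_eqI[OF D True])
      show "\<phi> p (W p) \<noteq> 0" "\<phi> p (W p) $ 0 = 0"
        using G_C_linear(5)[OF G[OF True]] G_C_trace[OF G[OF True]] W(2,3) by auto
      fix z assume z: "z \<in> D"
      have "F z = \<phi> z (H z $ 0 *s oct_one + (z - p) ^ m *s W z)"
        using \<phi>(2) z W(4)[OF z] by metis
      then show "F z = H z $ 0 *s oct_one + (z - p) ^ m *s \<phi> z (W z)"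
        by (simp add: G_C_linear(1,2)[OF G[OF z]] G_C_one[OF G[OF z]])
    qed
    then show ?thesis using W(5) by simp
  qed (simp add: cdiv_def divisor_def)
qed

lemma cdiv_support:
  assumes D: "open D" "connected D" and F: "vec_holomorphic_on F D" "\<exists>z\<in>D. mod_center (F z) \<noteq> 0"
  shows "locally_finite_in {p\<in>D. cdiv D F p \<noteq> 0} D"
proof -
  obtain z0 i where i: "z0 \<in> D" "mod_center (F z0) $ i \<noteq> 0" using F(2) by (auto simp: vec_eq_iff)
  have hol: "(\<lambda>z. mod_center (F z) $ i) holomorphic_on D"
    using mod_center_holomorphic[OF F(1)] by (simp add: vec_holomorphic_on_def)
  have "locally_finite_in {z\<in>D. mod_center (F z) $ i = 0} D"
    by (rule zeros_locally_finite[OF D hol]) (use i in blast)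
  moreover have "{p\<in>D. cdiv D F p \<noteq> 0} \<subseteq> {z\<in>D. mod_center (F z) $ i = 0}"
  proof
    fix p assume p: "p \<in> {p\<in>D. cdiv D F p \<noteq> 0}"
    then have pD: "p \<in> D" by simp
    obtain m W where W: "\<And>z. z \<in> D \<Longrightarrow> F z = F z $ 0 *s oct_one + (z - p) ^ m *s W z" "cdiv D F p = int m"
      by (rule cdiv_factor[OF D pD F]) blast
    have "m > 0" using p W(2) by simp
    then have "mod_center (F p) = 0"
      using arg_cong[OF W(1)[OF pD], of mod_center] by (simp add: mod_center_linear)
    then show "p \<in> {z\<in>D. mod_center (F z) $ i = 0}" using pD by simp
  qed
  ultimately show ?thesis by (rule locally_finite_in_subset)
qed

section \<open>Equal invariants imply holomorphic conjugacy\<close>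

text \<open>
  Dividing the imaginary part by a function with the same divisor leaves a nowhere vanishing vector.
\<close>

lemma primitive_part:
  assumes D: "open D" "connected D" and F: "vec_holomorphic_on F D" "\<exists>z\<in>D. mod_center (F z) \<noteq> 0"
    and g: "g holomorphic_on D" "\<And>p. p \<in> D \<Longrightarrow> \<exists>G. G holomorphic_on D \<and> G p \<noteq> 0 \<and>
      (\<forall>z\<in>D. g z = (z - p) ^ nat (cdiv D F p) * G z)"
    and g_nz: "\<exists>z\<in>D. g z \<noteq> 0"
  obtains V where "vec_holomorphic_on V D" "\<And>z. z \<in> D \<Longrightarrow> V z $ 0 = 0" "\<And>z. z \<in> D \<Longrightarrow> V z \<noteq> 0"
    "\<And>z. z \<in> D \<Longrightarrow> F z = F z $ 0 *s oct_one + g z *s V z"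
proof -
  define N where "N z = F z - F z $ 0 *s oct_one" for z
  have Nhol: "(\<lambda>z. N z $ i) holomorphic_on D" for i
    using F(1) unfolding N_def vec_holomorphic_on_def by (auto intro!: holomorphic_intros)
  have loc: "\<exists>W G r. vec_holomorphic_on W D \<and> G holomorphic_on D \<and> W p \<noteq> 0 \<and> r > 0 \<and> ball p r \<subseteq> D \<and>
      (\<forall>z\<in>ball p r. G z \<noteq> 0) \<and> (\<forall>z\<in>D. N z = (z - p) ^ nat (cdiv D F p) *s W z) \<and>
      (\<forall>z\<in>D. g z = (z - p) ^ nat (cdiv D F p) * G z)" if p: "p \<in> D" for p
  proof -
    obtain m W where W: "vec_holomorphic_on W D" "W p \<noteq> 0"
      "\<And>z. z \<in> D \<Longrightarrow> F z = F z $ 0 *s oct_one + (z - p) ^ m *s W z" "cdiv D F p = int m"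
      by (rule cdiv_factor[OF D p F]) blast
    obtain G where G: "G holomorphic_on D" "G p \<noteq> 0" "\<forall>z\<in>D. g z = (z - p) ^ nat (cdiv D F p) * G z"
      using g(2)[OF p] by (elim exE conjE)
    have "\<exists>z\<in>D. G z \<noteq> 0" using G(2) p by blast
    then obtain r where r: "r > 0" "ball p r \<subseteq> D" "\<And>z. z \<in> ball p r - {p} \<Longrightarrow> G z \<noteq> 0"
      using zeros_isolated[OF D G(1) _ p] by metis
    have "G z \<noteq> 0" if "z \<in> ball p r" for z using r(3)[of z] G(2) that by auto
    moreover have "N z = (z - p) ^ nat (cdiv D F p) *s W z" if "z \<in> D" for z
    proof -
      have "N z = (F z $ 0 *s oct_one + (z - p) ^ m *s W z) - F z $ 0 *s oct_one"
        unfolding N_def using W(3)[OF that] by (rule arg_cong)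
      then show ?thesis using W(4) by simp
    qed
    ultimately show ?thesis using W(1,2) G(1,3) r(1,2) by blast
  qed
  have "\<exists>h. h holomorphic_on D \<and> (\<forall>z\<in>D. N z $ i = g z * h z)" for i
  proof -
    obtain h where "h holomorphic_on D" "\<And>z. z \<in> D \<Longrightarrow> N z $ i = g z * h z"
    proof (rule local_quotient[of D "\<lambda>z. N z $ i" g])
      fix p assume p: "p \<in> D"
      show "\<exists>r>0. \<forall>z\<in>ball p r - {p}. g z \<noteq> 0" using zeros_isolated[OF D g(1) g_nz p] by metis
      obtain W G r where WG: "vec_holomorphic_on W D" "G holomorphic_on D" "r > 0" "ball p r \<subseteq> D"
        "\<forall>z\<in>ball p r. G z \<noteq> 0" "\<forall>z\<in>D. N z = (z - p) ^ nat (cdiv D F p) *s W z"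
        "\<forall>z\<in>D. g z = (z - p) ^ nat (cdiv D F p) * G z"
        using loc[OF p] by (elim exE conjE)
      have "(\<lambda>z. W z $ i / G z) holomorphic_on ball p r"
        using WG(1,2,4,5) unfolding vec_holomorphic_on_def
        by (intro holomorphic_intros) (auto intro: holomorphic_on_subset)
      moreover have "N z $ i = g z * (W z $ i / G z)" if "z \<in> ball p r" for z
      proof -
        have "z \<in> D" "G z \<noteq> 0" using that WG(4,5) by auto
        then show ?thesis using WG(6,7) by simp
      qed
      ultimately show "\<exists>r>0. \<exists>q. q holomorphic_on ball p r \<and> (\<forall>z\<in>ball p r. N z $ i = g z * q z)"
        using WG(3) by blast
    qed blast
    then show ?thesis by blast
  qed
  then obtain h where h: "\<And>i. h i holomorphic_on D" "\<And>i z. z \<in> D \<Longrightarrow> N z $ i = g z * h i z"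
    by metis
  define V where "V z = (\<chi> i. if i = 0 then 0 else h i z)" for z
  have N0: "N z $ 0 = 0" for z by (simp add: N_def oct_one_def)
  have NV: "N z = g z *s V z" if "z \<in> D" for z
    using h(2)[OF that] N0[of z] by (simp add: vec_eq_iff V_def)
  show thesis
  proof (rule that[of V])
    show V: "vec_holomorphic_on V D"
      unfolding vec_holomorphic_on_def
    proof
      fix i show "(\<lambda>z. V z $ i) holomorphic_on D"
        using h(1)[of i] by (cases "i = 0") (simp_all add: V_def)
    qed
    show "V z $ 0 = 0" for z by (simp add: V_def)
    show "F z = F z $ 0 *s oct_one + g z *s V z" if "z \<in> D" for z
      using NV[OF that] by (simp add: N_def algebra_simps)
    fix p assume p: "p \<in> D"
    obtain W G where WG: "vec_holomorphic_on W D" "G holomorphic_on D" "W p \<noteq> 0"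
        "\<forall>z\<in>D. N z = (z - p) ^ nat (cdiv D F p) *s W z"
        "\<forall>z\<in>D. g z = (z - p) ^ nat (cdiv D F p) * G z"
      using loc[OF p] by (elim exE conjE)
    obtain i where i: "W p $ i \<noteq> 0" using WG(3) by (auto simp: vec_eq_iff)
    have "W p $ i = G p * V p $ i"
    proof (rule holomorphic_eq_at_limit[OF D(1) p])
      show "(\<lambda>z. W z $ i) holomorphic_on D" "(\<lambda>z. G z * V z $ i) holomorphic_on D"
        using WG(1,2) V by (auto simp: vec_holomorphic_on_def intro!: holomorphic_intros)
      fix z assume z: "z \<in> D" "z \<noteq> p"
      have "(z - p) ^ nat (cdiv D F p) * W z $ i = (z - p) ^ nat (cdiv D F p) * (G z * V z $ i)"
        using arg_cong[OF NV[OF z(1)], of "\<lambda>v. v $ i"] WG(4,5) z(1) by (simp add: mult.assoc)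
      then show "W z $ i = G z * V z $ i" using z(2) by simp
    qed
    then show "V p \<noteq> 0" using i by auto
  qed
qed

lemma G_moves_cong:
  assumes "G_moves D V W" "\<And>z. z \<in> D \<Longrightarrow> V' z = V z" "\<And>z. z \<in> D \<Longrightarrow> W' z = W z"
  shows "G_moves D V' W'"
  using assms unfolding G_moves_def by simp

text \<open>
  Both maps are conjugate to the same normal form, since it involves only the norm.
\<close>

lemma nonvanishing_imaginary_G_moves:
  assumes D: "open D" "connected D"
    and V: "vec_holomorphic_on V D" "\<And>z. z \<in> D \<Longrightarrow> V z $ 0 = 0" "\<And>z. z \<in> D \<Longrightarrow> V z \<noteq> 0"
    and W: "vec_holomorphic_on W D" "\<And>z. z \<in> D \<Longrightarrow> W z $ 0 = 0" "\<And>z. z \<in> D \<Longrightarrow> W z \<noteq> 0"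
    and norm: "\<And>z. z \<in> D \<Longrightarrow> (\<Sum>i\<in>UNIV. (V z $ i)\<^sup>2) = (\<Sum>i\<in>UNIV. (W z $ i)\<^sup>2)"
  shows "G_moves D V W"
proof -
  have adm: "admissible D (\<lambda>z. to_zorn (U z))"
    if "vec_holomorphic_on U D" "\<And>z. z \<in> D \<Longrightarrow> U z $ 0 = 0" "\<And>z. z \<in> D \<Longrightarrow> U z \<noteq> 0" for U
    unfolding admissible_def
  proof (intro conjI ballI)
    fix z assume z: "z \<in> D"
    show "to_zorn (U z) $ 4 = - to_zorn (U z) $ 0" using that(2)[OF z] by (simp add: to_zorn_def)
    show "to_zorn (U z) \<noteq> 0" using that(3)[OF z] from_zorn_eq_0[of "to_zorn (U z)"] by (simp add: from_to_zorn)
  qed (rule to_zorn_holomorphic[OF that(1)])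
  obtain Y where Y: "zorn_equiv D Y (\<lambda>z. to_zorn (V z))"
    "\<And>z. z \<in> D \<Longrightarrow> Y z = oct 0 1 0 0 0 (- zorn_norm (to_zorn (V z))) 0 0"
    by (rule zorn_normal_form[OF D adm[OF V]]) blast+
  obtain Y' where Y': "zorn_equiv D Y' (\<lambda>z. to_zorn (W z))"
    "\<And>z. z \<in> D \<Longrightarrow> Y' z = oct 0 1 0 0 0 (- zorn_norm (to_zorn (W z))) 0 0"
    by (rule zorn_normal_form[OF D adm[OF W]]) blast+
  have VY: "G_moves D V (\<lambda>z. from_zorn (Y z))" and YW: "G_moves D (\<lambda>z. from_zorn (Y' z)) W"
    using Y(1) Y'(1) by (simp_all add: zorn_equiv_def G_equiv_def from_to_zorn)
  have "Y z = Y' z" if "z \<in> D" for z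
    using Y(2)[OF that] Y'(2)[OF that] norm[OF that] by (simp add: zorn_norm_eq[symmetric] from_to_zorn)
  then have "G_moves D V (\<lambda>z. from_zorn (Y' z))" by (intro G_moves_cong[OF VY]) simp_all
  then show ?thesis using YW by (rule G_moves_trans)
qed

text \<open>
  The imaginary parts are \<open>g V\<close> and \<open>g W\<close>, where \<open>g\<close> has the common central divisor. Equality of the
  norms of \<open>V\<close> and \<open>W\<close> follows from that of \<open>F\<close> and \<open>H\<close> off the zeros of \<open>g\<close>, and at the zeros by
  continuity. An automorphism taking \<open>W\<close> to \<open>V\<close> takes \<open>H\<close> to \<open>F\<close>, as it fixes the center.
\<close>

theorem same_invariants_imp_G_moves:
  assumes D: "open D" "connected D" and F: "vec_holomorphic_on F D" "\<exists>z\<in>D. mod_center (F z) \<noteq> 0"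
    and H: "vec_holomorphic_on H D" "\<exists>z\<in>D. mod_center (H z) \<noteq> 0"
    and cd: "cdiv D F = cdiv D H"
    and tr: "\<And>z. z \<in> D \<Longrightarrow> F z $ 0 = H z $ 0"
    and norm: "\<And>z. z \<in> D \<Longrightarrow> (\<Sum>i\<in>UNIV. (F z $ i)\<^sup>2) = (\<Sum>i\<in>UNIV. (H z $ i)\<^sup>2)"
  shows "G_moves D H F"
proof -
  let ?S = "{p\<in>D. cdiv D F p \<noteq> 0}"
  obtain g where g: "g holomorphic_on D" "\<And>z. z \<in> D - ?S \<Longrightarrow> g z \<noteq> 0"
    "\<And>p. p \<in> ?S \<Longrightarrow> \<exists>G. G holomorphic_on D \<and> G p \<noteq> 0 \<and> (\<forall>z\<in>D. g z = (z - p) ^ nat (cdiv D F p) * G z)"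
    by (rule Weierstrass_divisor[OF D(1) cdiv_support[OF D F], where m = "\<lambda>p. nat (cdiv D F p)"]) blast+
  have gG: "\<exists>G. G holomorphic_on D \<and> G p \<noteq> 0 \<and> (\<forall>z\<in>D. g z = (z - p) ^ nat (cdiv D F p) * G z)"
    if "p \<in> D" for p
  proof (cases "p \<in> ?S")
    case True then show ?thesis by (rule g(3))
  next
    case False
    then show ?thesis using g(1,2) that by (intro exI[of _ g]) auto
  qed
  have g_nz: "\<exists>z\<in>D. g z \<noteq> 0"
  proof (rule ccontr)
    assume all0: "\<not> ?thesis"
    obtain p where p: "p \<in> D" using F(2) by blast
    obtain G where G: "G holomorphic_on D" "G p \<noteq> 0" "\<forall>z\<in>D. g z = (z - p) ^ nat (cdiv D F p) * G z"
      using gG[OF p] by (elim exE conjE)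
    have "G p = 0"
      by (rule holomorphic_eq_at_limit[OF D(1) p G(1), of "\<lambda>_. 0"]) (use all0 G(3) in auto)
    with G(2) show False by simp
  qed
  obtain V where V: "vec_holomorphic_on V D" "\<And>z. z \<in> D \<Longrightarrow> V z $ 0 = 0" "\<And>z. z \<in> D \<Longrightarrow> V z \<noteq> 0"
    "\<And>z. z \<in> D \<Longrightarrow> F z = F z $ 0 *s oct_one + g z *s V z"
    by (rule primitive_part[OF D F g(1) gG g_nz]) blast+
  obtain W where W: "vec_holomorphic_on W D" "\<And>z. z \<in> D \<Longrightarrow> W z $ 0 = 0" "\<And>z. z \<in> D \<Longrightarrow> W z \<noteq> 0"
    "\<And>z. z \<in> D \<Longrightarrow> H z = H z $ 0 *s oct_one + g z *s W z"
    by (rule primitive_part[OF D H g(1) gG[unfolded cd] g_nz]) blast+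
  have sq: "(\<Sum>i\<in>UNIV. (a $ i)\<^sup>2) = (a $ 0)\<^sup>2 + c\<^sup>2 * (\<Sum>i\<in>UNIV. (v $ i)\<^sup>2)"
    if av: "a = a $ 0 *s oct_one + c *s v" "v $ 0 = 0" for a v :: octonion_C and c
  proof -
    have "a $ i = c * v $ i" if "i \<in> {1, 2, 3, 4, 5, 6, 7}" for i
    proof -
      have "a $ i = a $ 0 * oct_one $ i + c * v $ i"
        using arg_cong[OF av(1), of "\<lambda>v. v $ i"]
        by (simp only: vector_add_component vector_smult_component)
      then show ?thesis using that by (auto simp: oct_one_def)
    qed
    then show ?thesis unfolding sum_8 using av(2) by (simp add: power_mult_distrib distrib_left)
  qed
  have VW: "(\<Sum>i\<in>UNIV. (V z $ i)\<^sup>2) = (\<Sum>i\<in>UNIV. (W z $ i)\<^sup>2)" if z: "z \<in> D" for z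
  proof -
    have off: "(\<Sum>i\<in>UNIV. (V x $ i)\<^sup>2) = (\<Sum>i\<in>UNIV. (W x $ i)\<^sup>2)" if "x \<in> D" "g x \<noteq> 0" for x
      using sq[OF V(4,2)[OF that(1)]] sq[OF W(4,2)[OF that(1)]] tr[OF that(1)] norm[OF that(1)] that(2) by simp
    obtain r where r: "r > 0" "ball z r \<subseteq> D" "\<And>x. x \<in> ball z r - {z} \<Longrightarrow> g x \<noteq> 0"
      using zeros_isolated[OF D g(1) g_nz z] by metis
    show ?thesis
    proof (rule holomorphic_eq_at_limit[of "ball z r" z "\<lambda>x. \<Sum>i\<in>UNIV. (V x $ i)\<^sup>2"
          "\<lambda>x. \<Sum>i\<in>UNIV. (W x $ i)\<^sup>2"])
      show "(\<lambda>x. \<Sum>i\<in>UNIV. (V x $ i)\<^sup>2) holomorphic_on ball z r"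
        "(\<lambda>x. \<Sum>i\<in>UNIV. (W x $ i)\<^sup>2) holomorphic_on ball z r"
        using V(1) W(1) unfolding vec_holomorphic_on_def
        by (intro holomorphic_intros; blast intro: holomorphic_on_subset[OF _ r(2)])+
      show "(\<Sum>i\<in>UNIV. (V x $ i)\<^sup>2) = (\<Sum>i\<in>UNIV. (W x $ i)\<^sup>2)" if "x \<in> ball z r" "x \<noteq> z" for x
        using that r by (intro off) auto
    qed (use r(1) in auto)
  qed
  have "G_moves D W V" by (rule nonvanishing_imaginary_G_moves[OF D W(1-3) V(1-3)]) (simp_all add: VW)
  then obtain \<phi> where \<phi>: "holomorphic_into_G_C D \<phi>" "\<forall>z\<in>D. V z = \<phi> z (W z)"
    unfolding G_moves_def by (elim exE conjE)
  have "F z = \<phi> z (H z)" if z: "z \<in> D" for z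
  proof -
    have G: "\<phi> z \<in> G_C" using \<phi>(1) z by (simp add: holomorphic_into_G_C_def)
    have "\<phi> z (H z) = \<phi> z (H z $ 0 *s oct_one + g z *s W z)" using W(4)[OF z] by (rule arg_cong)
    also have "\<dots> = F z $ 0 *s oct_one + g z *s V z"
      using \<phi>(2) z tr[OF z] by (simp add: G_C_linear(1,2)[OF G] G_C_one[OF G])
    also have "\<dots> = F z" by (rule V(4)[OF z, symmetric])
    finally show ?thesis ..
  qed
  then show ?thesis unfolding G_moves_def using \<phi>(1) by blast
qed

section \<open>Slice functions and their stem functions\<close>

lemma corresponding_stem_cong:
  assumes "symmetric_domain D" "corresponding_stem D f F" "\<And>z. z \<in> D \<Longrightarrow> F' z = F z"
  shows "corresponding_stem D f F'"
proof -
  have "cnj z \<in> D" if "z \<in> D" for z using assms(1) that unfolding symmetric_domain_def by blast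
  then show ?thesis using assms(2,3) by (simp add: corresponding_stem_def stem_function_def)
qed

text \<open>
  A slice function determines its stem function, so every comparison of slice functions can be made
  on \<open>D\<close>.
\<close>

lemma slice_eq_iff_stem_eq:
  assumes "corresponding_stem D f F" "corresponding_stem D h H"
  shows "(\<forall>q\<in>axial_domain D. f q = h q) \<longleftrightarrow> (\<forall>z\<in>D. F z = H z)"
proof
  assume eq: "\<forall>q\<in>axial_domain D. f q = h q"
  have "corresponding_stem D f H"
    unfolding corresponding_stem_def
  proof (intro conjI allI impI)
    show "stem_function D H" using assms(2) by (simp add: corresponding_stem_def)
    fix x y J assume J: "J \<in> sphere_O" and xy: "Complex x y \<in> D"
    then have "axial x y J \<in> axial_domain D" by (auto simp: axial_domain_def)
    then show "f (axial x y J) = octC_Re (H (Complex x y)) + J \<odot> octC_Im (H (Complex x y))"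
      using eq assms(2) J xy by (simp add: corresponding_stem_def)
  qed
  then show "\<forall>z\<in>D. F z = H z" using corresponding_stem_unique[OF assms(1)] by blast
next
  assume "\<forall>z\<in>D. F z = H z"
  then show "\<forall>q\<in>axial_domain D. f q = h q"
    using assms by (auto simp: axial_domain_def corresponding_stem_def)
qed

lemma octC_Re_Im_simps:
  "octC_Re (x + y) = octC_Re x + octC_Re y" "octC_Im (x + y) = octC_Im x + octC_Im y"
  "octC_cnj (x + y) = octC_cnj x + octC_cnj y"
  "octC_cnj (x \<odot> y) = octC_cnj x \<odot> octC_cnj y" "octC_cnj (oct_conj x) = oct_conj (octC_cnj x)"
  by (simp_all add: oct_eq_iff octC_Re_def octC_Im_def octC_cnj_def complexify_def oct_mult_def
      oct_conj_def complex_eq_iff)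

lemma oct_mult_distrib_left: "x \<odot> (y + z) = x \<odot> y + x \<odot> z" for x :: "'a::comm_ring_1 ^ 8"
  by (simp add: oct_eq_iff oct_mult_def algebra_simps)

lemma corresponding_stem_slice_conj:
  assumes D: "symmetric_domain D" and f: "corresponding_stem D f F"
  shows "corresponding_stem D (slice_conj D f) (stem_conj F)"
proof (rule corresponding_stem_cong[OF D])
  have "stem_function D (stem_of D f)"
    using f corresponding_stem_stem_of unfolding slice_function_def corresponding_stem_def by blast
  then have "stem_function D (stem_conj (stem_of D f))"
    by (simp add: stem_function_def stem_conj_def octC_Re_Im_simps)
  then show "corresponding_stem D (slice_conj D f) (stem_conj (stem_of D f))"
    unfolding slice_conj_def by (rule corresponding_stem_slice_of)
  show "stem_conj F z = stem_conj (stem_of D f) z" if "z \<in> D" for z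
    using stem_of_eq[OF f that] by (simp add: stem_conj_def)
qed

lemma corresponding_stem_slice_star:
  assumes D: "symmetric_domain D" and f: "corresponding_stem D f F" and g: "corresponding_stem D g G"
  shows "corresponding_stem D (slice_star D f g) (\<lambda>z. F z \<odot> G z)"
proof (rule corresponding_stem_cong[OF D])
  have "stem_function D (stem_of D f)" "stem_function D (stem_of D g)"
    using f g corresponding_stem_stem_of unfolding slice_function_def corresponding_stem_def by blast+
  then have "stem_function D (\<lambda>z. stem_of D f z \<odot> stem_of D g z)"
    by (simp add: stem_function_def octC_Re_Im_simps)
  then show "corresponding_stem D (slice_star D f g) (\<lambda>z. stem_of D f z \<odot> stem_of D g z)"
    unfolding slice_star_def by (rule corresponding_stem_slice_of)
  show "F z \<odot> G z = stem_of D f z \<odot> stem_of D g z" if "z \<in> D" for z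
    using stem_of_eq[OF f that] stem_of_eq[OF g that] by simp
qed

lemma corresponding_stem_slice_Tr:
  assumes D: "symmetric_domain D" and f: "corresponding_stem D f F"
  shows "corresponding_stem D (slice_Tr D f) (stem_Tr F)"
  using f corresponding_stem_slice_conj[OF D f]
  by (simp add: corresponding_stem_def slice_Tr_def stem_Tr_def stem_function_def octC_Re_Im_simps
      oct_mult_distrib_left)

lemma corresponding_stem_slice_N:
  assumes D: "symmetric_domain D" and f: "corresponding_stem D f F"
  shows "corresponding_stem D (slice_N D f) (stem_N F)"
  unfolding slice_N_def stem_N_def
  by (rule corresponding_stem_slice_star[OF D f corresponding_stem_slice_conj[OF D f]])

lemma slice_preserving_iff:
  assumes D: "symmetric_domain D" and f: "corresponding_stem D f F"
  shows "slice_preserving D f \<longleftrightarrow> (\<forall>z\<in>D. mod_center (F z) = 0)"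
proof -
  have "a = - a \<longleftrightarrow> a = 0" for a :: complex by (auto simp: complex_eq_iff)
  then have "x = oct_conj x \<longleftrightarrow> mod_center x = 0" for x :: octonion_C
    by (auto simp: oct_eq_iff vec_eq_iff forall_7 oct_conj_def)
  then show ?thesis
    unfolding slice_preserving_def slice_eq_iff_stem_eq[OF f corresponding_stem_slice_conj[OF D f]]
    by (simp add: stem_conj_def)
qed

lemma same_slice_invariants_iff:
  assumes D: "symmetric_domain D" and f: "corresponding_stem D f F" and h: "corresponding_stem D h H"
  shows "same_slice_invariants D f h \<longleftrightarrow> same_stem_invariants D F H"
proof -
  have "open D" using D by (simp add: symmetric_domain_def)
  have cd: "cdiv D (stem_of D f) = cdiv D F" if f: "corresponding_stem D f F" for f F
    unfolding cdiv_def by (rule divisor_cong[OF \<open>open D\<close>]) (simp add: stem_of_eq[OF f])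
  show ?thesis
    unfolding same_slice_invariants_def same_stem_invariants_def slice_cdiv_def cd[OF f] cd[OF h]
      slice_eq_iff_stem_eq[OF corresponding_stem_slice_Tr[OF D f] corresponding_stem_slice_Tr[OF D h]]
      slice_eq_iff_stem_eq[OF corresponding_stem_slice_N[OF D f] corresponding_stem_slice_N[OF D h]] ..
qed

lemma stem_Tr_eq: "stem_Tr F z = (2 * F z $ 0) *s oct_one"
  by (simp add: oct_eq_iff stem_Tr_def stem_conj_def oct_conj_def oct_one_def)

lemma stem_N_eq: "stem_N F z = (\<Sum>i\<in>UNIV. (F z $ i)\<^sup>2) *s oct_one"
  by (simp add: oct_eq_iff stem_N_def stem_conj_def oct_conj_def oct_one_def oct_mult_def sum_8 power2_eq_square)

lemma scalar_oct_one_inject: "a *s (oct_one :: octonion_C) = b *s oct_one \<longleftrightarrow> a = b"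
  by (auto simp: oct_eq_iff oct_one_def)

lemma same_stem_invariants_iff:
  "same_stem_invariants D F H \<longleftrightarrow> cdiv D F = cdiv D H \<and> (\<forall>z\<in>D. F z $ 0 = H z $ 0) \<and>
     (\<forall>z\<in>D. (\<Sum>i\<in>UNIV. (F z $ i)\<^sup>2) = (\<Sum>i\<in>UNIV. (H z $ i)\<^sup>2))"
  unfolding same_stem_invariants_def stem_Tr_eq stem_N_eq scalar_oct_one_inject by simp

lemma slice_regular_stem_holomorphic:
  assumes "slice_regular D f" "corresponding_stem D f F"
  shows "vec_holomorphic_on F D"
proof -
  obtain F' where F': "corresponding_stem D f F'" "vec_holomorphic_on F' D"
    using assms(1) unfolding slice_regular_def by blast
  have "F z = F' z" if "z \<in> D" for z by (rule corresponding_stem_unique[OF assms(2) F'(1) that])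
  then show ?thesis using F'(2) unfolding vec_holomorphic_on_def by (simp cong: holomorphic_cong)
qed

lemma all_equivalent_4I:
  assumes "A \<longleftrightarrow> B" "B \<Longrightarrow> E" "E \<Longrightarrow> C" "C \<Longrightarrow> B"
  shows "all_equivalent [A, B, C, E]"
  using assms by (auto simp: all_equivalent_def)

theorem theorem2p1:
  fixes D :: "complex set"
    and f h :: "octonion \<Rightarrow> octonion"
    and F H :: "complex \<Rightarrow> octonion_C"
  assumes "symmetric_domain D"
    and "slice_regular D f" and "slice_regular D h"
    and "corresponding_stem D f F" and "corresponding_stem D h H"
  shows "(\<not> slice_preserving D f \<and> \<not> slice_preserving D h \<longrightarrow>
           all_equivalent
            [same_slice_invariants D f h,
             same_stem_invariants D F H,
             cdiv D F = cdiv D H \<and> (\<forall>z\<in>D. \<exists>\<alpha>\<in>G_C. F z = \<alpha> (H z)),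
             \<exists>\<phi>. holomorphic_into_G_C D \<phi> \<and> (\<forall>z\<in>D. F z = \<phi> z (H z))])
       \<and> (slice_preserving D f \<longrightarrow>
           all_equivalent
            [\<forall>q\<in>axial_domain D. f q = h q,
             \<forall>z\<in>D. F z = H z,
             \<forall>z\<in>D. \<exists>\<alpha>\<in>G_C. F z = \<alpha> (H z),
             \<exists>\<phi>. holomorphic_into_G_C D \<phi> \<and> (\<forall>z\<in>D. F z = \<phi> z (H z))])"
proof -
  note sym = assms(1) and f = assms(4) and h = assms(5)
  have D: "open D" "connected D" using sym by (auto simp: symmetric_domain_def)
  have F: "vec_holomorphic_on F D" and H: "vec_holomorphic_on H D"
    using slice_regular_stem_holomorphic assms(2-5) by auto
  have pointwise: "\<forall>z\<in>D. \<exists>\<alpha>\<in>G_C. F z = \<alpha> (H z)" if "G_moves D H F"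
    using that unfolding G_moves_def holomorphic_into_G_C_def by blast
  have "all_equivalent [same_slice_invariants D f h, same_stem_invariants D F H,
      cdiv D F = cdiv D H \<and> (\<forall>z\<in>D. \<exists>\<alpha>\<in>G_C. F z = \<alpha> (H z)), G_moves D H F]"
    if "\<not> slice_preserving D f" "\<not> slice_preserving D h"
  proof -
    have nF: "\<exists>z\<in>D. mod_center (F z) \<noteq> 0" and nH: "\<exists>z\<in>D. mod_center (H z) \<noteq> 0"
      using that slice_preserving_iff[OF sym f] slice_preserving_iff[OF sym h] by auto
    have i_iff_ii: "same_slice_invariants D f h \<longleftrightarrow> same_stem_invariants D F H"
      by (rule same_slice_invariants_iff[OF sym f h])
    have ii_iv: "G_moves D H F" if "same_stem_invariants D F H"
      by (rule same_invariants_imp_G_moves[OF D F nF H nH]) (use that in \<open>simp_all add: same_stem_invariants_iff\<close>)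
    have iv_iii: "cdiv D F = cdiv D H \<and> (\<forall>z\<in>D. \<exists>\<alpha>\<in>G_C. F z = \<alpha> (H z))" if "G_moves D H F"
      using G_moves_cdiv[OF D H nH that] pointwise[OF that] by blast
    have iii_ii: "same_stem_invariants D F H"
      if iii: "cdiv D F = cdiv D H \<and> (\<forall>z\<in>D. \<exists>\<alpha>\<in>G_C. F z = \<alpha> (H z))"
      unfolding same_stem_invariants_iff
    proof (intro conjI ballI)
      fix z assume "z \<in> D"
      then obtain \<alpha> where "\<alpha> \<in> G_C" "F z = \<alpha> (H z)" using iii by blast
      then show "F z $ 0 = H z $ 0" "(\<Sum>i\<in>UNIV. (F z $ i)\<^sup>2) = (\<Sum>i\<in>UNIV. (H z $ i)\<^sup>2)"
        by (simp_all add: G_C_trace G_C_norm)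
    qed (use iii in blast)
    show ?thesis by (rule all_equivalent_4I[OF i_iff_ii ii_iv iv_iii iii_ii])
  qed
  note a = this
  have b: "all_equivalent [\<forall>q\<in>axial_domain D. f q = h q, \<forall>z\<in>D. F z = H z,
      \<forall>z\<in>D. \<exists>\<alpha>\<in>G_C. F z = \<alpha> (H z), G_moves D H F]" if "slice_preserving D f"
  proof -
    have i_iff_ii: "(\<forall>q\<in>axial_domain D. f q = h q) \<longleftrightarrow> (\<forall>z\<in>D. F z = H z)"
      by (rule slice_eq_iff_stem_eq[OF f h])
    have ii_iv: "G_moves D H F" if "\<forall>z\<in>D. F z = H z"
      unfolding G_moves_def by (rule exI[of _ "\<lambda>z x. x"]) (use that holomorphic_into_G_C_id in auto)
    have iii_ii: "\<forall>z\<in>D. F z = H z" if iii: "\<forall>z\<in>D. \<exists>\<alpha>\<in>G_C. F z = \<alpha> (H z)"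
    proof
      fix z assume z: "z \<in> D"
      then obtain \<alpha> where \<alpha>: "\<alpha> \<in> G_C" "F z = \<alpha> (H z)" using iii by blast
      have "mod_center (F z) = 0" using \<open>slice_preserving D f\<close> slice_preserving_iff[OF sym f] z by simp
      then have "F z \<in> center_C" by (simp add: center_C_eq_kernel)
      then obtain c where c: "F z = c *s oct_one" by (auto simp: center_C_def)
      then have "\<alpha> (c *s oct_one) = \<alpha> (H z)"
        using \<alpha>(2) by (simp add: G_C_linear(2)[OF \<alpha>(1)] G_C_one[OF \<alpha>(1)])
      then show "F z = H z" using c by (simp add: G_C_linear(6)[OF \<alpha>(1)])
    qed
    show ?thesis by (rule all_equivalent_4I[OF i_iff_ii ii_iv pointwise iii_ii])
  qed
  show ?thesis
    unfolding G_moves_def[symmetric]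
  proof (intro conjI impI)
    assume "\<not> slice_preserving D f \<and> \<not> slice_preserving D h"
    then show "all_equivalent [same_slice_invariants D f h, same_stem_invariants D F H,
        cdiv D F = cdiv D H \<and> (\<forall>z\<in>D. \<exists>\<alpha>\<in>G_C. F z = \<alpha> (H z)), G_moves D H F]"
      by (intro a) simp_all
  qed (rule b)
qed

end
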